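(* Let $(u,\boldsymbol q)$ be the solution of the model problem, let $(u_h,\boldsymbol q_h)\in\mathcal V_h^{p-1}\times\boldsymbol{\mathcal H}_h^p$ be the solution of the discrete mixed problem (MFEM), and let $\nu_h\in\mathcal V_h^{p+1}$ be the residual-minimization postprocessed solution (RM). Then, for all $K\in\mathcal T_h$, $$\|u-\nu_h\|_K\le\frac{h_K}{\pi}\Big(\|\boldsymbol q-\boldsymbol q_h\|_K+\big\|\nabla\big(u-Q_K^{p+1}u|_K\big)\big\|_K\Big)+\big\|u_h-Q_K^{p-1}u|_K\big\|_K+\big\|u-Q_K^{p+1}u|_K\big\|_K .$$
   Context: Let $\Omega\subset\mathbb R^d$ ($d=2,3$) be a polyhedral Lipschitz domain, and $\{\mathcal T_h\}_{h>0}$ a family of conforming, shape-regular simplicial meshes of $\Omega$; $h_K$ is the diameter of $K$. For $D\subset\overline\Omega$, $(\cdot,\cdot)_D$ and $\|\cdot\|_D$ are the $L^2(D)$ inner product and norm (scalar or vector-valued functions); $(\cdot,\cdot)_{\mathcal T_h}=\sum_{K\in\mathcal T_h}(\cdot,\cdot)_K$. Fix an integer $p\ge1$, $f\in L^2(\Omega)$ and $u_D\in H^{1/2}(\partial\Omega)$. For an integer $r\ge0$ and $K\in\mathcal T_h$: $\mathcal V_K^r$ is the space of polynomials on $K$ of total degree $\le r$; $\mathcal V_{*,K}^r=\{v\in\mathcal V_K^r:(v,1)_K=0\}$; $\mathcal V_h^r=\{v\in L^2(\Omega):v|_K\in\mathcal V_K^r\ \forall K\in\mathcal T_h\}$; $\boldsymbol{\mathcal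 H}_h^r=\{\boldsymbol v\in H(\operatorname{div},\Omega):\boldsymbol v|_K\in(\mathcal V_K^r)^d\ \forall K\in\mathcal T_h\}$. $Q_K^r:L^2(K)\to\mathcal V_K^r$ is the $L^2(K)$-orthogonal projection. Model problem: $u\in H^1(\Omega)$ is the weak solution of $-\Delta u=f$ in $\Omega$, $u=u_D$ on $\partial\Omega$, and $\boldsymbol q=-\nabla u\in H(\operatorname{div},\Omega)$. (MFEM) Find $(u_h,\boldsymbol q_h)\in\mathcal V_h^{p-1}\times\boldsymbol{\mathcal H}_h^p$ such that $(\boldsymbol q_h,\boldsymbol p_h)_{\mathcal T_h}-(\operatorname{div}\boldsymbol p_h,u_h)_{\mathcal T_h}=-\langle u_D,\boldsymbol p_h\cdot\boldsymbol n\rangle_{\partial\Omega}$ for all $\boldsymbol p_h\in\boldsymbol{\mathcal H}_h^p$, and $(\operatorname{div}\boldsymbol q_h,v_h)_{\mathcal T_h}=(f,v_h)_{\mathcal T_h}$ for all $v_h\in\mathcal V_h^{p-1}$. This problem is well-posed. (RM) With the discrete dual norm $\displaystyle\|\boldsymbol p\|_{*,K}=\sup_{0\ne v_K\in\mathcal V_{*,K}^{p+2}}\frac{(\boldsymbol p,\nabla v_K)_K}{\|\nabla v_K\|_K}$, the function $\nu_h\in\mathcal V_h^{p+1}$ is defined by: for each $K\in\mathcal T_h$, $\nu_h|_K$ is the minimizer of $w_K\mapsto\frac12\|\boldsymbol q_h+\nabla w_K\|_{*,K}^2$ over $\mathcal V_K^{p+1}$ that satisfies $(\nu_h,1)_K=(u_h,1)_K$.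 *)

theory Defs
  imports "HOL-Analysis.Analysis"
begin

section \<open>Square-integrable functions\<close>

text \<open>Elements of \<open>L\<^sup>2\<close> are represented by functions, so membership in the spaces below is
  insensitive to modification on null sets, and equality in \<open>L\<^sup>2\<close> is written with \<open>AE\<close>.\<close>

definition L2 :: "'a measure \<Rightarrow> ('a \<Rightarrow> 'b::euclidean_space) set" where
  "L2 M = {f. f \<in> borel_measurable M \<and> integrable M (\<lambda>x. (norm (f x))\<^sup>2)}"

definition L2_inner :: "'a measure \<Rightarrow> ('a \<Rightarrow> 'b::euclidean_space) \<Rightarrow> ('a \<Rightarrow> 'b) \<Rightarrow> real" where
  "L2_inner M f g = (LINT x|M. f x \<bullet> g x)"

definition L2_norm :: "'a measure \<Rightarrow> ('a \<Rightarrow> 'b::euclidean_space) \<Rightarrow> real" where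
  "L2_norm M f = sqrt (L2_inner M f f)"

abbreviation L2_on :: "'a::euclidean_space set \<Rightarrow> ('a \<Rightarrow> 'b::euclidean_space) set" where
  "L2_on D \<equiv> L2 (lebesgue_on D)"

abbreviation inner_on ::
  "'a::euclidean_space set \<Rightarrow> ('a \<Rightarrow> 'b::euclidean_space) \<Rightarrow> ('a \<Rightarrow> 'b) \<Rightarrow> real" where
  "inner_on D \<equiv> L2_inner (lebesgue_on D)"

abbreviation norm_on ::
  "'a::euclidean_space set \<Rightarrow> ('a \<Rightarrow> 'b::euclidean_space) \<Rightarrow> real" where
  "norm_on D \<equiv> L2_norm (lebesgue_on D)"


section \<open>Classical and weak derivatives\<close>

definition grad :: "('a::euclidean_space \<Rightarrow> real) \<Rightarrow> 'a \<Rightarrow> 'a" where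
  "grad f x = (\<Sum>b\<in>Basis. frechet_derivative f (at x) b *\<^sub>R b)"

primrec times_differentiable :: "nat \<Rightarrow> ('a::euclidean_space \<Rightarrow> real) \<Rightarrow> bool" where
  "times_differentiable 0 f \<longleftrightarrow> continuous_on UNIV f"
| "times_differentiable (Suc n) f \<longleftrightarrow> (\<forall>x. f differentiable (at x)) \<and>
     (\<forall>b\<in>Basis. times_differentiable n (\<lambda>x. frechet_derivative f (at x) b))"

definition smooth :: "('a::euclidean_space \<Rightarrow> real) \<Rightarrow> bool" where
  "smooth f \<longleftrightarrow> (\<forall>n. times_differentiable n f)"

definition test_functions :: "'a::euclidean_space set \<Rightarrow> ('a \<Rightarrow> real) set" where
  "test_functions U = {\<phi>. smooth \<phi> \<and> compact (closure {x. \<phi> x \<noteq> 0}) \<and> closure {x. \<phi> x \<noteq> 0} \<subseteq> U}"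

definition has_weak_grad ::
  "'a::euclidean_space set \<Rightarrow> ('a \<Rightarrow> real) \<Rightarrow> ('a \<Rightarrow> 'a) \<Rightarrow> bool" where
  "has_weak_grad U u g \<longleftrightarrow> u \<in> L2_on U \<and> g \<in> L2_on U \<and>
     (\<forall>\<phi>\<in>test_functions U.
        (LINT x|lebesgue_on U. u x *\<^sub>R grad \<phi> x) = - (LINT x|lebesgue_on U. \<phi> x *\<^sub>R g x))"

definition H1 :: "'a::euclidean_space set \<Rightarrow> ('a \<Rightarrow> real) set" where
  "H1 U = {u. \<exists>g. has_weak_grad U u g}"

text \<open>Weak derivatives are unique up to null sets; \<open>weak_grad\<close> and \<open>weak_div\<close> pick a representative,
  which is meaningful on the open set \<open>U\<close> only.\<close>

definition weak_grad :: "'a::euclidean_space set \<Rightarrow> ('a \<Rightarrow> real) \<Rightarrow> 'a \<Rightarrow> 'a" where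
  "weak_grad U u = (SOME g. has_weak_grad U u g)"

definition has_weak_div ::
  "'a::euclidean_space set \<Rightarrow> ('a \<Rightarrow> 'a) \<Rightarrow> ('a \<Rightarrow> real) \<Rightarrow> bool" where
  "has_weak_div U v g \<longleftrightarrow> v \<in> L2_on U \<and> g \<in> L2_on U \<and>
     (\<forall>\<phi>\<in>test_functions U. inner_on U v (grad \<phi>) = - inner_on U g \<phi>)"

definition Hdiv :: "'a::euclidean_space set \<Rightarrow> ('a \<Rightarrow> 'a) set" where
  "Hdiv U = {v. \<exists>g. has_weak_div U v g}"

definition weak_div :: "'a::euclidean_space set \<Rightarrow> ('a \<Rightarrow> 'a) \<Rightarrow> 'a \<Rightarrow> real" where
  "weak_div U v = (SOME g. has_weak_div U v g)"


section \<open>Boundary measure, traces and normal traces\<close>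

text \<open>Hausdorff measure of integer dimension \<open>n \<ge> 1\<close>, normalised to agree with \<open>n\<close>-dimensional
  Lebesgue measure on flat pieces.\<close>

definition hausdorff_premeasure :: "nat \<Rightarrow> real \<Rightarrow> 'a::metric_space set \<Rightarrow> ennreal" where
  "hausdorff_premeasure n \<delta> A =
     (INF U \<in> {U :: nat \<Rightarrow> 'a set. A \<subseteq> (\<Union>i. U i) \<and> (\<forall>i. bounded (U i) \<and> diameter (U i) \<le> \<delta>)}.
        \<Sum>i. ennreal (unit_ball_vol (real n) * (diameter (U i) / 2) ^ n))"

definition hausdorff_measure :: "nat \<Rightarrow> 'a::metric_space measure" where
  "hausdorff_measure n =
     measure_of UNIV (sets borel) (\<lambda>A. SUP \<delta>\<in>{0<..}. hausdorff_premeasure n \<delta> A)"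

definition boundary_measure :: "'a::euclidean_space set \<Rightarrow> 'a measure" where
  "boundary_measure \<Omega> =
     completion (restrict_space (hausdorff_measure (DIM('a) - 1)) (frontier \<Omega>))"

text \<open>The trace operator \<open>H\<^sup>1(\<Omega>) \<rightarrow> L\<^sup>2(\<partial>\<Omega>)\<close> of a bounded Lipschitz domain, as the continuous extension
  of the restriction of smooth functions to the boundary.\<close>

definition has_trace ::
  "'a::euclidean_space set \<Rightarrow> ('a \<Rightarrow> real) \<Rightarrow> ('a \<Rightarrow> real) \<Rightarrow> bool" where
  "has_trace \<Omega> w g \<longleftrightarrow> w \<in> H1 \<Omega> \<and> g \<in> L2 (boundary_measure \<Omega>) \<and>
     (\<exists>\<phi> :: nat \<Rightarrow> 'a \<Rightarrow> real. (\<forall>n. smooth (\<phi> n)) \<and>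
        (\<lambda>n. norm_on \<Omega> (\<lambda>x. w x - \<phi> n x)) \<longlonglongrightarrow> 0 \<and>
        (\<lambda>n. norm_on \<Omega> (\<lambda>x. weak_grad \<Omega> w x - grad (\<phi> n) x)) \<longlonglongrightarrow> 0 \<and>
        (\<lambda>n. L2_norm (boundary_measure \<Omega>) (\<lambda>x. g x - \<phi> n x)) \<longlonglongrightarrow> 0)"

definition H_half_boundary :: "'a::euclidean_space set \<Rightarrow> ('a \<Rightarrow> real) set" where
  "H_half_boundary \<Omega> = {g. \<exists>w. has_trace \<Omega> w g}"

definition H1_0 :: "'a::euclidean_space set \<Rightarrow> ('a \<Rightarrow> real) set" where
  "H1_0 \<Omega> = {w. has_trace \<Omega> w (\<lambda>_. 0)}"

text \<open>The duality pairing between \<open>g \<in> H\<^bsup>1/2\<^esup>(\<partial>\<Omega>)\<close> and the normal trace of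
  \<open>v \<in> H(div, \<Omega>)\<close> is defined by Green's formula; it does not depend on the chosen lifting \<open>w\<close> of \<open>g\<close>.\<close>

definition normal_trace_pairing ::
  "'a::euclidean_space set \<Rightarrow> ('a \<Rightarrow> real) \<Rightarrow> ('a \<Rightarrow> 'a) \<Rightarrow> real" where
  "normal_trace_pairing \<Omega> g v =
     (let w = (SOME w. has_trace \<Omega> w g)
      in inner_on \<Omega> v (weak_grad \<Omega> w) + inner_on \<Omega> (weak_div \<Omega> v) w)"


section \<open>Domains and meshes\<close>

definition lipschitz_domain :: "'a::euclidean_space set \<Rightarrow> bool" where
  "lipschitz_domain \<Omega> \<longleftrightarrow> open \<Omega> \<and> connected \<Omega> \<and> bounded \<Omega> \<and> \<Omega> \<noteq> {} \<and>
     (\<forall>z\<in>frontier \<Omega>. \<exists>U e L \<gamma>. open U \<and> z \<in> U \<and> norm e = 1 \<and>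
        L-lipschitz_on {y. y \<bullet> e = 0} \<gamma> \<and>
        \<Omega> \<inter> U = {x\<in>U. \<gamma> (x - (x \<bullet> e) *\<^sub>R e) < x \<bullet> e})"

definition polyhedral_lipschitz_domain :: "'a::euclidean_space set \<Rightarrow> bool" where
  "polyhedral_lipschitz_domain \<Omega> \<longleftrightarrow> lipschitz_domain \<Omega> \<and>
     (\<exists>P. finite P \<and> (\<forall>S\<in>P. polytope S) \<and> closure \<Omega> = \<Union>P)"

text \<open>Elements are closed simplices; conformity is contained in \<open>triangulation\<close>.\<close>

definition conforming_mesh :: "'a::euclidean_space set \<Rightarrow> 'a set set \<Rightarrow> bool" where
  "conforming_mesh \<Omega> T \<longleftrightarrow>
     triangulation T \<and> (\<forall>K\<in>T. int DIM('a) simplex K) \<and> \<Union>T = closure \<Omega>"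

definition inradius :: "'a::euclidean_space set \<Rightarrow> real" where
  "inradius K = Sup {r. 0 \<le> r \<and> (\<exists>x. cball x r \<subseteq> K)}"

definition shape_regular_family :: "(real \<Rightarrow> 'a::euclidean_space set set) \<Rightarrow> bool" where
  "shape_regular_family T \<longleftrightarrow> (\<exists>\<kappa>>0. \<forall>h>0. \<forall>K\<in>T h. diameter K \<le> \<kappa> * inradius K)"


section \<open>Polynomial spaces\<close>

definition multi_indices :: "nat \<Rightarrow> ('a::euclidean_space \<Rightarrow> nat) set" where
  "multi_indices r = {\<alpha> \<in> Basis \<rightarrow>\<^sub>E UNIV. (\<Sum>b\<in>Basis. \<alpha> b) \<le> r}"

text \<open>As a simplex has nonempty interior, a polynomial on it is identified with the polynomial
  function on the whole space extending it.\<close>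

definition polys :: "nat \<Rightarrow> ('a::euclidean_space \<Rightarrow> real) set" where
  "polys r = {f. \<exists>c. f = (\<lambda>x. \<Sum>\<alpha>\<in>multi_indices r. c \<alpha> * (\<Prod>b\<in>Basis. (x \<bullet> b) ^ \<alpha> b))}"

definition vector_polys :: "nat \<Rightarrow> ('a::euclidean_space \<Rightarrow> 'a) set" where
  "vector_polys r = {v. \<forall>b\<in>Basis. (\<lambda>x. v x \<bullet> b) \<in> polys r}"

definition polys_mean_zero :: "'a::euclidean_space set \<Rightarrow> nat \<Rightarrow> ('a \<Rightarrow> real) set" where
  "polys_mean_zero K r = {v \<in> polys r. inner_on K v (\<lambda>_. 1) = 0}"

definition broken_polys ::
  "'a::euclidean_space set \<Rightarrow> 'a set set \<Rightarrow> nat \<Rightarrow> ('a \<Rightarrow> real) set" where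
  "broken_polys \<Omega> T r =
     {v \<in> L2_on \<Omega>. \<forall>K\<in>T. \<exists>P\<in>polys r. AE x in lebesgue_on K. v x = P x}"

definition Hdiv_polys ::
  "'a::euclidean_space set \<Rightarrow> 'a set set \<Rightarrow> nat \<Rightarrow> ('a \<Rightarrow> 'a) set" where
  "Hdiv_polys \<Omega> T r =
     {v \<in> Hdiv \<Omega>. \<forall>K\<in>T. \<exists>P\<in>vector_polys r. AE x in lebesgue_on K. v x = P x}"

definition L2_proj :: "'a::euclidean_space set \<Rightarrow> nat \<Rightarrow> ('a \<Rightarrow> real) \<Rightarrow> 'a \<Rightarrow> real" where
  "L2_proj K r f = (SOME P. P \<in> polys r \<and> (\<forall>v\<in>polys r. inner_on K (\<lambda>x. f x - P x) v = 0))"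


section \<open>The continuous and discrete problems\<close>

definition mesh_inner ::
  "'a::euclidean_space set set \<Rightarrow> ('a \<Rightarrow> 'b::euclidean_space) \<Rightarrow> ('a \<Rightarrow> 'b) \<Rightarrow> real" where
  "mesh_inner T f g = (\<Sum>K\<in>T. inner_on K f g)"

definition model_solution ::
  "'a::euclidean_space set \<Rightarrow> ('a \<Rightarrow> real) \<Rightarrow> ('a \<Rightarrow> real) \<Rightarrow> ('a \<Rightarrow> real) \<Rightarrow> ('a \<Rightarrow> 'a) \<Rightarrow> bool" where
  "model_solution \<Omega> f u\<^sub>D u q \<longleftrightarrow>
     u \<in> H1 \<Omega> \<and> has_trace \<Omega> u u\<^sub>D \<and>
     (\<forall>v\<in>H1_0 \<Omega>. inner_on \<Omega> (weak_grad \<Omega> u) (weak_grad \<Omega> v) = inner_on \<Omega> f v) \<and>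
     q \<in> Hdiv \<Omega> \<and> (AE x in lebesgue_on \<Omega>. q x = - weak_grad \<Omega> u x)"

definition mfem_solution ::
  "'a::euclidean_space set \<Rightarrow> 'a set set \<Rightarrow> nat \<Rightarrow> ('a \<Rightarrow> real) \<Rightarrow> ('a \<Rightarrow> real) \<Rightarrow>
   ('a \<Rightarrow> real) \<Rightarrow> ('a \<Rightarrow> 'a) \<Rightarrow> bool" where
  "mfem_solution \<Omega> T p f u\<^sub>D u\<^sub>h q\<^sub>h \<longleftrightarrow>
     u\<^sub>h \<in> broken_polys \<Omega> T (p - 1) \<and> q\<^sub>h \<in> Hdiv_polys \<Omega> T p \<and>
     (\<forall>p\<^sub>h\<in>Hdiv_polys \<Omega> T p.
        mesh_inner T q\<^sub>h p\<^sub>h - mesh_inner T (weak_div \<Omega> p\<^sub>h) u\<^sub>h = - normal_trace_pairing \<Omega> u\<^sub>D p\<^sub>h) \<and>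
     (\<forall>v\<^sub>h\<in>broken_polys \<Omega> T (p - 1).
        mesh_inner T (weak_div \<Omega> q\<^sub>h) v\<^sub>h = mesh_inner T f v\<^sub>h)"

definition discrete_dual_norm :: "'a::euclidean_space set \<Rightarrow> nat \<Rightarrow> ('a \<Rightarrow> 'a) \<Rightarrow> real" where
  "discrete_dual_norm K r g =
     (SUP v \<in> polys_mean_zero K r - {\<lambda>_. 0}. inner_on K g (grad v) / norm_on K (grad v))"

definition rm_solution ::
  "'a::euclidean_space set \<Rightarrow> 'a set set \<Rightarrow> nat \<Rightarrow> ('a \<Rightarrow> real) \<Rightarrow> ('a \<Rightarrow> 'a) \<Rightarrow> ('a \<Rightarrow> real) \<Rightarrow> bool"
  where
  "rm_solution \<Omega> T p u\<^sub>h q\<^sub>h \<nu>\<^sub>h \<longleftrightarrow>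
     \<nu>\<^sub>h \<in> broken_polys \<Omega> T (p + 1) \<and>
     (\<forall>K\<in>T. (\<exists>w. (AE x in lebesgue_on K. \<nu>\<^sub>h x = w x) \<and>
                 is_arg_min (\<lambda>w. 1/2 * (discrete_dual_norm K (p + 2) (\<lambda>x. q\<^sub>h x + grad w x))\<^sup>2)
                   (\<lambda>w. w \<in> polys (p + 1)) w) \<and>
            inner_on K \<nu>\<^sub>h (\<lambda>_. 1) = inner_on K u\<^sub>h (\<lambda>_. 1))"

end

theory Submission
  imports Defs
begin

text \<open>On an element \<open>K\<close>, residual minimization makes \<open>q\<^sub>h + \<nabla>\<nu>\<^sub>h\<close> orthogonal to the gradients of
  polynomials of degree \<open>p + 1\<close>, which bounds \<open>\<nabla>(Q u - \<nu>\<^sub>h)\<close> for the projection \<open>Q u\<close> of degree \<open>p + 1\<close>; the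
  \<open>L\<^sup>2\<close> norm then follows from the Payne-Weinberger inequality on the convex set \<open>K\<close>, with constant
  \<open>diameter K / pi\<close>. If that inequality failed for a mean zero function, bisecting \<open>K\<close> repeatedly by hyperplanes
  that keep the mean zero on the half where it still fails would produce violating convex sets close to a
  segment. Cut such a needle into \<open>N\<close> slabs of equal width: by the Brunn-Minkowski inequality the slab volumes
  form a log-concave sequence, so a discrete weighted Poincare inequality with the sharp constant holds along
  the needle, and \<open>N \<rightarrow> \<infinity>\<close> yields a contradiction.\<close>

section \<open>A discrete Poincare inequality for log-concave weights\<close>

text \<open>Payne-Weinberger is applied to one function only, the polynomial
  \<open>Q u - \<nu>\<^sub>h\<close> minus its mean, so differentiability with a continuous gradient
  suffices for it. The mean itself produces the term with \<open>u\<^sub>h\<close>: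
  \<open>\<nu>\<^sub>h\<close> has the mean of \<open>u\<^sub>h\<close> on \<open>K\<close>, and
  projections of every degree keep the mean of \<open>u\<close>. The volume of a needle has no lower
  bound, so every error made on it must be a multiple of that volume. Hence the violated inequality
  is first weakened by a constant per unit volume; this slack pays for the oscillation of
  \<open>P\<close> and its gradient within slabs and for the deviation of the discrete constant from
  its limit. Log-concavity needs Brunn-Minkowski only in product form, volume of \<open>A\<close>
  times volume of \<open>B\<close> at most the squared volume of a set containing all midpoints; the
  constant of the unweighted interval survives every log-concave weight. \<open>weak_grad\<close> on
  the interior of \<open>K\<close> is an arbitrary representative, unrelated to the one on \<Omega>.
  The two are compared by testing with gradients of polynomials, which do not vanish at the
  boundary; this is why cutoff functions appear.\<close>

lemma discrete_dirichlet:
  fixes G :: "nat \<Rightarrow> real"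
  assumes N: "N > 0" and G0: "G 0 = 0" and GN: "G N = 0"
  shows "(2 - 2 * cos (pi / N)) * (\<Sum>j<N. (G j)\<^sup>2) \<le> (\<Sum>j<N. (G (Suc j) - G j)\<^sup>2)"
proof -
  \<comment> \<open>The sine is the lowest eigenvector of the discrete Dirichlet Laplacian on
    \<open>0..N\<close>, positive between the end points; \<open>srec\<close> is its eigenvalue
    equation. The bound comes from comparing \<open>G\<close> with it.\<close>
  define s where "s x = sin (pi * x / N)" for x :: real
  have s0: "s 0 = 0" and sN: "s N = 0" using N by (auto simp: s_def)
  have spos: "s x > 0" if "0 < x" "x < real N" for x
    unfolding s_def using that N by (intro sin_gt_zero) (auto simp: field_simps)
  have srec: "s (x + 1) + s (x - 1) = 2 * cos (pi / N) * s x" for x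
    by (simp add: s_def ring_distribs add_divide_distrib diff_divide_distrib sin_add sin_diff)
  define a where "a j = (G j)\<^sup>2 * s (real j + 1) / s j" for j
  define c where "c j = (G j)\<^sup>2 * s (real j - 1) / s j" for j
  \<comment> \<open>This is 2xy <= x^2 + y^2 with the weight \<open>s (j + 1) / s j\<close> and its
    inverse. At the end points one quotient has denominator 0, but \<open>G\<close> vanishes
    there.\<close>
  have cross: "2 * G j * G (Suc j) \<le> a j + c (Suc j)" if "j < N" for j
  proof (cases "j = 0 \<or> Suc j = N")
    case True
    then show ?thesis using G0 GN s0 sN by (auto simp: a_def c_def add.commute)
  next
    case False
    then have "real j + 1 < real N" "real j > 0" using that by linarith+
    then have p: "s j > 0" "s (real j + 1) > 0" using spos[of "real j"] spos[of "real j + 1"] by auto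
    have "0 \<le> (G j * s (real j + 1) - G (Suc j) * s j)\<^sup>2 / (s j * s (real j + 1))" using p by simp
    also have "\<dots> = a j + c (Suc j) - 2 * G j * G (Suc j)"
      using p by (simp add: a_def c_def field_simps power2_eq_square)
    finally show ?thesis by simp
  qed
  have ac: "a j + c j = 2 * cos (pi / N) * (G j)\<^sup>2" if "j < N" for j
  proof (cases "j = 0")
    case False
    then have "s j > 0" using that by (auto intro!: spos)
    moreover have "a j + c j = (G j)\<^sup>2 * (s (real j + 1) + s (real j - 1)) / s j"
      by (simp add: a_def c_def add_divide_distrib ring_distribs)
    ultimately show ?thesis by (simp add: srec)
  qed (simp add: a_def c_def G0)
  have shift: "(\<Sum>j<N. f (Suc j)) = (\<Sum>j<N. f j)" if "f 0 = 0" "f N = 0" for f :: "nat \<Rightarrow> real"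
    using sum.lessThan_Suc_shift[of f N] that by simp
  have "(\<Sum>j<N. 2 * G j * G (Suc j)) \<le> (\<Sum>j<N. a j + c (Suc j))"
    by (intro sum_mono cross) auto
  also have "\<dots> = (\<Sum>j<N. a j + c j)"
    using shift[of c] by (simp add: sum.distrib c_def G0 GN)
  also have "\<dots> = 2 * cos (pi / N) * (\<Sum>j<N. (G j)\<^sup>2)"
    by (simp add: ac sum_distrib_left)
  finally have 1: "(\<Sum>j<N. 2 * G j * G (Suc j)) \<le> 2 * cos (pi / N) * (\<Sum>j<N. (G j)\<^sup>2)" .
  have "(\<Sum>j<N. (G (Suc j) - G j)\<^sup>2)
      = (\<Sum>j<N. (G (Suc j))\<^sup>2) + (\<Sum>j<N. (G j)\<^sup>2) - (\<Sum>j<N. 2 * G j * G (Suc j))"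
    by (simp add: power2_diff sum.distrib sum_subtractf mult_ac)
  also have "(\<Sum>j<N. (G (Suc j))\<^sup>2) = (\<Sum>j<N. (G j)\<^sup>2)"
    using shift[of "\<lambda>j. (G j)\<^sup>2"] G0 GN by simp
  finally show ?thesis using 1 by (simp add: algebra_simps)
qed

text \<open>The partial sums \<open>F\<close> of \<open>m w\<close> are fluxes that vanish at both
  ends because the mean is zero. So the weighted Neumann problem for \<open>w\<close> turns into an
  unweighted Dirichlet problem for a rescaled flux \<open>G\<close>, and log-concavity lets the
  rescaling lose nothing. With \<open>n + 1\<close> weights the flux lives on the nodes
  \<open>0..n+1\<close>, hence the angle \<open>pi / Suc n\<close>.\<close>

lemma discrete_log_concave_poincare:
  fixes m w :: "nat \<Rightarrow> real"
  assumes pos: "\<And>j. j \<le> n \<Longrightarrow> m j > 0"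
    and lc: "\<And>j. Suc (Suc j) \<le> n \<Longrightarrow> m j * m (Suc (Suc j)) \<le> (m (Suc j))\<^sup>2"
    and mean: "(\<Sum>j\<le>n. m j * w j) = 0"
  shows "(2 - 2 * cos (pi / real (Suc n))) * (\<Sum>j\<le>n. m j * (w j)\<^sup>2)
    \<le> (\<Sum>j<n. (m j + m (Suc j)) / 2 * (w (Suc j) - w j)\<^sup>2)"
proof -
  define F where "F j = (\<Sum>i<j. m i * w i)" for j
  \<comment> \<open>The geometric mean of neighbouring weights is the edge weight for which both the
    diagonal terms (\<open>diag\<close>) and the cross terms (\<open>cross\<close>) below are
    estimated in the right direction.\<close>
  define k where "k j = sqrt (m j * m (Suc j))" for j
  define G where "G j = (case j of 0 \<Rightarrow> 0 | Suc i \<Rightarrow> \<bar>F j\<bar> / sqrt (k i))" for j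
  have F0: "F 0 = 0" and FN: "F (Suc n) = 0" using mean by (auto simp: F_def lessThan_Suc_atMost)
  have kpos: "k j > 0" if "j < n" for j using pos[of j] pos[of "Suc j"] that by (simp add: k_def)
  have G0: "G 0 = 0" and GN: "G (Suc n) = 0" using FN by (auto simp: G_def)
  have GS: "(G (Suc j))\<^sup>2 = (F (Suc j))\<^sup>2 / k j" if "j < n" for j
    using kpos[OF that] by (simp add: G_def power_divide)
  \<comment> \<open>Log-concavity enters here, through
    \<open>k j * k (Suc j) = m (Suc j) * sqrt (m j * m (Suc (Suc j)))\<close>.\<close>
  have kk: "sqrt (k j) * sqrt (k (Suc j)) \<le> m (Suc j)" if "Suc j < n" for j
  proof -
    have p: "m j > 0" "m (Suc j) > 0" "m (Suc (Suc j)) > 0" using pos that by auto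
    have "k j * k (Suc j) = m (Suc j) * sqrt (m j * m (Suc (Suc j)))"
      using p by (simp add: k_def real_sqrt_mult)
    also have "\<dots> \<le> m (Suc j) * sqrt ((m (Suc j))\<^sup>2)"
      using p lc[of j] that by (intro mult_left_mono real_sqrt_le_mono) auto
    also have "\<dots> = (m (Suc j))\<^sup>2" using p by (simp add: power2_eq_square)
    finally have "sqrt (k j * k (Suc j)) \<le> sqrt ((m (Suc j))\<^sup>2)" by (rule real_sqrt_le_mono)
    then show ?thesis using p by (simp add: real_sqrt_mult)
  qed
  have cross: "F j * F (Suc j) / m j \<le> G j * G (Suc j)" if "j \<le> n" for j
  proof (cases "j = 0 \<or> j = n")
    case True
    then show ?thesis using F0 FN G0 GN by auto
  next
    case False
    then have "j = Suc (j - 1)" "Suc (j - 1) < n" using that by auto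
    then obtain i where i: "j = Suc i" "Suc i < n" by blast
    have p: "m j > 0" "k i > 0" "k (Suc i) > 0" using pos i kpos by auto
    have "F j * F (Suc j) / m j \<le> \<bar>F j\<bar> * \<bar>F (Suc j)\<bar> / m j"
      using p abs_ge_self[of "F j * F (Suc j)"] by (simp add: abs_mult divide_right_mono)
    also have "\<dots> \<le> \<bar>F j\<bar> * \<bar>F (Suc j)\<bar> / (sqrt (k i) * sqrt (k (Suc i)))"
      using kk[of i] i p by (intro divide_left_mono) (auto intro!: mult_nonneg_nonneg)
    also have "\<dots> = G j * G (Suc j)" using i by (simp add: G_def)
    finally show ?thesis .
  qed
  define S where "S = (\<Sum>j\<le>n. m j * (w j)\<^sup>2)"
  define T where "T = (\<Sum>j<n. (F (Suc j))\<^sup>2 / k j)"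
  define U where "U = (\<Sum>j<n. (m j + m (Suc j)) / 2 * (w (Suc j) - w j)\<^sup>2)"
  define l where "l = 2 - 2 * cos (pi / real (Suc n))"
  have TG: "(\<Sum>j<Suc n. (G j)\<^sup>2) = T"
    by (subst sum.lessThan_Suc_shift) (simp add: G0 GS T_def)
  have diag: "2 * ((F (Suc j))\<^sup>2 / k j) \<le> (F (Suc j))\<^sup>2 / m j + (F (Suc j))\<^sup>2 / m (Suc j)" if "j < n" for j
  proof -
    have p: "m j > 0" "m (Suc j) > 0" using pos that by auto
    have "0 \<le> (1 / sqrt (m j) - 1 / sqrt (m (Suc j)))\<^sup>2" by simp
    then have "2 / k j \<le> 1 / m j + 1 / m (Suc j)"
      using p by (simp add: k_def power2_diff power_divide real_sqrt_mult)
    from mult_left_mono[OF this, of "(F (Suc j))\<^sup>2"] show ?thesis by (simp add: ring_distribs mult_ac)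
  qed
  have "S = (\<Sum>j\<le>n. (F (Suc j) - F j)\<^sup>2 / m j)"
    unfolding S_def
  proof (rule sum.cong)
    fix j assume "j \<in> {..n}"
    then have "m j > 0" using pos by auto
    then show "m j * (w j)\<^sup>2 = (F (Suc j) - F j)\<^sup>2 / m j"
      by (simp add: F_def power2_eq_square)
  qed simp
  also have "\<dots> = (\<Sum>j\<le>n. (F (Suc j))\<^sup>2 / m j) + (\<Sum>j\<le>n. (F j)\<^sup>2 / m j) - 2 * (\<Sum>j\<le>n. F j * F (Suc j) / m j)"
    by (simp add: power2_diff diff_divide_distrib add_divide_distrib sum.distrib sum_subtractf
        sum_distrib_left mult_ac)
  also have "(\<Sum>j\<le>n. (F (Suc j))\<^sup>2 / m j) = (\<Sum>j<n. (F (Suc j))\<^sup>2 / m j)"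
    by (simp add: FN flip: lessThan_Suc_atMost)
  also have "(\<Sum>j\<le>n. (F j)\<^sup>2 / m j) = (\<Sum>j<n. (F (Suc j))\<^sup>2 / m (Suc j))"
    by (simp add: F0 sum.lessThan_Suc_shift flip: lessThan_Suc_atMost del: sum.lessThan_Suc)
  finally have Seq: "S = (\<Sum>j<n. (F (Suc j))\<^sup>2 / m j + (F (Suc j))\<^sup>2 / m (Suc j))
      - 2 * (\<Sum>j\<le>n. F j * F (Suc j) / m j)" by (simp add: sum.distrib)
  \<comment> \<open>In the expanded square the diagonal is at least \<open>2 * T\<close> and the
    cross terms are at most those of \<open>G\<close>. So \<open>S\<close> dominates the Dirichlet
    energy of \<open>G\<close>, which is at least \<open>l * T\<close>.\<close>
  have "2 * T \<le> (\<Sum>j<n. (F (Suc j))\<^sup>2 / m j + (F (Suc j))\<^sup>2 / m (Suc j))"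
    unfolding T_def sum_distrib_left by (intro sum_mono diag) auto
  moreover have "(\<Sum>j\<le>n. F j * F (Suc j) / m j) \<le> (\<Sum>j\<le>n. G j * G (Suc j))"
    by (intro sum_mono cross) auto
  moreover have "(\<Sum>j<Suc n. (G (Suc j) - G j)\<^sup>2) = 2 * T - 2 * (\<Sum>j\<le>n. G j * G (Suc j))"
  proof -
    have "(\<Sum>j<Suc n. (G (Suc j))\<^sup>2) = T"
      using TG sum.lessThan_Suc_shift[of "\<lambda>j. (G j)\<^sup>2" "Suc n"] by (simp add: G0 GN)
    then show ?thesis using TG
      by (simp add: power2_diff sum.distrib sum_subtractf sum_distrib_left mult_ac
          flip: lessThan_Suc_atMost)
  qed
  ultimately have lT: "l * T \<le> S"
    using discrete_dirichlet[of "Suc n" G] G0 GN TG Seq by (simp add: l_def)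
  \<comment> \<open>Summation by parts expresses \<open>S\<close> by fluxes and increments of
    \<open>w\<close>. Cauchy-Schwarz gives S^2 <= T U, and with \<open>l * T \<le> S\<close> this
    yields l S^2 <= l T U <= S U.\<close>
  have "S = (\<Sum>j<Suc n. (F (Suc j) - F j) * w j)"
    by (simp add: S_def F_def power2_eq_square mult_ac flip: lessThan_Suc_atMost)
  also have "\<dots> = (\<Sum>j<Suc n. F (Suc j) * w j) - (\<Sum>j<Suc n. F j * w j)"
    by (simp add: left_diff_distrib sum_subtractf)
  also have "(\<Sum>j<Suc n. F j * w j) = (\<Sum>j<n. F (Suc j) * w (Suc j))"
    by (subst sum.lessThan_Suc_shift) (simp add: F0)
  also have "(\<Sum>j<Suc n. F (Suc j) * w j) - \<dots> = - (\<Sum>j<n. F (Suc j) * (w (Suc j) - w j))"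
    by (simp add: FN right_diff_distrib sum_subtractf)
  finally have "S = - (\<Sum>j<n. (F (Suc j) / sqrt (k j)) * (sqrt (k j) * (w (Suc j) - w j)))"
  proof -
    have "(\<Sum>j<n. F (Suc j) * (w (Suc j) - w j))
        = (\<Sum>j<n. (F (Suc j) / sqrt (k j)) * (sqrt (k j) * (w (Suc j) - w j)))"
    proof (rule sum.cong, goal_cases)
      case (2 j)
      then show ?case using kpos[of j] by auto
    qed simp
    moreover assume "S = - (\<Sum>j<n. F (Suc j) * (w (Suc j) - w j))"
    ultimately show ?thesis by simp
  qed
  then have "S\<^sup>2 = (\<Sum>j<n. (F (Suc j) / sqrt (k j)) * (sqrt (k j) * (w (Suc j) - w j)))\<^sup>2"
    by simp
  also have "\<dots> \<le> (\<Sum>j<n. (F (Suc j) / sqrt (k j))\<^sup>2) * (\<Sum>j<n. (sqrt (k j) * (w (Suc j) - w j))\<^sup>2)"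
    by (rule Cauchy_Schwarz_ineq_sum)
  also have "(\<Sum>j<n. (F (Suc j) / sqrt (k j))\<^sup>2) = T"
    unfolding T_def by (rule sum.cong) (use kpos in \<open>auto simp: power_divide less_imp_le\<close>)
  also have "T * (\<Sum>j<n. (sqrt (k j) * (w (Suc j) - w j))\<^sup>2) \<le> T * U"
  proof (rule mult_left_mono)
    show "(\<Sum>j<n. (sqrt (k j) * (w (Suc j) - w j))\<^sup>2) \<le> U"
      unfolding U_def
    proof (rule sum_mono)
      fix j assume j: "j \<in> {..<n}"
      then have p: "m j \<ge> 0" "m (Suc j) \<ge> 0" "k j \<ge> 0" using pos kpos by (auto intro: less_imp_le)
      then have "k j \<le> (m j + m (Suc j)) / 2" using arith_geo_mean_sqrt by (simp add: k_def)
      then show "(sqrt (k j) * (w (Suc j) - w j))\<^sup>2 \<le> (m j + m (Suc j)) / 2 * (w (Suc j) - w j)\<^sup>2"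
        using p mult_right_mono[of "k j" "(m j + m (Suc j)) / 2" "(w (Suc j) - w j)\<^sup>2"]
        by (simp add: power_mult_distrib)
    qed
    show "0 \<le> T" unfolding T_def using kpos by (intro sum_nonneg divide_nonneg_nonneg) (auto intro: less_imp_le)
  qed
  finally have STU: "S\<^sup>2 \<le> T * U" .
  have U0: "U \<ge> 0" unfolding U_def
    using pos by (intro sum_nonneg mult_nonneg_nonneg) (auto intro!: add_nonneg_nonneg intro: less_imp_le)
  have l0: "l \<ge> 0" using cos_le_one by (simp add: l_def)
  have S0: "S \<ge> 0" unfolding S_def using pos by (intro sum_nonneg mult_nonneg_nonneg) (auto intro: less_imp_le)
  have "l * S \<le> U"
  proof (cases "S = 0")
    case False
    have "S * (l * S) = l * S\<^sup>2" by (simp add: power2_eq_square)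
    also have "\<dots> \<le> l * (T * U)" using STU l0 by (rule mult_left_mono)
    also have "\<dots> = (l * T) * U" by simp
    also have "\<dots> \<le> S * U" using lT U0 by (rule mult_right_mono)
    finally show ?thesis using False S0 by simp
  qed (use U0 in simp)
  then show ?thesis by (simp add: l_def S_def U_def)
qed

section \<open>The Brunn-Minkowski inequality\<close>

lemma continuous_on_integral_halfspaces:
  fixes f :: "'a::euclidean_space \<Rightarrow> real" and g :: "real \<Rightarrow> 'a \<Rightarrow> real"
  assumes f: "integrable (lebesgue_on K) f" and K: "K \<in> sets lebesgue"
    and cont: "\<And>x. continuous_on UNIV (\<lambda>t. g t x)"
    and null: "\<And>t. negligible {x. g t x = 0}"
    and meas: "\<And>t. g t \<in> borel_measurable borel"
  shows "continuous_on UNIV (\<lambda>t. LINT x|lebesgue_on K. indicator {x. g t x < 0} x * f x)"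
  unfolding continuous_on_sequentially
proof (intro ballI allI impI, elim conjE, unfold o_def)
  fix t and s :: "nat \<Rightarrow> real" assume s: "s \<longlonglongrightarrow> t"
  have m: "{x. g t x < 0} \<in> sets lebesgue" for t
    using meas[of t] by (intro sets_completionI_sets) (simp add: borel_measurable_less)
  have im: "(\<lambda>x. indicator {x. g t x < 0} x :: real) \<in> borel_measurable (lebesgue_on K)" for t
    by (intro measurable_restrict_space1 borel_measurable_indicator m)
  \<comment> \<open>Off this null set the indicator of the half-space is eventually constant along
    the sequence, so dominated convergence applies with the absolute value of \<open>f\<close> as
    bound.\<close>
  have "{x. g t x = 0} \<in> null_sets lebesgue" using null negligible_iff_null_sets by blast
  then have "AE x in lebesgue_on K. g t x \<noteq> 0"
    using K by (subst AE_restrict_space_iff) (auto intro: AE_I')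
  then have "AE x in lebesgue_on K. (\<lambda>n. indicator {x. g (s n) x < 0} x * f x)
      \<longlonglongrightarrow> indicator {x. g t x < 0} x * f x"
  proof (rule AE_mp, intro AE_I2 impI)
    fix x assume x: "g t x \<noteq> 0"
    have "(\<lambda>n. g (s n) x) \<longlonglongrightarrow> g t x"
      using cont[of x] s by (auto simp: continuous_on_sequentially o_def)
    then have "\<forall>\<^sub>F n in sequentially. (g (s n) x < 0) = (g t x < 0)"
    proof (cases "g t x < 0")
      case False
      then have "g t x > 0" using x by simp
      from order_tendstoD(1)[OF \<open>(\<lambda>n. g (s n) x) \<longlonglongrightarrow> g t x\<close> this] show ?thesis
        by eventually_elim (use False in auto)
    qed (auto dest: order_tendstoD)
    then have "\<forall>\<^sub>F n in sequentially. indicator {x. g (s n) x < 0} x * f x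
        = indicator {x. g t x < 0} x * f x"
      by eventually_elim (simp add: indicator_def)
    then show "(\<lambda>n. indicator {x. g (s n) x < 0} x * f x)
      \<longlonglongrightarrow> indicator {x. g t x < 0} x * f x"
      by (rule tendsto_eventually)
  qed
  then show "(\<lambda>n. LINT x|lebesgue_on K. indicator {x. g (s n) x < 0} x * f x)
     \<longlonglongrightarrow> (LINT x|lebesgue_on K. indicator {x. g t x < 0} x * f x)"
    using f im by (intro integral_dominated_convergence[where w="\<lambda>x. \<bar>f x\<bar>"])
      (auto intro!: borel_measurable_times simp: indicator_def)
qed

lemma measure_cut:
  fixes U :: "'a::euclidean_space set"
  assumes U: "U \<in> lmeasurable" and i: "i \<noteq> 0"
  shows "measure lebesgue U = measure lebesgue (U \<inter> {x. x \<bullet> i < c}) + measure lebesgue (U \<inter> {x. c < x \<bullet> i})"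
proof -
  have m: "{x. x \<bullet> i < c} \<in> sets lebesgue" "{x. c < x \<bullet> i} \<in> sets lebesgue"
    by (auto intro!: sets_completionI_sets)
  have neg: "negligible {x. x \<bullet> i = c}"
    using negligible_hyperplane[of i c] i by (simp add: inner_commute)
  have mm: "U \<inter> {x. x \<bullet> i < c} \<in> lmeasurable" "U \<inter> {x. c < x \<bullet> i} \<in> lmeasurable"
    using U m by (auto intro!: fmeasurable_Int_fmeasurable simp del: Int_Collect)
  have "measure lebesgue U = measure lebesgue ((U \<inter> {x. x \<bullet> i < c}) \<union> (U \<inter> {x. c < x \<bullet> i}))"
    by (rule measure_negligible_symdiff[OF _ negligible_subset[OF neg]])
       (use U mm in auto)
  also have "\<dots> = measure lebesgue (U \<inter> {x. x \<bullet> i < c}) + measure lebesgue (U \<inter> {x. c < x \<bullet> i})"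
    using measure_Un3[OF mm] by (simp add: Int_def) (metis (mono_tags, lifting) Collect_empty_eq less_asym measure_empty)
  finally show ?thesis .
qed

lemma ex_cut:
  fixes V :: "'a::euclidean_space set"
  assumes V: "bounded V" "V \<in> lmeasurable" and i: "i \<in> Basis"
    and l: "0 \<le> l" "l \<le> measure lebesgue V"
  obtains c where "measure lebesgue (V \<inter> {x. x \<bullet> i < c}) = l"
proof -
  define w where "w c = measure lebesgue (V \<inter> {x. x \<bullet> i < c})" for c
  obtain B where B: "\<And>x. x \<in> V \<Longrightarrow> norm x \<le> B" using V(1) by (auto simp: bounded_iff)
  have B': "\<bar>x \<bullet> i\<bar> \<le> B" if "x \<in> V" for x using B[OF that] Basis_le_norm[OF i, of x] by linarith
  have weq: "w c = (LINT x|lebesgue_on V. indicator {x. x \<bullet> i - c < 0} x * 1)" for c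
  proof -
    have m: "{x. x \<bullet> i < c} \<in> sets lebesgue" by (auto intro!: sets_completionI_sets)
    have "(LINT x|lebesgue_on V. indicator {x. x \<bullet> i < c} x) = measure (lebesgue_on V) ({x. x \<bullet> i < c} \<inter> V)"
      using Bochner_Integration.integral_indicator[of "lebesgue_on V" "{x. x \<bullet> i < c}"] by simp
    also have "\<dots> = w c"
      using V(2) m by (subst measure_restrict_space) (auto simp: w_def Int_commute)
    finally show ?thesis by simp
  qed
  have neg: "negligible {x. x \<bullet> i - t = 0}" for t
    using negligible_hyperplane[of i t] i by (simp add: inner_commute nonzero_Basis)
  have "continuous_on UNIV w"
    unfolding weq using V(2) neg
    by (intro continuous_on_integral_halfspaces[where g="\<lambda>c x. x \<bullet> i - c"])
       (auto intro!: continuous_intros finite_measure.integrable_const finite_measure_lebesgue_on)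
  then have "continuous_on {-B-1..B+1} w" by (rule continuous_on_subset) simp
  moreover have "w (-B-1) = 0"
  proof -
    have "V \<inter> {x. x \<bullet> i < -B-1} = {}" using B' by force
    then show ?thesis by (simp add: w_def)
  qed
  moreover have "w (B+1) = measure lebesgue V"
  proof -
    have "V \<inter> {x. x \<bullet> i < B+1} = V" using B' by force
    then show ?thesis by (simp add: w_def)
  qed
  moreover have "-B-1 \<le> B+1 \<or> V = {}" using B' by force
  ultimately show ?thesis
    using IVT'[of w "-B-1" l "B+1"] l that unfolding w_def by force
qed

section \<open>Finite families of disjoint open boxes\<close>

lemma box_Int_halfspace:
  fixes a b :: "'a::euclidean_space"
  assumes i: "i \<in> Basis"
  shows "\<exists>b'. box a b \<inter> {x. x \<bullet> i < c} = box a b'"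
    and "\<exists>a'. box a b \<inter> {x. c < x \<bullet> i} = box a' b"
proof -
  show "\<exists>b'. box a b \<inter> {x. x \<bullet> i < c} = box a b'"
    by (rule exI[of _ "\<Sum>j\<in>Basis. (if j = i then min (b \<bullet> i) c else b \<bullet> j) *\<^sub>R j"])
       (use i in \<open>auto simp: box_def inner_sum_left_Basis split: if_splits\<close>)
  show "\<exists>a'. box a b \<inter> {x. c < x \<bullet> i} = box a' b"
    by (rule exI[of _ "\<Sum>j\<in>Basis. (if j = i then max (a \<bullet> i) c else a \<bullet> j) *\<^sub>R j"])
       (use i in \<open>auto simp: box_def inner_sum_left_Basis split: if_splits\<close>)
qed

text \<open>Open boxes stay open boxes when cut by an open coordinate half-space, and the cut loses
  only a null set. Excluding the empty box makes the number of boxes a usable induction measure and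
  gives every nonempty family positive volume.\<close>

definition box_family :: "'a::euclidean_space set set \<Rightarrow> bool" where
  "box_family \<A> \<longleftrightarrow> finite \<A> \<and> disjoint \<A> \<and> {} \<notin> \<A> \<and> (\<forall>X\<in>\<A>. \<exists>a b. X = box a b)"

lemma box_family_lmeasurable:
  assumes "box_family \<A>" shows "\<Union>\<A> \<in> lmeasurable" "bounded (\<Union>\<A>)"
  using assms by (force simp: box_family_def intro!: fmeasurable.finite_Union bounded_Union)+

lemma box_family_pos:
  assumes "box_family \<A>" "\<A> \<noteq> {}" shows "measure lebesgue (\<Union>\<A>) > 0"
proof -
  have "open (\<Union>\<A>)" using assms unfolding box_family_def by (metis open_Union open_box)
  moreover have "\<Union>\<A> \<noteq> {}" using assms by (auto simp: box_family_def)
  ultimately have "\<not> negligible (\<Union>\<A>)" using open_not_negligible by blast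
  then show ?thesis using box_family_lmeasurable(1)[OF assms(1)]
    by (simp add: negligible_iff_measure zero_less_measure_iff)
qed

lemma box_family_cut:
  fixes \<A> :: "'a::euclidean_space set set"
  assumes A: "box_family \<A>" and H: "\<And>a b::'a. \<exists>a' b'. box a b \<inter> H = box a' b'"
  shows "box_family ((\<lambda>X. X \<inter> H) ` \<A> - {{}})" "\<Union>((\<lambda>X. X \<inter> H) ` \<A> - {{}}) = \<Union>\<A> \<inter> H"
    "card ((\<lambda>X. X \<inter> H) ` \<A> - {{}}) \<le> card \<A>"
    "X \<in> \<A> \<Longrightarrow> X \<inter> H = {} \<Longrightarrow> card ((\<lambda>X. X \<inter> H) ` \<A> - {{}}) < card \<A>"
proof -
  have fin: "finite \<A>" using A by (simp add: box_family_def)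
  show "box_family ((\<lambda>X. X \<inter> H) ` \<A> - {{}})"
    unfolding box_family_def
  proof (intro conjI)
    show "disjoint ((\<lambda>X. X \<inter> H) ` \<A> - {{}})"
      using A unfolding box_family_def pairwise_def disjnt_def by blast
    show "\<forall>X\<in>(\<lambda>X. X \<inter> H) ` \<A> - {{}}. \<exists>a b. X = box a b"
      using A H unfolding box_family_def by (metis DiffE imageE)
  qed (use fin in auto)
  show "\<Union>((\<lambda>X. X \<inter> H) ` \<A> - {{}}) = \<Union>\<A> \<inter> H" by blast
  show "card ((\<lambda>X. X \<inter> H) ` \<A> - {{}}) \<le> card \<A>"
    by (meson Diff_subset card_image_le card_mono fin finite_imageI order_trans)
  assume X: "X \<in> \<A>" "X \<inter> H = {}"
  then have "(\<lambda>X. X \<inter> H) ` \<A> - {{}} \<subseteq> (\<lambda>X. X \<inter> H) ` (\<A> - {X})" by blast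
  then have "card ((\<lambda>X. X \<inter> H) ` \<A> - {{}}) \<le> card (\<A> - {X})"
    by (meson card_image_le card_mono fin finite_Diff finite_imageI order_trans)
  also have "\<dots> < card \<A>" using X fin by (intro card_Diff1_less)
  finally show "card ((\<lambda>X. X \<inter> H) ` \<A> - {{}}) < card \<A>" .
qed

text \<open>A coordinate hyperplane separates two disjoint boxes, so each of its open sides misses a
  box of the family. Both halves of the family therefore have fewer boxes, which drives the
  induction for Brunn-Minkowski.\<close>

lemma box_family_separate:
  fixes \<A> :: "'a::euclidean_space set set"
  assumes A: "box_family \<A>" and XY: "X \<in> \<A>" "Y \<in> \<A>" "X \<noteq> Y"
  obtains i c X' Y' where "i \<in> Basis" "X' \<in> \<A>" "Y' \<in> \<A>"
    "X' \<inter> {x. x \<bullet> i < c} = {}" "Y' \<inter> {x. c < x \<bullet> i} = {}"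
proof -
  obtain a b a' b' where ab: "X = box a b" "Y = box a' b'"
    using A XY by (metis box_family_def)
  have "X \<inter> Y = {}" "X \<noteq> {}" "Y \<noteq> {}"
    using A XY by (auto simp: box_family_def pairwise_def disjnt_def)
  then obtain i where i: "i \<in> Basis" "b \<bullet> i \<le> a' \<bullet> i \<or> b' \<bullet> i \<le> a \<bullet> i"
    using ab disjoint_interval(4)[of a b a' b'] box_ne_empty(2)[of a b] box_ne_empty(2)[of a' b']
    by (metis not_less)
  from i(2) show thesis
  proof
    assume "b \<bullet> i \<le> a' \<bullet> i"
    then show thesis
      by (intro that[of i Y X "b \<bullet> i"]) (use i XY ab in \<open>force simp: box_def\<close>)+
  next
    assume "b' \<bullet> i \<le> a \<bullet> i"
    then show thesis
      by (intro that[of i X Y "b' \<bullet> i"]) (use i XY ab in \<open>force simp: box_def\<close>)+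
  qed
qed

section \<open>Brunn-Minkowski in product form: boxes, box families, convex sets\<close>

lemma sqrt_prod: "sqrt (\<Prod>i\<in>A. f i) = (\<Prod>i\<in>A. sqrt (f i))"
  by (induction A rule: infinite_finite_induct) (simp_all add: real_sqrt_mult)

lemma brunn_minkowski_box:
  fixes a b c d :: "'a::euclidean_space"
  assumes ne: "box a b \<noteq> {}" "box c d \<noteq> {}"
    and C: "C \<in> lmeasurable" "\<And>x y. x \<in> box a b \<Longrightarrow> y \<in> box c d \<Longrightarrow> x + y \<in> C"
  shows "2 ^ DIM('a) * sqrt (measure lebesgue (box a b) * measure lebesgue (box c d)) \<le> measure lebesgue C"
proof -
  have p: "a \<bullet> i < b \<bullet> i" "c \<bullet> i < d \<bullet> i" if "i \<in> Basis" for i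
    using ne that by (auto simp: box_ne_empty)
  have sub: "box (a + c) (b + d) \<subseteq> C"
  proof
    fix z assume z: "z \<in> box (a + c) (b + d)"
    \<comment> \<open>The relative position of \<open>z\<close> in the sum box. The same relative
      position in each of the two boxes splits \<open>z\<close> into its summands; afterwards the
      claim is 2 sqrt(u v) <= u + v in every coordinate.\<close>
    define s where "s i = (z \<bullet> i - (a + c) \<bullet> i) / ((b + d) \<bullet> i - (a + c) \<bullet> i)" for i
    define x where "x = (\<Sum>i\<in>Basis. (a \<bullet> i + s i * (b \<bullet> i - a \<bullet> i)) *\<^sub>R i)"
    have s: "0 < s i" "s i < 1" "(z - x) \<bullet> i = c \<bullet> i + s i * (d \<bullet> i - c \<bullet> i)" if "i \<in> Basis" for i
    proof -
      have q: "(b + d) \<bullet> i - (a + c) \<bullet> i > 0" using p[OF that] by (simp add: inner_add_left)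
      then show "0 < s i" "s i < 1" using z that by (auto simp: s_def box_def)
      have "s i * ((b + d) \<bullet> i - (a + c) \<bullet> i) = z \<bullet> i - (a + c) \<bullet> i" using q by (simp add: s_def)
      then show "(z - x) \<bullet> i = c \<bullet> i + s i * (d \<bullet> i - c \<bullet> i)"
        using that by (simp add: x_def inner_diff_left inner_add_left inner_sum_left_Basis) (simp add: algebra_simps)
    qed
    have conv: "u < u + t * (v - u) \<and> u + t * (v - u) < v" if "u < v" "0 < t" "t < 1" for u v t :: real
    proof -
      have *: "t * (v - u) < 1 * (v - u)" using that by (intro mult_strict_right_mono) auto
      have "0 < t * (v - u)" using that by simp
      then show ?thesis using * by (simp only: mult_1) (simp only: less_diff_eq less_add_same_cancel1 add.commute simp_thms)
    qed
    have "x \<in> box a b" "z - x \<in> box c d"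
      using s p conv by (auto simp: box_def) (auto simp: x_def inner_sum_left_Basis)
    from C(2)[OF this] show "z \<in> C" by simp
  qed
  have le: "measure lebesgue (box (a + c) (b + d)) \<le> measure lebesgue C"
    using sub C(1) by (intro measure_mono_fmeasurable) auto
  have m: "measure lebesgue (box a b) = (\<Prod>i\<in>Basis. b \<bullet> i - a \<bullet> i)"
    "measure lebesgue (box c d) = (\<Prod>i\<in>Basis. d \<bullet> i - c \<bullet> i)"
    "measure lebesgue (box (a + c) (b + d)) = (\<Prod>i\<in>Basis. (b \<bullet> i - a \<bullet> i) + (d \<bullet> i - c \<bullet> i))"
    using p by (auto simp: measure_lborel_box_eq less_imp_le inner_diff_left inner_add_left
        algebra_simps intro!: prod.cong add_mono)
  have "2 ^ DIM('a) * sqrt (measure lebesgue (box a b) * measure lebesgue (box c d))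
      = (\<Prod>i\<in>Basis. 2 * sqrt ((b \<bullet> i - a \<bullet> i) * (d \<bullet> i - c \<bullet> i)))"
    by (simp add: m prod.distrib real_sqrt_mult sqrt_prod)
  also have "\<dots> \<le> (\<Prod>i\<in>Basis. (b \<bullet> i - a \<bullet> i) + (d \<bullet> i - c \<bullet> i))"
  proof (rule prod_mono, intro conjI)
    fix i :: 'a assume "i \<in> Basis"
    then have q: "b \<bullet> i - a \<bullet> i \<ge> 0" "d \<bullet> i - c \<bullet> i \<ge> 0" using p by (auto intro: less_imp_le)
    show "0 \<le> 2 * sqrt ((b \<bullet> i - a \<bullet> i) * (d \<bullet> i - c \<bullet> i))" using q by simp
    show "2 * sqrt ((b \<bullet> i - a \<bullet> i) * (d \<bullet> i - c \<bullet> i)) \<le> (b \<bullet> i - a \<bullet> i) + (d \<bullet> i - c \<bullet> i)"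
      using arith_geo_mean_sqrt[OF q] by simp
  qed
  finally show ?thesis using le m by simp
qed

lemma brunn_minkowski_box_families:
  fixes \<A> \<B> :: "'a::euclidean_space set set"
  assumes "box_family \<A>" "box_family \<B>" "\<A> \<noteq> {}" "\<B> \<noteq> {}" "C \<in> lmeasurable"
    and "\<And>x y. x \<in> \<Union>\<A> \<Longrightarrow> y \<in> \<Union>\<B> \<Longrightarrow> x + y \<in> C"
  shows "2 ^ DIM('a) * sqrt (measure lebesgue (\<Union>\<A>) * measure lebesgue (\<Union>\<B>)) \<le> measure lebesgue C"
  using assms
proof (induction "card \<A> + card \<B>" arbitrary: \<A> \<B> C rule: less_induct)
  case (less \<A> \<B> C)
  \<comment> \<open>Stated for renamed families because it is used with the roles of
    \<open>\<A>\<close> and \<open>\<B>\<close> exchanged when only \<open>\<B>\<close> has two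
    boxes.\<close>
  have step: "2 ^ DIM('a) * sqrt (measure lebesgue (\<Union>\<A>') * measure lebesgue (\<Union>\<B>')) \<le> measure lebesgue C"
    if A: "box_family \<A>'" and B: "box_family \<B>'" and ne: "\<B>' \<noteq> {}"
      and add: "\<And>x y. x \<in> \<Union>\<A>' \<Longrightarrow> y \<in> \<Union>\<B>' \<Longrightarrow> x + y \<in> C"
      and card: "card \<A>' + card \<B>' = card \<A> + card \<B>"
      and XY: "X \<in> \<A>'" "Y \<in> \<A>'" "X \<noteq> Y"
    for \<A>' \<B>' X Y
  proof -
    obtain i c X' Y' where i: "i \<in> Basis" and X': "X' \<in> \<A>'" "X' \<inter> {x. x \<bullet> i < c} = {}"
      and Y': "Y' \<in> \<A>'" "Y' \<inter> {x. c < x \<bullet> i} = {}"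
      using box_family_separate[OF A XY] by metis
    define cut where "cut H \<F> = (\<lambda>X. X \<inter> H) ` \<F> - {{}}" for H :: "'a set" and \<F>
    have Hl: "\<exists>a' b'. box a b \<inter> {x. x \<bullet> i < c} = box a' b'" for a b :: 'a and c
      using box_Int_halfspace(1)[OF i] by metis
    have Hr: "\<exists>a' b'. box a b \<inter> {x. c < x \<bullet> i} = box a' b'" for a b :: 'a and c
      using box_Int_halfspace(2)[OF i] by metis
    note cl = box_family_cut[OF _ Hl, folded cut_def] and cr = box_family_cut[OF _ Hr, folded cut_def]
    let ?m = "measure lebesgue :: 'a set \<Rightarrow> real"
    have i0: "i \<noteq> 0" using i by auto
    define U V where "U = \<Union>\<A>'" and "V = \<Union>\<B>'"
    have U: "U \<in> lmeasurable" "?m U > 0" and V: "V \<in> lmeasurable" "bounded V" "?m V > 0"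
      using A B ne XY box_family_lmeasurable box_family_pos unfolding U_def V_def by blast+
    define l where "l = ?m (U \<inter> {x. x \<bullet> i < c}) / ?m U"
    have Ueq: "?m U = ?m (U \<inter> {x. x \<bullet> i < c}) + ?m (U \<inter> {x. c < x \<bullet> i})"
      by (rule measure_cut) (use U i0 in auto)
    have l: "0 \<le> l" "l \<le> 1" using U Ueq by (auto simp: l_def)
    have Ul: "?m (U \<inter> {x. x \<bullet> i < c}) = l * ?m U" using U by (simp add: l_def)
    then have Ur: "?m (U \<inter> {x. c < x \<bullet> i}) = (1 - l) * ?m U" using Ueq by (simp add: algebra_simps)
    \<comment> \<open>The first cut prescribes the proportion \<open>l\<close>; continuity supplies
      a cut of \<open>V\<close> with the same proportion. This second cut may keep all boxes of
      \<open>\<B>'\<close> on one side, but it never increases their number, and the first cut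
      already decreases the total.\<close>
    obtain c' where Vl: "?m (V \<inter> {x. x \<bullet> i < c'}) = l * ?m V"
      using ex_cut[OF V(2,1) i, of "l * ?m V"] l V by (auto simp: mult_left_le_one_le)
    then have Vr: "?m (V \<inter> {x. c' < x \<bullet> i}) = (1 - l) * ?m V"
      using measure_cut[OF V(1) i0, of c'] by (simp add: algebra_simps)
    have IH: "2 ^ DIM('a) * sqrt ((t * ?m U) * (t * ?m V)) \<le> ?m D"
      if "t \<ge> 0" "box_family \<F>" "box_family \<G>" "card \<F> < card \<A>'" "card \<G> \<le> card \<B>'"
        "?m (\<Union>\<F>) = t * ?m U" "?m (\<Union>\<G>) = t * ?m V" "D \<in> lmeasurable"
        "\<And>x y. x \<in> \<Union>\<F> \<Longrightarrow> y \<in> \<Union>\<G> \<Longrightarrow> x + y \<in> D" for t \<F> \<G> D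
    proof (cases "t = 0")
      case False
      then have "\<F> \<noteq> {}" "\<G> \<noteq> {}" using that U V by auto
      then show ?thesis using less.hyps[of \<F> \<G> D] that card by simp
    qed simp
    define Cl Cr where "Cl = C \<inter> {x. x \<bullet> i < c + c'}" and "Cr = C \<inter> {x. c + c' < x \<bullet> i}"
    have H: "{x. x \<bullet> i < c + c'} \<in> sets lebesgue" "{x. c + c' < x \<bullet> i} \<in> sets lebesgue"
      by (auto intro!: sets_completionI_sets)
    have Cm: "Cl \<in> lmeasurable" "Cr \<in> lmeasurable"
      unfolding Cl_def Cr_def using less.prems(5) H by (auto intro!: fmeasurable_Int_fmeasurable simp del: Int_Collect)
    have Ceq: "?m C = ?m Cl + ?m Cr" unfolding Cl_def Cr_def by (rule measure_cut) (use less.prems i0 in auto)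
    \<comment> \<open>Homogeneity of degree one is what makes equal proportions work: the bounds for
      \<open>l\<close> and \<open>1 - l\<close> add up to the bound for the whole.\<close>
    have root: "sqrt ((t * ?m U) * (t * ?m V)) = t * sqrt (?m U * ?m V)" if "t \<ge> 0" for t
    proof -
      have "(t * ?m U) * (t * ?m V) = t\<^sup>2 * (?m U * ?m V)" by (simp add: power2_eq_square)
      then show ?thesis using that by (simp add: real_sqrt_mult)
    qed
    have "2 ^ DIM('a) * sqrt ((l * ?m U) * (l * ?m V)) \<le> ?m Cl"
    proof (rule IH[of l "cut {x. x \<bullet> i < c} \<A>'" "cut {x. x \<bullet> i < c'} \<B>'"])
      show "x + y \<in> Cl" if "x \<in> \<Union>(cut {x. x \<bullet> i < c} \<A>')" "y \<in> \<Union>(cut {x. x \<bullet> i < c'} \<B>')" for x y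
        using that add[of x y] unfolding cl(2)[OF A] cl(2)[OF B] by (auto simp: Cl_def inner_add_left)
    qed (use l A B X' cl Cm in \<open>auto simp: Ul Vl simp flip: U_def V_def\<close>)
    moreover have "2 ^ DIM('a) * sqrt (((1 - l) * ?m U) * ((1 - l) * ?m V)) \<le> ?m Cr"
    proof (rule IH[of "1 - l" "cut {x. c < x \<bullet> i} \<A>'" "cut {x. c' < x \<bullet> i} \<B>'"])
      show "x + y \<in> Cr" if "x \<in> \<Union>(cut {x. c < x \<bullet> i} \<A>')" "y \<in> \<Union>(cut {x. c' < x \<bullet> i} \<B>')" for x y
        using that add[of x y] unfolding cr(2)[OF A] cr(2)[OF B] by (auto simp: Cr_def inner_add_left)
    qed (use l A B Y' cr Cm in \<open>auto simp: Ur Vr simp flip: U_def V_def\<close>)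
    moreover have "t = l * t + (1 - l) * t" for t :: real by (simp add: algebra_simps)
    ultimately show ?thesis using l Ceq root[of l] root[of "1 - l"]
      unfolding U_def[symmetric] V_def[symmetric]
      by (metis (no_types, opaque_lifting) add_mono diff_ge_0_iff_ge mult.left_commute)
  qed
  show ?case
  proof (cases "\<exists>X Y. X \<in> \<A> \<and> Y \<in> \<A> \<and> X \<noteq> Y")
    case True
    then show ?thesis using step[of \<A> \<B>] less.prems by blast
  next
    case False
    show ?thesis
    proof (cases "\<exists>X Y. X \<in> \<B> \<and> Y \<in> \<B> \<and> X \<noteq> Y")
      case True
      then obtain X Y where "X \<in> \<B>" "Y \<in> \<B>" "X \<noteq> Y" by blast
      then show ?thesis using step[of \<B> \<A> X Y] less.prems
        by (metis add.commute mult.commute)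
    next
      case F2: False
      obtain X Y where XY: "\<A> = {X}" "\<B> = {Y}" using False F2 less.prems(3,4) by blast
      then obtain a b c d where "X = box a b" "Y = box c d"
        using less.prems(1,2) by (auto simp: box_family_def)
      then show ?thesis
        using brunn_minkowski_box[of a b c d C] XY less.prems by (auto simp: box_family_def)
    qed
  qed
qed


text \<open>An open set is a countable union of closed boxes, and finitely many of them exhaust its
  volume up to \<open>e\<close>. A division of their union consists of non-overlapping boxes, and
  passing to interiors loses only null faces.\<close>

lemma open_approx_box_family:
  fixes U :: "'a::euclidean_space set"
  assumes U: "open U" "bounded U" and e: "e > 0"
  obtains \<A> where "box_family \<A>" "\<Union>\<A> \<subseteq> U" "measure lebesgue U < measure lebesgue (\<Union>\<A>) + e"
proof -
  obtain \<D> where D: "countable \<D>" "\<D> \<subseteq> Pow U" "\<And>X. X \<in> \<D> \<Longrightarrow> \<exists>a b. X = cbox a b" "\<Union>\<D> = U"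
    using open_countable_Union_open_cbox[OF U(1)] by metis
  define S where "S n = \<Union>{X \<in> \<D>. to_nat_on \<D> X < n}" for n
  have fin: "finite {X \<in> \<D>. to_nat_on \<D> X < n}" for n
    using finite_vimage_IntI[OF finite_lessThan[of n] inj_on_to_nat_on[OF D(1)]]
    by (rule finite_subset[rotated]) auto
  have "(\<lambda>n. measure lebesgue (S n)) \<longlonglongrightarrow> measure lebesgue (\<Union>n. S n)"
  proof (rule Lim_measure_incseq)
    have "S n \<in> sets lebesgue" for n
      unfolding S_def using fin D(3) by (intro sets.finite_Union) (auto, metis lmeasurable_cbox fmeasurableD)
    then show "range S \<subseteq> sets lebesgue" by auto
    show "incseq S" unfolding incseq_def S_def by (intro allI impI Union_mono, auto)
    have "(\<Union>n. S n) = U" using D(4) by (auto simp: S_def)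
    then show "emeasure lebesgue (\<Union>n. S n) \<noteq> \<infinity>" using lmeasurable_open[OF U(2,1)] by (auto simp: fmeasurable_def)
  qed
  moreover have "(\<Union>n. S n) = U" using D(4) by (auto simp: S_def)
  ultimately obtain n where n: "measure lebesgue U - e < measure lebesgue (S n)"
    using e order_tendstoD(1)[of _ "measure lebesgue U" sequentially "measure lebesgue U - e"]
    by (auto simp: eventually_sequentially)
  obtain p where p: "p division_of S n"
    unfolding S_def using elementary_unions_intervals[OF fin, of n] D(3) by auto
  define \<A> where "\<A> = interior ` p - {{}}"
  show thesis
  proof (rule that)
    show "box_family \<A>"
      unfolding box_family_def
    proof (intro conjI)
      show "disjoint \<A>"
        using division_ofD(5)[OF p] unfolding \<A>_def pairwise_def disjnt_def by (metis DiffE imageE)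
      show "\<forall>X\<in>\<A>. \<exists>a b. X = box a b"
        unfolding \<A>_def using division_ofD(4)[OF p] by (metis DiffE imageE interior_cbox)
    qed (use division_ofD(1)[OF p] in \<open>auto simp: \<A>_def\<close>)
    have Aeq: "\<Union>\<A> = \<Union>(interior ` p)" by (auto simp: \<A>_def)
    have "S n \<subseteq> U" using D by (auto simp: S_def)
    moreover have "\<Union>\<A> \<subseteq> S n" using division_ofD(6)[OF p] interior_subset unfolding Aeq by blast
    ultimately show "\<Union>\<A> \<subseteq> U" by blast
    have "negligible (\<Union>(frontier ` p))"
    proof (rule negligible_Union)
      show "negligible t" if t: "t \<in> frontier ` p" for t
      proof -
        obtain k where "k \<in> p" "t = frontier k" using t by blast
        then show ?thesis using division_ofD(4)[OF p] negligible_convex_frontier convex_box(1) by metis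
      qed
    qed (use division_ofD(1)[OF p] in auto)
    moreover have "S n - \<Union>\<A> \<subseteq> \<Union>(frontier ` p)"
    proof
      fix x assume "x \<in> S n - \<Union>\<A>"
      then obtain k where k: "k \<in> p" "x \<in> k" "x \<notin> interior k"
        using division_ofD(6)[OF p] unfolding Aeq by auto
      then have "x \<in> frontier k" unfolding frontier_def using closure_subset by auto
      then show "x \<in> \<Union>(frontier ` p)" using k by blast
    qed
    ultimately have "negligible (S n - \<Union>\<A>)" by (rule negligible_subset)
    then have "measure lebesgue (S n) = measure lebesgue (\<Union>\<A>)"
      using \<open>\<Union>\<A> \<subseteq> S n\<close> \<open>box_family \<A>\<close>[THEN box_family_lmeasurable(1)]
      by (intro measure_negligible_symdiff) (auto simp: Diff_eq_empty_iff[THEN iffD2])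
    then show "measure lebesgue U < measure lebesgue (\<Union>\<A>) + e" using n by simp
  qed
qed

text \<open>Doubling \<open>C\<close> multiplies its volume by the same power of 2 that the box
  estimate carries, so sums become midpoints and the factor cancels. Convexity makes the frontiers
  null, so the interiors, which box families approximate, carry the full volume.\<close>

lemma brunn_minkowski_midpoint:
  fixes A B C :: "'a::euclidean_space set"
  assumes A: "convex A" "bounded A" and B: "convex B" "bounded B" and C: "C \<in> lmeasurable"
    and mid: "\<And>x y. x \<in> A \<Longrightarrow> y \<in> B \<Longrightarrow> midpoint x y \<in> C"
  shows "measure lebesgue A * measure lebesgue B \<le> (measure lebesgue C)\<^sup>2"
proof (cases "measure lebesgue A = 0 \<or> measure lebesgue B = 0")
  case False
  let ?m = "measure lebesgue :: 'a set \<Rightarrow> real"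
  have int: "?m (interior S) = ?m S" "bounded (interior S)" if "convex S" "bounded S" for S
    using that measure_interior[OF _ negligible_convex_frontier, of S] by (auto simp: bounded_interior)
  define D where "D = (\<lambda>x. 2 *\<^sub>R x) ` C"
  have Dm: "?m D = 2 ^ DIM('a) * ?m C" using measure_lebesgue_affine[of 2 0 C] by (simp add: D_def)
  have D: "D \<in> lmeasurable"
  proof -
    have "D \<in> sets lebesgue"
      unfolding D_def using C by (intro differentiable_image_in_sets_lebesgue) (auto intro!: derivative_intros)
    then show ?thesis using C emeasure_lebesgue_affine[of 2 0 C]
      by (auto simp: D_def fmeasurable_def ennreal_mult_less_top)
  qed
  have pos: "?m A > 0" "?m B > 0" using False by (simp_all add: zero_less_measure_iff)
  have *: "sqrt ((?m A - e) * (?m B - e)) \<le> ?m C" if e: "0 < e" "e < ?m A" "e < ?m B" for e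
  proof -
    obtain \<A> where a: "box_family \<A>" "\<Union>\<A> \<subseteq> interior A" "?m (interior A) < ?m (\<Union>\<A>) + e"
      using open_approx_box_family[of "interior A" e] int[OF A] e by auto
    obtain \<B> where b: "box_family \<B>" "\<Union>\<B> \<subseteq> interior B" "?m (interior B) < ?m (\<Union>\<B>) + e"
      using open_approx_box_family[of "interior B" e] int[OF B] e by auto
    have "\<A> \<noteq> {}" "\<B> \<noteq> {}" using a(3) b(3) e int A B by auto
    moreover have "x + y \<in> D" if "x \<in> \<Union>\<A>" "y \<in> \<Union>\<B>" for x y
    proof -
      have "midpoint x y \<in> C" using mid that a(2) b(2) interior_subset by blast
      moreover have "x + y = 2 *\<^sub>R midpoint x y" by (simp add: midpoint_def)
      ultimately show ?thesis unfolding D_def by blast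
    qed
    ultimately have "2 ^ DIM('a) * sqrt (?m (\<Union>\<A>) * ?m (\<Union>\<B>)) \<le> ?m D"
      using a b D by (intro brunn_minkowski_box_families)
    then have "sqrt (?m (\<Union>\<A>) * ?m (\<Union>\<B>)) \<le> ?m C" unfolding Dm by simp
    moreover have "(?m A - e) * (?m B - e) \<le> ?m (\<Union>\<A>) * ?m (\<Union>\<B>)"
      using a(3) b(3) e int A B by (intro mult_mono) auto
    ultimately show ?thesis using real_sqrt_le_mono order_trans by blast
  qed
  have "((\<lambda>e. sqrt ((?m A - e) * (?m B - e))) \<longlongrightarrow> sqrt ((?m A - 0) * (?m B - 0))) (at_right 0)"
    by (intro tendsto_intros)
  moreover have "\<forall>\<^sub>F e in at_right 0. sqrt ((?m A - e) * (?m B - e)) \<le> ?m C"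
    unfolding eventually_at_right_field using * pos by (intro exI[of _ "min (?m A) (?m B)"]) auto
  ultimately have "sqrt (?m A * ?m B) \<le> ?m C"
    by (simp add: tendsto_upperbound)
  then have "(sqrt (?m A * ?m B))\<^sup>2 \<le> (?m C)\<^sup>2" by (intro power_mono) auto
  then show ?thesis by simp
qed auto

section \<open>Localization to needles\<close>

lemma integrable_on_compact:
  fixes f :: "'a::euclidean_space \<Rightarrow> 'b::euclidean_space"
  assumes "compact K" "continuous_on K f"
  shows "integrable (lebesgue_on K) f"
proof -
  have "integrable lebesgue (\<lambda>x. indicator K x *\<^sub>R f x)"
    using borel_integrable_compact[OF assms]
    by (subst integrable_completion) (auto intro: borel_measurable_integrable)
  then show ?thesis using assms lmeasurable_compact[of K]
    by (subst integrable_restrict_space) auto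
qed

lemma integrable_lebesgue_on_indicator:
  fixes f :: "'a::euclidean_space \<Rightarrow> real"
  assumes f: "integrable (lebesgue_on K) f" and "K \<in> sets lebesgue" "H \<in> sets lebesgue"
  shows "integrable (lebesgue_on K) (\<lambda>x. indicator H x * f x)"
  using integrable_mult_indicator[OF _ f, of "H \<inter> K"] assms
  by (subst Bochner_Integration.integrable_cong[OF refl, of _ _ "\<lambda>x. indicator (H \<inter> K) x *\<^sub>R f x"])
     (auto simp: indicator_def sets_restrict_space_iff)

lemma integral_lebesgue_on_Int:
  fixes f :: "'a::euclidean_space \<Rightarrow> real"
  assumes "K \<in> sets lebesgue" "H \<in> sets lebesgue"
  shows "(LINT x|lebesgue_on K. indicator H x * f x) = (LINT x|lebesgue_on (K \<inter> H). f x)"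
  using assms by (subst (1 2) integral_restrict_space) (auto simp: indicator_inter_arith mult_ac)

lemma integral_lebesgue_on_spike_set:
  fixes f :: "'a::euclidean_space \<Rightarrow> 'b::euclidean_space"
  assumes S: "S \<in> sets lebesgue" and T: "T \<in> sets lebesgue" and neg: "negligible (S - T \<union> (T - S))"
  shows "(LINT x|lebesgue_on S. f x) = (LINT x|lebesgue_on T. f x)"
proof -
  have ae: "AE x in lebesgue. indicator S x *\<^sub>R f x = indicator T x *\<^sub>R f x"
    by (rule AE_I'[of "S - T \<union> (T - S)"]) (use neg negligible_iff_null_sets in \<open>auto simp: indicator_def\<close>)
  have "integral\<^sup>L lebesgue (\<lambda>x. indicator S x *\<^sub>R f x) = integral\<^sup>L lebesgue (\<lambda>x. indicator T x *\<^sub>R f x)"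
  \<comment> \<open>\<open>f\<close> is arbitrary: if one integrand is not measurable, neither is
    the other, and both integrals have the default value 0.\<close>
  proof (cases "(\<lambda>x. indicator S x *\<^sub>R f x) \<in> borel_measurable lebesgue")
    case True
    then show ?thesis using ae by (intro integral_cong_AE) (auto intro: borel_measurable_AE)
  next
    case False
    have ae': "AE x in lebesgue. indicator T x *\<^sub>R f x = indicator S x *\<^sub>R f x"
      using ae by (rule eventually_mono) (rule sym)
    have "(\<lambda>x. indicator T x *\<^sub>R f x) \<notin> borel_measurable lebesgue"
    proof
      assume "(\<lambda>x. indicator T x *\<^sub>R f x) \<in> borel_measurable lebesgue"
      from borel_measurable_AE[OF this ae'] False show False by contradiction
    qed
    then show ?thesis using False by (metis borel_measurable_integrable not_integrable_integral_eq)
  qed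
  then show ?thesis using S T by (simp add: integral_restrict_space)
qed

text \<open>The half-spaces whose boundary contains the plane where the coordinates \<open>a\<close>
  and \<open>b\<close> equal \<alpha> and \<beta> form a circle. Turning by \<open>pi\<close>
  exchanges the two sides and, as the total is zero, changes the sign of the integral of
  \<open>P\<close>; so some position makes it vanish on both sides, and one side keeps a positive
  integral of \<open>G\<close>. That the plane can be prescribed is what the localization
  uses.\<close>

lemma bisect_halfspace:
  fixes a b :: "'a::euclidean_space"
  assumes K: "compact K"
    and P: "continuous_on K P" "(LINT x|lebesgue_on K. P x) = (0::real)"
    and G: "continuous_on K G" "(LINT x|lebesgue_on K. G x) > (0::real)"
    and ab: "a \<in> Basis" "b \<in> Basis" "a \<noteq> b"
  obtains c s K' where "c \<noteq> 0 \<or> s \<noteq> (0::real)"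
    "K' = K \<inter> {y. c * (y \<bullet> a - \<alpha>) + s * (y \<bullet> b - \<beta>) \<le> 0}"
    "(LINT x|lebesgue_on K'. P x) = 0" "(LINT x|lebesgue_on K'. G x) > 0"
proof -
  define g where "g t y = cos t * (y \<bullet> a - \<alpha>) + sin t * (y \<bullet> b - \<beta>)" for t :: real and y
  define J where "J f t = (LINT x|lebesgue_on K. indicator {x. g t x < 0} x * f x)" for f :: "'a \<Rightarrow> real" and t
  have Km: "K \<in> sets lebesgue" using lmeasurable_compact[OF K] by auto
  have g_eq: "{x. g t x = 0} = {x. (cos t *\<^sub>R a + sin t *\<^sub>R b) \<bullet> x = cos t * \<alpha> + sin t * \<beta>}" for t
    by (auto simp: g_def inner_add_left inner_commute algebra_simps)
  have n0: "cos t *\<^sub>R a + sin t *\<^sub>R b \<noteq> 0" for t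
  proof
    assume "cos t *\<^sub>R a + sin t *\<^sub>R b = 0"
    then have "(cos t *\<^sub>R a + sin t *\<^sub>R b) \<bullet> a = 0" "(cos t *\<^sub>R a + sin t *\<^sub>R b) \<bullet> b = 0" by simp_all
    then have "cos t = 0" "sin t = 0" using ab by (simp_all add: inner_add_left inner_Basis)
    then show False using sin_cos_squared_add[of t] by simp
  qed
  have null: "negligible {x. g t x = 0}" for t
    unfolding g_eq by (rule negligible_hyperplane) (use n0 in auto)
  have gm: "g t \<in> borel_measurable borel" for t unfolding g_def by measurable
  have Hm: "{x. g t x < 0} \<in> sets lebesgue" "{x. g t x \<le> 0} \<in> sets lebesgue" for t
    using gm[of t] by (auto intro!: sets_completionI_sets)
  have pi_shift: "g (t + pi) x = - g t x" for t x by (simp add: g_def)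
  have Jcont: "continuous_on UNIV (J f)" if "continuous_on K f" for f
    unfolding J_def using integrable_on_compact[OF K that] Km null gm
    by (intro continuous_on_integral_halfspaces) (auto simp: g_def intro!: continuous_intros)
  \<comment> \<open>\<open>J\<close> uses open half-spaces, for which opposite sides are disjoint;
    the result needs closed ones to stay compact. They differ by a null hyperplane.\<close>
  have J_le: "J f t = (LINT x|lebesgue_on (K \<inter> {y. g t y \<le> 0}). f x)" for f t
  proof -
    have "J f t = (LINT x|lebesgue_on (K \<inter> {x. g t x < 0}). f x)"
      unfolding J_def by (rule integral_lebesgue_on_Int) (use Km Hm in auto)
    also have "\<dots> = (LINT x|lebesgue_on (K \<inter> {y. g t y \<le> 0}). f x)"
      by (rule integral_lebesgue_on_spike_set) (use Km Hm null[of t] in \<open>auto intro: negligible_subset\<close>)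
    finally show ?thesis .
  qed
  have J_split: "J f t + J f (t + pi) = (LINT x|lebesgue_on K. f x)" if "continuous_on K f" for f t
  proof -
    have fi: "integrable (lebesgue_on K) f" by (rule integrable_on_compact) fact+
    note im = integrable_lebesgue_on_indicator[OF fi Km Hm(1)]
    have "J f t + J f (t + pi)
        = (LINT x|lebesgue_on K. indicator {x. g t x < 0} x * f x + indicator {x. g (t + pi) x < 0} x * f x)"
      unfolding J_def by (subst Bochner_Integration.integral_add[symmetric]) (use im in auto)
    also have "\<dots> = (LINT x|lebesgue_on K. f x)"
    proof (rule integral_cong_AE)
      have "AE x in lebesgue_on K. g t x \<noteq> 0"
        using null[of t] Km negligible_iff_null_sets[of "{x. g t x = 0}"]
        by (subst AE_restrict_space_iff) (auto intro: AE_I')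
      then show "AE x in lebesgue_on K. indicator {x. g t x < 0} x * f x + indicator {x. g (t + pi) x < 0} x * f x = f x"
        by eventually_elim (auto simp: indicator_def pi_shift)
    qed (use im fi in \<open>auto intro!: borel_measurable_add borel_measurable_integrable\<close>)
    finally show ?thesis .
  qed
  have "\<exists>t. J P t = 0"
  proof -
    have "J P pi = - J P 0" using J_split[OF P(1), of 0] P(2) by simp
    moreover have "continuous_on {0..pi} (J P)" using Jcont[OF P(1)] continuous_on_subset by blast
    ultimately have "J P pi = - J P 0" "continuous_on {0..pi} (J P)" by blast+
    show ?thesis
    proof (cases "J P 0 \<le> 0")
      case True
      then show ?thesis using IVT'[of "J P" 0 0 pi] \<open>J P pi = - J P 0\<close> \<open>continuous_on {0..pi} (J P)\<close> by auto
    next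
      case False
      then show ?thesis using IVT2'[of "J P" pi 0 0] \<open>J P pi = - J P 0\<close> \<open>continuous_on {0..pi} (J P)\<close> by auto
    qed
  qed
  then obtain t0 where "J P t0 = 0" by blast
  moreover have "J P (t0 + pi) = 0" using J_split[OF P(1), of t0] P(2) \<open>J P t0 = 0\<close> by simp
  moreover have "J G t0 > 0 \<or> J G (t0 + pi) > 0" using J_split[OF G(1), of t0] G(2) by linarith
  ultimately obtain t where t: "J P t = 0" "J G t > 0" by blast
  show thesis
  proof (rule that[OF _ refl])
    show "cos t \<noteq> 0 \<or> sin t \<noteq> 0" using n0[of t] by auto
  qed (use t in \<open>simp_all add: J_le[unfolded g_def]\<close>)
qed

text \<open>Bisecting through a countable dense set of codimension-two planes makes the decreasing
  sets \<open>F n\<close> shrink to a set \<open>L\<close> contained in a line, and compactness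
  makes some \<open>F n\<close> thin enough. The needle is this \<open>F n\<close> and not
  \<open>L\<close>, which may be a null set and carry no information on the integrals.\<close>

lemma localization:
  fixes K :: "'a::euclidean_space set"
  assumes K: "compact K" "convex K"
    and P: "continuous_on K P" "(LINT x|lebesgue_on K. P x) = (0::real)"
    and G: "continuous_on K G" "(LINT x|lebesgue_on K. G x) > (0::real)"
    and \<eta>: "\<eta> > 0"
  obtains e K' where "norm e = 1" "K' \<subseteq> K" "compact K'" "convex K'"
    "(LINT x|lebesgue_on K'. P x) = 0" "(LINT x|lebesgue_on K'. G x) > 0"
    "\<And>x y. x \<in> K' \<Longrightarrow> y \<in> K' \<Longrightarrow> norm ((y - x) - ((y - x) \<bullet> e) *\<^sub>R e) < \<eta>"
proof -
  obtain D :: "(real \<times> real) set" where D: "countable D" "\<And>X. open X \<Longrightarrow> X \<noteq> {} \<Longrightarrow> \<exists>d\<in>D. d \<in> X"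
    by (rule countable_dense_setE) blast
  define I where "I = (Basis :: 'a set) \<times> (Basis :: 'a set) \<times> D"
  have "D \<noteq> {}" using D(2)[of UNIV] by auto
  then have I: "countable I" "I \<noteq> {}" using D(1) by (auto simp: I_def countable_finite)
  define good where "good K' \<longleftrightarrow> K' \<subseteq> K \<and> compact K' \<and> convex K' \<and>
     (LINT x|lebesgue_on K'. P x) = 0 \<and> (LINT x|lebesgue_on K'. G x) > 0" for K'
  \<comment> \<open>Records that \<open>S\<close> lies on one side of a hyperplane through the
    \<open>n\<close>-th plane of the enumeration. Indices with \<open>a = b\<close> describe no such
    plane and impose nothing.\<close>
  define cuts where "cuts n S \<longleftrightarrow> (case from_nat_into I n of (a, b, \<alpha>, \<beta>) \<Rightarrow> a \<noteq> b \<longrightarrow>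
     (\<exists>c s. (c \<noteq> 0 \<or> s \<noteq> (0::real)) \<and> (\<forall>y\<in>S. c * (y \<bullet> a - \<alpha>) + s * (y \<bullet> b - \<beta>) \<le> 0)))" for n S
  have "\<exists>F. \<forall>n. good (F n) \<and> F (Suc n) \<subseteq> F n \<and> cuts n (F (Suc n))"
  proof (rule dependent_nat_choice)
    show "\<exists>S. good S" using assms unfolding good_def by blast
    fix S n assume S: "good S"
    obtain a b \<alpha> \<beta> where i: "from_nat_into I n = (a, b, \<alpha>, \<beta>)" by (metis surj_pair)
    then have "(a, b, \<alpha>, \<beta>) \<in> I" using from_nat_into[OF I(2), of n] by simp
    then have ab: "a \<in> Basis" "b \<in> Basis" by (auto simp: I_def)
    show "\<exists>S'. good S' \<and> S' \<subseteq> S \<and> cuts n S'"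
    proof (cases "a = b")
      case True
      then show ?thesis using S i by (auto simp: cuts_def)
    next
      case False
      have "compact S" "continuous_on S P" "continuous_on S G" "(LINT x|lebesgue_on S. P x) = 0"
        "(LINT x|lebesgue_on S. G x) > 0"
        using S P G continuous_on_subset by (auto simp: good_def)
      then obtain c s S' where cs: "c \<noteq> 0 \<or> s \<noteq> (0::real)"
        "S' = S \<inter> {y. c * (y \<bullet> a - \<alpha>) + s * (y \<bullet> b - \<beta>) \<le> 0}"
        "(LINT x|lebesgue_on S'. P x) = 0" "(LINT x|lebesgue_on S'. G x) > 0"
        using bisect_halfspace[of S P G a b \<alpha> \<beta>] ab False by blast
      define H where "H = {y. c * (y \<bullet> a - \<alpha>) + s * (y \<bullet> b - \<beta>) \<le> 0}"
      have "H = {y. (c *\<^sub>R a + s *\<^sub>R b) \<bullet> y \<le> c * \<alpha> + s * \<beta>}"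
        by (auto simp: H_def inner_add_left inner_commute algebra_simps)
      then have "closed H" "convex H" by (simp_all add: closed_halfspace_le convex_halfspace_le)
      then have "good S'"
        using S cs unfolding good_def H_def[symmetric] by (auto intro: compact_Int_closed convex_Int)
      moreover have "cuts n S'" "S' \<subseteq> S" using i cs(1,2) by (auto simp: cuts_def)
      ultimately show ?thesis by blast
    qed
  qed
  then obtain F where F: "\<And>n. good (F n)" "\<And>n. F (Suc n) \<subseteq> F n" "\<And>n. cuts n (F (Suc n))" by blast
  have Fmono: "F n \<subseteq> F m" if "m \<le> n" for m n using lift_Suc_antimono_le[of F] F(2) that by blast
  have ne: "F n \<noteq> {}" for n using F(1)[of n] by (auto simp: good_def)
  define L where "L = (\<Inter>n. F n)"
  \<comment> \<open>Three points of \<open>L\<close> project to a degenerate triangle in every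
    coordinate plane. Otherwise a point of the dense set lies inside the triangle, and the cut made
    through it would leave all three vertices on one side of a line through an interior
    point.\<close>
  have minors: "((y - x) \<bullet> a) * ((z - x) \<bullet> b) = ((y - x) \<bullet> b) * ((z - x) \<bullet> a)"
    if xyz: "x \<in> L" "y \<in> L" "z \<in> L" and ab: "a \<in> Basis" "b \<in> Basis" for x y z a b
  proof (rule ccontr)
    define ua ub va vb where uv: "ua = (y - x) \<bullet> a" "ub = (y - x) \<bullet> b" "va = (z - x) \<bullet> a" "vb = (z - x) \<bullet> b"
    define d where "d = ua * vb - ub * va"
    assume "((y - x) \<bullet> a) * ((z - x) \<bullet> b) \<noteq> ((y - x) \<bullet> b) * ((z - x) \<bullet> a)"
    then have d0: "d \<noteq> 0" by (simp add: d_def uv)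
    then have "a \<noteq> b" by (auto simp: d_def uv)
    \<comment> \<open>Barycentric coordinates with respect to the projected triangle.
      \<open>W\<close> is its interior, and the centroid shows that it is nonempty.\<close>
    define \<sigma> \<tau> where "\<sigma> q = ((fst q - x \<bullet> a) * vb - (snd q - x \<bullet> b) * va) / d"
      and "\<tau> q = (ua * (snd q - x \<bullet> b) - ub * (fst q - x \<bullet> a)) / d" for q
    define W where "W = {q. 0 < \<sigma> q} \<inter> {q. 0 < \<tau> q} \<inter> {q. \<sigma> q + \<tau> q < 1}"
    have "open W" unfolding W_def \<sigma>_def \<tau>_def
      by (intro open_Int open_Collect_less) (use d0 in \<open>auto intro!: continuous_intros\<close>)
    moreover have "(x \<bullet> a + (ua + va) / 3, x \<bullet> b + (ub + vb) / 3) \<in> W"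
    proof -
      let ?q = "(x \<bullet> a + (ua + va) / 3, x \<bullet> b + (ub + vb) / 3)"
      have "(ua + va) / 3 * vb - (ub + vb) / 3 * va = d / 3" "ua * ((ub + vb) / 3) - ub * ((ua + va) / 3) = d / 3"
        by (simp_all add: d_def field_simps)
      then have "\<sigma> ?q = 1/3" "\<tau> ?q = 1/3" using d0 by (simp_all add: \<sigma>_def \<tau>_def)
      then show ?thesis by (simp add: W_def)
    qed
    ultimately obtain q where "q \<in> D" "q \<in> W" using D(2)[of W] by blast
    then obtain \<alpha> \<beta> where q: "(\<alpha>, \<beta>) \<in> D" "(\<alpha>, \<beta>) \<in> W" by (cases q) blast
    then have "(a, b, \<alpha>, \<beta>) \<in> I" using ab by (simp add: I_def)
    then obtain n where n: "from_nat_into I n = (a, b, \<alpha>, \<beta>)" using I from_nat_into_surj by metis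
    then obtain c s where cs: "c \<noteq> 0 \<or> s \<noteq> 0"
      and half: "\<And>y. y \<in> F (Suc n) \<Longrightarrow> c * (y \<bullet> a - \<alpha>) + s * (y \<bullet> b - \<beta>) \<le> 0"
      using F(3)[of n] \<open>a \<noteq> b\<close> by (auto simp: cuts_def)
    have xyzF: "x \<in> F (Suc n)" "y \<in> F (Suc n)" "z \<in> F (Suc n)" using xyz by (auto simp: L_def)
    define S T where "S = \<sigma> (\<alpha>, \<beta>)" and "T = \<tau> (\<alpha>, \<beta>)"
    have ST: "S > 0" "T > 0" "S + T < 1" using q(2) by (auto simp: W_def S_def T_def)
    have "d * (\<alpha> - x \<bullet> a) = d * (S * ua + T * va)" "d * (\<beta> - x \<bullet> b) = d * (S * ub + T * vb)"
      using d0 by (simp_all add: S_def T_def \<sigma>_def \<tau>_def field_simps) (simp_all add: d_def field_simps)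
    then have p: "\<alpha> - x \<bullet> a = S * ua + T * va" "\<beta> - x \<bullet> b = S * ub + T * vb" using d0 by simp_all
    \<comment> \<open>The values of the linear form along the edges at \<open>x\<close>. Measured
      from the cut point, which is a convex combination of the vertices with positive weights, the
      form is at most 0 at all three vertices, so it vanishes there. Hence \<open>A = B = 0\<close>,
      and Cramer's rule with the determinant \<open>d\<close> forces
      \<open>c = s = 0\<close>.\<close>
    define A B where "A = c * ua + s * ub" and "B = c * va + s * vb"
    have L: "c * (\<alpha> - x \<bullet> a) + s * (\<beta> - x \<bullet> b) = S * A + T * B"
      unfolding p A_def B_def by (simp add: algebra_simps)
    have h: "- (S * A + T * B) \<le> 0" "A \<le> S * A + T * B" "B \<le> S * A + T * B"
      using half[OF xyzF(1)] half[OF xyzF(2)] half[OF xyzF(3)]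
      unfolding L[symmetric] by (simp_all add: A_def B_def uv inner_diff_left algebra_simps)
    have "S * A + T * B \<le> (S + T) * (S * A + T * B)"
      using mult_left_mono[OF h(2), of S] mult_left_mono[OF h(3), of T] ST by (simp add: ring_distribs)
    then have "(1 - (S + T)) * (S * A + T * B) \<le> 0" by (simp add: algebra_simps)
    then have z: "S * A + T * B = 0" using ST h(1) by (auto simp: mult_le_0_iff)
    then have AB: "A \<le> 0" "B \<le> 0" using h by auto
    then have "S * A \<le> 0" "T * B \<le> 0" using ST by (auto simp: mult_le_0_iff)
    then have "S * A = 0" "T * B = 0" using z by linarith+
    then have "A = 0" "B = 0" using ST by auto
    have "c * d = vb * A - ub * B" "s * d = ua * B - va * A"
      by (simp_all add: d_def A_def B_def algebra_simps)
    then show False using cs d0 \<open>A = 0\<close> \<open>B = 0\<close> by simp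
  qed
  obtain e where e: "norm e = 1" "\<And>x y. x \<in> L \<Longrightarrow> y \<in> L \<Longrightarrow> y - x = ((y - x) \<bullet> e) *\<^sub>R e"
  proof (cases "\<exists>x0\<in>L. \<exists>y0\<in>L. x0 \<noteq> y0")
    case False
    obtain e :: 'a where "e \<in> Basis" using nonempty_Basis by blast
    show thesis by (rule that[of e]) (use False \<open>e \<in> Basis\<close> in auto)
  next
    case True
    then obtain x0 y0 where xy0: "x0 \<in> L" "y0 \<in> L" "x0 \<noteq> y0" by blast
    define u where "u = y0 - x0"
    have u0: "u \<noteq> 0" using xy0 by (simp add: u_def)
    have *: "w = ((w \<bullet> u) / (u \<bullet> u)) *\<^sub>R u" if "w = y - x0" "y \<in> L" for w y
    proof -
      have "(u \<bullet> u) *\<^sub>R w = (w \<bullet> u) *\<^sub>R u"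
      proof (rule euclidean_eqI)
        fix b :: 'a assume b: "b \<in> Basis"
        have "(w \<bullet> u) * (u \<bullet> b) = (\<Sum>a\<in>Basis. (u \<bullet> a) * ((u \<bullet> b) * (w \<bullet> a)))"
          unfolding euclidean_inner[of w u] sum_distrib_right by (intro sum.cong refl) (simp only: mult_ac)
        also have "\<dots> = (\<Sum>a\<in>Basis. (u \<bullet> a) * ((u \<bullet> a) * (w \<bullet> b)))"
          by (intro sum.cong refl) (use minors[OF xy0(1,2) that(2) _ b] in \<open>simp add: u_def that\<close>)
        also have "\<dots> = (u \<bullet> u) * (w \<bullet> b)"
          unfolding euclidean_inner[of u u] sum_distrib_right by (intro sum.cong refl) (simp only: mult_ac)
        finally show "((u \<bullet> u) *\<^sub>R w) \<bullet> b = ((w \<bullet> u) *\<^sub>R u) \<bullet> b" by simp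
      qed
      then have "(1 / (u \<bullet> u)) *\<^sub>R ((u \<bullet> u) *\<^sub>R w) = (1 / (u \<bullet> u)) *\<^sub>R ((w \<bullet> u) *\<^sub>R u)" by simp
      then show ?thesis using u0 by simp
    qed
    define e where "e = (1 / norm u) *\<^sub>R u"
    show thesis
    proof (rule that[of e])
      show "norm e = 1" using u0 by (simp add: e_def)
      fix x y assume "x \<in> L" "y \<in> L"
      then have "y - x = (((y - x0) \<bullet> u) / (u \<bullet> u)) *\<^sub>R u - (((x - x0) \<bullet> u) / (u \<bullet> u)) *\<^sub>R u"
        using *[OF refl, of x] *[OF refl, of y] by (simp only:) (simp only: diff_diff_eq2 diff_add_cancel)
      also have "\<dots> = (((y - x) \<bullet> u) / (u \<bullet> u)) *\<^sub>R u"
        by (simp add: inner_diff_left diff_divide_distrib flip: scaleR_left_diff_distrib)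
      also have "\<dots> = ((y - x) \<bullet> e) *\<^sub>R e"
        using u0 by (simp add: e_def dot_square_norm power2_eq_square)
      finally show "y - x = ((y - x) \<bullet> e) *\<^sub>R e" .
    qed
  qed
  \<comment> \<open>Pairs in \<open>F n\<close> whose difference has a component of length at least
    \<eta> across \<open>e\<close>. If all these compact sets were nonempty they would have a common
    element, a pair of points of \<open>L\<close> off the direction of \<open>e\<close>.\<close>
  define Z where "Z n = F n \<times> F n \<inter> {q. \<eta> \<le> norm ((snd q - fst q) - ((snd q - fst q) \<bullet> e) *\<^sub>R e)}" for n
  have "\<exists>n. Z n = {}"
  proof (rule ccontr)
    assume "\<nexists>n. Z n = {}"
    moreover have "compact (Z n)" for n
      unfolding Z_def using F(1)[of n]
      by (intro compact_Int_closed compact_Times closed_Collect_le) (auto simp: good_def intro!: continuous_intros)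
    moreover have "Z n \<subseteq> Z m" if "m \<le> n" for m n using Fmono[OF that] by (auto simp: Z_def)
    ultimately have "\<Inter>(range Z) \<noteq> {}" by (intro compact_nest) auto
    then obtain x y where "(x, y) \<in> \<Inter>(range Z)" by auto
    then have "\<eta> \<le> norm ((y - x) - ((y - x) \<bullet> e) *\<^sub>R e)" "x \<in> L" "y \<in> L" by (auto simp: Z_def L_def)
    then show False using e(2)[of x y] \<eta> by simp
  qed
  then obtain n where "Z n = {}" by blast
  show thesis
    by (rule that[OF e(1), of "F n"]) (use F(1)[of n] \<open>Z n = {}\<close> in \<open>auto simp: good_def Z_def not_le[symmetric]\<close>)
qed

text \<open>On a thin set \<open>P\<close> and \<open>g\<close> are, up to \<open>k\<close>,
  functions of the position along \<open>e\<close> alone. Slab volumes and one sample of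
  \<open>P\<close> per slab thus give the discrete weighted problem. Every error is a multiple of
  the volume, and the factor in front of the gradient term tends to (d/pi)^2 as \<open>N\<close>
  grows.\<close>

lemma needle_estimate:
  fixes K :: "'a::euclidean_space set" and P :: "'a \<Rightarrow> real" and g :: "'a \<Rightarrow> 'a" and n :: nat
  defines "N \<equiv> real (Suc n)"
  assumes K: "compact K" "convex K" "measure lebesgue K > 0"
    and e: "norm e = 1" and thin: "\<And>x y. x \<in> K \<Longrightarrow> y \<in> K \<Longrightarrow> norm ((y - x) - ((y - x) \<bullet> e) *\<^sub>R e) \<le> \<eta>"
    and diam: "\<And>x y. x \<in> K \<Longrightarrow> y \<in> K \<Longrightarrow> norm (y - x) \<le> d"
    and P: "\<And>x. x \<in> K \<Longrightarrow> (P has_derivative (\<lambda>h. g x \<bullet> h)) (at x)"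
    and g: "continuous_on K g"
    and unif: "\<And>x y. x \<in> K \<Longrightarrow> y \<in> K \<Longrightarrow> norm (y - x) \<le> 2 * d / N + \<eta> \<Longrightarrow>
        \<bar>P y - P x\<bar> \<le> k \<and> norm (g y - g x) \<le> k"
    and bound: "\<And>x. x \<in> K \<Longrightarrow> \<bar>P x\<bar> \<le> B \<and> norm (g x) \<le> B"
    and mean: "(LINT x|lebesgue_on K. P x) = 0"
  shows "(LINT x|lebesgue_on K. (P x)\<^sup>2) \<le> (2 * B * k + k\<^sup>2) * measure lebesgue K
     + d\<^sup>2 / (N\<^sup>2 * (2 - 2 * cos (pi / N))) * ((LINT x|lebesgue_on K. (norm (g x))\<^sup>2) + 2 * B * k * measure lebesgue K)"
proof -
  have N: "N > 0" by (simp add: N_def)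
  define M where "M = measure lebesgue K"
  have Pc: "continuous_on K P"
    by (meson P continuous_at_imp_continuous_on has_derivative_continuous)
  have Kne: "K \<noteq> {}" using K(3) by auto
  have Km: "K \<in> sets lebesgue" "K \<in> lmeasurable" using lmeasurable_compact[OF K(1)] by auto
  define t where "t x = x \<bullet> e" for x :: 'a
  have tc: "continuous_on K t" unfolding t_def by (intro continuous_intros)
  have negt: "negligible {x. t x = c}" for c
  proof -
    have "e \<noteq> 0" using e by auto
    then show ?thesis unfolding t_def using negligible_hyperplane[of e c] by (simp add: inner_commute)
  qed
  obtain y0 where y0: "y0 \<in> K" "\<And>x. x \<in> K \<Longrightarrow> t y0 \<le> t x"
    using continuous_attains_inf[OF K(1) Kne tc] by blast
  obtain y1 where y1: "y1 \<in> K" "\<And>x. x \<in> K \<Longrightarrow> t x \<le> t y1"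
    using continuous_attains_sup[OF K(1) Kne tc] by blast
  define l where "l = t y1 - t y0"
  have l: "l > 0"
  proof (rule ccontr)
    assume "\<not> l > 0"
    then have "K \<subseteq> {x. t x = t y0}" using y0 y1 unfolding l_def by force
    then have "negligible K" using negt negligible_subset by blast
    then show False using K(3) by (simp add: negligible_imp_measure0)
  qed
  have ld: "l \<le> d"
  proof -
    have "l = (y1 - y0) \<bullet> e" by (simp add: l_def t_def inner_diff_left)
    also have "\<dots> \<le> norm (y1 - y0)" using norm_cauchy_schwarz[of "y1 - y0" e] e by simp
    also have "\<dots> \<le> d" using diam y0 y1 by blast
    finally show ?thesis .
  qed
  \<comment> \<open>Two slab widths, because a point between \<open>y j\<close> and
    \<open>y (Suc j)\<close> will be compared with points of both slabs.\<close>
  have close: "norm (y - x) \<le> 2 * d / N + \<eta>" if "x \<in> K" "y \<in> K" "\<bar>t y - t x\<bar> \<le> 2 * l / N" for x y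
  proof -
    have "norm (y - x) \<le> norm (((y - x) \<bullet> e) *\<^sub>R e) + norm ((y - x) - ((y - x) \<bullet> e) *\<^sub>R e)"
      using norm_triangle_ineq[of "((y - x) \<bullet> e) *\<^sub>R e" "(y - x) - ((y - x) \<bullet> e) *\<^sub>R e"] by simp
    also have "norm (((y - x) \<bullet> e) *\<^sub>R e) = \<bar>t y - t x\<bar>" using e by (simp add: t_def inner_diff_left)
    also have "\<dots> \<le> 2 * d / N" using that(3) ld N by (rule_tac order_trans) (auto simp: divide_right_mono)
    finally show ?thesis using thin[OF that(1,2)] by simp
  qed
  define c where "c j = t y0 + real j * l / N" for j
  define H where "H j = {x. c j < t x} \<inter> {x. t x < c (Suc j)}" for j
  define S where "S j = K \<inter> H j" for j
  define m where "m j = measure lebesgue (S j)" for j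
  have c_Suc: "c (Suc j) = c j + l / N" for j by (simp add: c_def add_divide_distrib ring_distribs)
  have cN: "c (Suc n) = t y1" using N by (simp add: c_def l_def N_def)
  have Hopen: "open (H j)" for j
    unfolding H_def t_def by (intro open_Int open_Collect_less continuous_intros)
  have Hconv: "convex (H j)" for j
    unfolding H_def t_def
    using convex_halfspace_gt[of "c j" e] convex_halfspace_lt[of e "c (Suc j)"]
    by (auto simp: inner_commute intro: convex_Int)
  have Hm: "H j \<in> sets lebesgue" for j using Hopen by auto
  have Sm: "S j \<in> lmeasurable" for j
    unfolding S_def using Km Hm by (auto intro: fmeasurable_Int_fmeasurable)
  \<comment> \<open>Sample points on the segment joining the two extreme points in direction
    \<open>e\<close>, one halfway through each slab; convexity keeps them in
    \<open>K\<close>.\<close>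
  define y where "y j = y0 + ((real j + 1/2) / N) *\<^sub>R (y1 - y0)" for j
  have yK: "y j \<in> K" if "j \<le> n" for j
  proof -
    have "(real j + 1/2) / N \<le> 1" using that N by (simp add: N_def)
    then have "(1 - (real j + 1/2) / N) *\<^sub>R y0 + ((real j + 1/2) / N) *\<^sub>R y1 \<in> K"
      using N by (intro convexD_alt[OF K(2) y0(1) y1(1)]) auto
    then show ?thesis by (simp add: y_def algebra_simps)
  qed
  have ty: "t (y j) = c j + l / (2 * N)" for j
    using N by (simp add: y_def c_def t_def inner_add_left inner_diff_left l_def field_simps)
  have mpos: "m j > 0" if "j \<le> n" for j
  proof -
    have "interior K \<noteq> {}"
    proof
      assume "interior K = {}"
      then have "negligible K"
        using negligible_convex_interior[OF K(2)] by simp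
      then show False using K(3) by (simp add: negligible_imp_measure0)
    qed
    then have "closure (interior K) = K"
      using convex_closure_interior[OF K(2)] compact_imp_closed[OF K(1)] by (simp add: closure_closed)
    moreover have "l / (2 * N) < l / N" using l N by (simp add: field_simps)
    then have "y j \<in> H j" using l N by (simp add: H_def ty c_Suc)
    ultimately have "interior K \<inter> H j \<noteq> {}"
      using yK[OF that] open_Int_closure_eq_empty[OF Hopen[of j], of "interior K"] by auto
    then have "\<not> negligible (interior K \<inter> H j)"
      by (intro open_not_negligible) (auto intro: Hopen)
    moreover have "interior K \<inter> H j \<subseteq> S j" using interior_subset by (auto simp: S_def)
    ultimately have "\<not> negligible (S j)" using negligible_subset by blast
    then show ?thesis using Sm by (simp add: m_def negligible_iff_measure zero_less_measure_iff)
  qed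
  \<comment> \<open>The midpoint of a point in slab \<open>j\<close> and one in slab
    \<open>j + 2\<close> lies in slab \<open>j + 1\<close>, since the slabs have equal
    width.\<close>
  have mlc: "m j * m (Suc (Suc j)) \<le> (m (Suc j))\<^sup>2" for j
    unfolding m_def
  proof (rule brunn_minkowski_midpoint)
    show "convex (S j)" "convex (S (Suc (Suc j)))" using K(2) Hconv by (auto simp: S_def intro: convex_Int)
    show "bounded (S j)" "bounded (S (Suc (Suc j)))"
      using compact_imp_bounded[OF K(1)] by (auto simp: S_def intro: bounded_subset)
    fix x z assume xz: "x \<in> S j" "z \<in> S (Suc (Suc j))"
    have "midpoint x z \<in> K"
      using xz K(2) unfolding S_def convex_contains_segment by (meson IntD1 midpoint_in_closed_segment subsetD)
    moreover have "t (midpoint x z) = (t x + t z) / 2" by (simp add: t_def midpoint_def inner_add_left)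
    ultimately show "midpoint x z \<in> S (Suc j)"
      using xz by (auto simp: S_def H_def c_Suc)
  qed (rule Sm)
  have slab_close: "norm (y j - x) \<le> 2 * d / N + \<eta>" if "x \<in> S j" "j \<le> n" for x j
  proof (rule close)
    define q where "q = l / N"
    have q: "q > 0" "l / (2 * N) = q / 2" "2 * l / N = 2 * q" using l N by (auto simp: q_def)
    have "c j < t x" "t x < c j + q" using that by (auto simp: S_def H_def c_Suc q_def)
    then show "\<bar>t (y j) - t x\<bar> \<le> 2 * l / N" unfolding ty q(2,3) using q(1) by (auto simp: abs_le_iff)
  qed (use that yK in \<open>auto simp: S_def\<close>)
  \<comment> \<open>The open slabs miss only the hyperplanes at the \<open>c j\<close>, which are
    null.\<close>
  have AEslab: "AE x in lebesgue_on K. (\<Sum>j\<le>n. indicator (H j) x) = (1::real)"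
  proof -
    have "negligible (\<Union>j\<le>Suc n. {x. t x = c j})" using negt by (intro negligible_Union) auto
    then have "AE x in lebesgue_on K. x \<notin> (\<Union>j\<le>Suc n. {x. t x = c j})"
      using Km unfolding negligible_iff_null_sets by (subst AE_restrict_space_iff) (auto intro: AE_I')
    moreover have "AE x in lebesgue_on K. x \<in> K" by (rule AE_I2) simp
    ultimately show ?thesis
    proof eventually_elim
      case (elim x)
      then have x: "x \<in> K" "\<And>j. j \<le> Suc n \<Longrightarrow> t x \<noteq> c j" by auto
      define j0 where "j0 = (LEAST j. t x < c (Suc j))"
      have ex: "t x < c (Suc n)" using x y1(2)[of x] cN by force
      have j0: "t x < c (Suc j0)" "j0 \<le> n"
        unfolding j0_def using ex by (auto intro: LeastI Least_le)
      have low: "c j0 < t x"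
      proof (cases j0)
        case 0
        then show ?thesis using x y0(2)[of x] by (force simp: c_def)
      next
        case (Suc i)
        then have "\<not> t x < c (Suc i)" using not_less_Least[of i "\<lambda>j. t x < c (Suc j)"] by (simp add: j0_def)
        then show ?thesis using x(2)[of j0] Suc j0(2) by auto
      qed
      have cmono: "c i \<le> c j" if "i \<le> j" for i j
        using that l N by (auto simp: c_def intro!: divide_right_mono mult_right_mono)
      have "indicator (H j) x = (if j = j0 then 1 else 0 :: real)" for j
      proof (cases "j = j0")
        case False
        then have "Suc j \<le> j0 \<or> Suc j0 \<le> j" by auto
        then show ?thesis using cmono[of "Suc j" j0] cmono[of "Suc j0" j] low j0 False by (auto simp: H_def)
      qed (use low j0 in \<open>simp add: H_def\<close>)
      then show ?case using j0(2) by (simp add: sum.delta)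
    qed
  qed
  have slab_sum: "(LINT x|lebesgue_on K. f x) = (\<Sum>j\<le>n. LINT x|lebesgue_on (S j). f x)"
    and slab_int: "\<And>j. integrable (lebesgue_on (S j)) f"
    if f: "continuous_on K f" for f :: "'a \<Rightarrow> real"
  proof -
    have fi: "integrable (lebesgue_on K) f" by (rule integrable_on_compact) fact+
    note im = integrable_lebesgue_on_indicator[OF fi Km(1) Hm]
    show "integrable (lebesgue_on (S j)) f" for j
    proof -
      have "integrable lebesgue (\<lambda>x. indicator K x *\<^sub>R (indicator (H j) x * f x))"
        using im[of j] Km by (subst (asm) integrable_restrict_space) auto
      then show ?thesis using Sm[of j]
        by (subst integrable_restrict_space) (auto simp: S_def indicator_inter_arith mult_ac)
    qed
    have "(LINT x|lebesgue_on K. f x) = (LINT x|lebesgue_on K. (\<Sum>j\<le>n. indicator (H j) x * f x))"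
    proof (rule integral_cong_AE)
      show "AE x in lebesgue_on K. f x = (\<Sum>j\<le>n. indicator (H j) x * f x)"
        using AEslab by eventually_elim (simp only: sum_distrib_right[symmetric] mult_1)
      show "f \<in> borel_measurable (lebesgue_on K)" using fi by (rule borel_measurable_integrable)
      show "(\<lambda>x. \<Sum>j\<le>n. indicator (H j) x * f x) \<in> borel_measurable (lebesgue_on K)"
        by (intro borel_measurable_sum borel_measurable_integrable im)
    qed
    also have "\<dots> = (\<Sum>j\<le>n. LINT x|lebesgue_on K. indicator (H j) x * f x)"
      by (rule Bochner_Integration.integral_sum) (rule im)
    also have "\<dots> = (\<Sum>j\<le>n. LINT x|lebesgue_on (S j). f x)"
      unfolding S_def by (intro sum.cong refl integral_lebesgue_on_Int[OF Km(1) Hm])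
    finally show "(LINT x|lebesgue_on K. f x) = (\<Sum>j\<le>n. LINT x|lebesgue_on (S j). f x)" .
  qed
  have const: "(LINT x|lebesgue_on (S j). r) = m j * r" for j and r :: real
    using Sm[of j] by (simp add: m_def measure_restrict_space)
  have fin: "finite_measure (lebesgue_on (S j))" for j using finite_measure_lebesgue_on Sm by blast
  have slab_le: "(LINT x|lebesgue_on K. f x) \<le> (\<Sum>j\<le>n. m j * r j)"
    if "continuous_on K f" "\<And>j x. j \<le> n \<Longrightarrow> x \<in> S j \<Longrightarrow> f x \<le> r j" for f r
    unfolding slab_sum[OF that(1)] const[symmetric]
    by (intro sum_mono integral_mono slab_int[OF that(1)] finite_measure.integrable_const[OF fin]) (use that in auto)
  have slab_ge: "(\<Sum>j\<le>n. m j * r j) \<le> (LINT x|lebesgue_on K. f x)"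
    if "continuous_on K f" "\<And>j x. j \<le> n \<Longrightarrow> x \<in> S j \<Longrightarrow> r j \<le> f x" for f r
    unfolding slab_sum[OF that(1)] const[symmetric]
    by (intro sum_mono integral_mono slab_int[OF that(1)] finite_measure.integrable_const[OF fin]) (use that in auto)
  have Msum: "M = (\<Sum>j\<le>n. m j)"
  proof -
    have "(LINT x|lebesgue_on K. (1::real)) = M" using Km by (simp add: M_def measure_restrict_space)
    then show ?thesis using slab_sum[of "\<lambda>x. 1"] const[of _ 1] by (simp add: continuous_on_const)
  qed
  have M: "M > 0" using K(3) by (simp add: M_def)
  have k0: "k \<ge> 0"
    using unif[OF y0(1) y0(1)] close[OF y0(1) y0(1)] l N by auto
  have B0: "B \<ge> 0" using bound[OF y0(1)] by auto
  have sq: "a\<^sup>2 \<le> b\<^sup>2 + 2 * B * k" if "\<bar>a\<bar> \<le> B" "\<bar>b\<bar> \<le> B" "\<bar>a - b\<bar> \<le> k" for a b :: real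
  proof -
    have "(a - b) * (a + b) \<le> \<bar>a - b\<bar> * \<bar>a + b\<bar>" by (metis abs_ge_self abs_mult)
    also have "\<dots> \<le> k * (2 * B)" using that k0 by (intro mult_mono) auto
    finally show ?thesis by (simp add: power2_eq_square algebra_simps)
  qed
  define av where "av j = P (y j)" for j
  define T where "T = (\<Sum>j\<le>n. m j * (av j)\<^sup>2)"
  define s where "s = (\<Sum>j\<le>n. m j * av j)"
  have P2: "(LINT x|lebesgue_on K. (P x)\<^sup>2) \<le> T + 2 * B * k * M"
  proof -
    have "(LINT x|lebesgue_on K. (P x)\<^sup>2) \<le> (\<Sum>j\<le>n. m j * ((av j)\<^sup>2 + 2 * B * k))"
    proof (rule slab_le)
      fix j x assume j: "j \<le> n" and x: "x \<in> S j"
      then have "x \<in> K" by (simp add: S_def)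
      then show "(P x)\<^sup>2 \<le> (av j)\<^sup>2 + 2 * B * k"
        unfolding av_def using unif[OF _ yK[OF j] slab_close[OF x j]] bound yK[OF j]
        by (intro sq) (auto simp: abs_minus_commute)
    qed (intro continuous_intros Pc)
    then show ?thesis by (simp add: T_def Msum ring_distribs sum.distrib sum_distrib_left mult_ac)
  qed
  have s: "\<bar>s\<bar> \<le> k * M"
  proof -
    have near: "\<bar>P x - av j\<bar> \<le> k" if "j \<le> n" "x \<in> S j" for j x
      using that unif[OF _ yK[OF that(1)] slab_close[OF that(2,1)]] by (auto simp: S_def av_def abs_minus_commute)
    have "0 \<le> (\<Sum>j\<le>n. m j * (av j + k))"
      using slab_le[OF Pc, of "\<lambda>j. av j + k"] near mean by (force simp: abs_le_iff)
    moreover have "(\<Sum>j\<le>n. m j * (av j - k)) \<le> 0"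
      using slab_ge[OF Pc, of "\<lambda>j. av j - k"] near mean by (force simp: abs_le_iff)
    ultimately show ?thesis
      by (simp add: s_def Msum ring_distribs sum.distrib sum_subtractf sum_distrib_left mult_ac abs_le_iff)
  qed
  define lam where "lam = 2 - 2 * cos (pi / N)"
  have lam: "lam > 0"
  proof -
    have "cos (pi / N) < cos 0" using N by (intro cos_monotone_0_pi) (auto simp: N_def field_simps)
    then show ?thesis by (simp add: lam_def)
  qed
  \<comment> \<open>The samples have only approximately mean zero. Subtracting their weighted mean
    \<open>a\<close> changes the sum of squares by \<open>s\<^sup>2 / M\<close>, which is at most
    \<open>k\<^sup>2 * M\<close>.\<close>
  define a where "a = s / M"
  have disc: "lam * (\<Sum>j\<le>n. m j * (av j - a)\<^sup>2) \<le> (\<Sum>j<n. (m j + m (Suc j)) / 2 * (av (Suc j) - av j)\<^sup>2)"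
  proof -
    have "(\<Sum>j\<le>n. m j * (av j - a)) = s - a * M"
      by (simp add: s_def Msum ring_distribs sum_subtractf sum_distrib_left mult_ac)
    then have "(\<Sum>j\<le>n. m j * (av j - a)) = 0" using M by (simp add: a_def)
    then show ?thesis
      using discrete_log_concave_poincare[of n m "\<lambda>j. av j - a"] mpos mlc by (simp add: lam_def N_def)
  qed
  have "(\<Sum>j\<le>n. m j * (av j - a)\<^sup>2) = T - 2 * a * s + a\<^sup>2 * M"
    by (simp add: T_def s_def Msum power2_diff ring_distribs sum.distrib sum_subtractf sum_distrib_left sum_distrib_right mult_ac)
  also have "\<dots> = T - s\<^sup>2 / M" using M by (simp add: a_def field_simps power2_eq_square)
  finally have Teq: "(\<Sum>j\<le>n. m j * (av j - a)\<^sup>2) = T - s\<^sup>2 / M" .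
  have s2: "s\<^sup>2 / M \<le> k\<^sup>2 * M"
  proof -
    have "s\<^sup>2 \<le> (k * M)\<^sup>2" using s power_mono[of "\<bar>s\<bar>" "k * M" 2] by simp
    then show ?thesis using M by (simp add: field_simps power2_eq_square)
  qed
  \<comment> \<open>Mean value theorem between consecutive samples. Their difference is the
    \<open>N\<close>-th part of \<open>y1 - y0\<close>, so its length is at most
    \<open>d / N\<close>; this is how the diameter enters the constant.\<close>
  have "\<exists>z\<in>K. (av (Suc j) - av j)\<^sup>2 \<le> (d / N)\<^sup>2 * (norm (g z))\<^sup>2 \<and> c j \<le> t z \<and> t z \<le> c (Suc (Suc j))"
    if j: "j < n" for j
  proof -
    define w where "w = y (Suc j) - y j"
    have w: "w = (1 / N) *\<^sub>R (y1 - y0)"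
      by (simp add: w_def y_def add_divide_distrib flip: scaleR_left_diff_distrib)
    have seg: "y j + r *\<^sub>R w \<in> K" if "0 \<le> r" "r \<le> 1" for r
    proof -
      have "(1 - r) *\<^sub>R y j + r *\<^sub>R y (Suc j) \<in> K"
        using that j by (intro convexD_alt[OF K(2)] yK) auto
      then show ?thesis by (simp add: w_def algebra_simps)
    qed
    have "((\<lambda>r. P (y j + r *\<^sub>R w)) has_real_derivative (g (y j + r *\<^sub>R w) \<bullet> w)) (at r)"
      if "0 \<le> r" "r \<le> 1" for r
    proof -
      have "((\<lambda>r. y j + r *\<^sub>R w) has_derivative (\<lambda>h. h *\<^sub>R w)) (at r)"
        by (auto intro!: derivative_eq_intros)
      from has_derivative_compose[OF this P[OF seg[OF that]]] show ?thesis
        by (rule has_derivative_imp_has_field_derivative) simp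
    qed
    then have "\<exists>r. 0 < r \<and> r < 1 \<and> P (y j + 1 *\<^sub>R w) - P (y j + 0 *\<^sub>R w) = (1 - 0) * (g (y j + r *\<^sub>R w) \<bullet> w)"
      by (intro MVT2) auto
    then obtain r where r: "0 < r" "r < 1" "av (Suc j) - av j = g (y j + r *\<^sub>R w) \<bullet> w"
      by (auto simp: av_def w_def)
    have wd: "norm w \<le> d / N" using diam[OF y0(1) y1(1)] N by (simp add: w divide_right_mono)
    have "\<bar>av (Suc j) - av j\<bar> \<le> norm (g (y j + r *\<^sub>R w)) * norm w"
      unfolding r(3) by (rule Cauchy_Schwarz_ineq2)
    also have "\<dots> \<le> norm (g (y j + r *\<^sub>R w)) * (d / N)" by (rule mult_left_mono[OF wd norm_ge_zero])
    finally have "(av (Suc j) - av j)\<^sup>2 \<le> (norm (g (y j + r *\<^sub>R w)) * (d / N))\<^sup>2"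
      using power_mono[of "\<bar>av (Suc j) - av j\<bar>" _ 2] by simp
    then have sqb: "(av (Suc j) - av j)\<^sup>2 \<le> (d / N)\<^sup>2 * (norm (g (y j + r *\<^sub>R w)))\<^sup>2"
      by (simp only: power_mult_distrib mult.commute)
    have "t (y j + r *\<^sub>R w) = c j + l / (2 * N) + r * (l / N)"
      using ty[of j] w by (simp add: t_def inner_add_left inner_diff_left l_def)
    moreover have "r * (l / N) \<le> l / N" "0 \<le> r * (l / N)" using r l N by (auto simp: field_simps)
    moreover have "0 < l / (2 * N)" "l / (2 * N) < l / N" using l N by (auto simp: field_simps)
    ultimately have "c j \<le> t (y j + r *\<^sub>R w)" "t (y j + r *\<^sub>R w) \<le> c (Suc (Suc j))" unfolding c_Suc by linarith+
    with sqb seg[of r] r show ?thesis by (intro bexI[of _ "y j + r *\<^sub>R w"]) auto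
  qed
  then obtain z where z: "\<And>j. j < n \<Longrightarrow> z j \<in> K"
    "\<And>j. j < n \<Longrightarrow> (av (Suc j) - av j)\<^sup>2 \<le> (d / N)\<^sup>2 * (norm (g (z j)))\<^sup>2"
    "\<And>j. j < n \<Longrightarrow> c j \<le> t (z j) \<and> t (z j) \<le> c (Suc (Suc j))" by metis
  define I where "I = (LINT x|lebesgue_on K. (norm (g x))\<^sup>2)"
  have gz: "(norm (g (z j)))\<^sup>2 - 2 * B * k \<le> (norm (g x))\<^sup>2"
    if "j < n" "x \<in> S j \<or> x \<in> S (Suc j)" for j x
  proof -
    have x: "x \<in> K" using that by (auto simp: S_def)
    have "\<bar>t (z j) - t x\<bar> \<le> 2 * l / N" using z(3)[OF that(1)] that(2) by (auto simp: S_def H_def c_Suc abs_le_iff)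
    then have "norm (g (z j) - g x) \<le> k" using unif close x z(1)[OF that(1)] by blast
    then have "\<bar>norm (g (z j)) - norm (g x)\<bar> \<le> k" using norm_triangle_ineq3 order_trans by blast
    then show ?thesis using sq[of "norm (g (z j))" "norm (g x)"] bound x z(1)[OF that(1)] by auto
  qed
  have g2c: "continuous_on K (\<lambda>x. (norm (g x))\<^sup>2)" by (intro continuous_intros g)
  \<comment> \<open>There are \<open>n\<close> gradient samples \<open>z j\<close> for
    \<open>n + 1\<close> slabs. Here \<open>z j\<close> is assigned to slab \<open>j\<close> and the
    last slab is filled with a nonpositive value; \<open>low2\<close> assigns it to slab
    \<open>j + 1\<close> and fills the first. Their average matches the edge weights of the discrete
    inequality.\<close>
  have low1: "(\<Sum>j<n. m j * (norm (g (z j)))\<^sup>2) \<le> I + 2 * B * k * M"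
  proof -
    have "(\<Sum>j\<le>n. m j * (if j < n then (norm (g (z j)))\<^sup>2 - 2 * B * k else - 2 * B * k)) \<le> I"
      unfolding I_def
    proof (rule slab_ge[OF g2c])
      fix j x assume "j \<le> n" "x \<in> S j"
      have "- 2 * B * k \<le> 0" using B0 k0 by simp
      also have "0 \<le> (norm (g x))\<^sup>2" by simp
      finally show "(if j < n then (norm (g (z j)))\<^sup>2 - 2 * B * k else - 2 * B * k) \<le> (norm (g x))\<^sup>2"
        using gz[of j x] \<open>x \<in> S j\<close> by auto
    qed
    moreover have "(\<Sum>j\<le>n. m j * (if j < n then (norm (g (z j)))\<^sup>2 - 2 * B * k else - 2 * B * k))
        = (\<Sum>j<n. m j * (norm (g (z j)))\<^sup>2) - 2 * B * k * M"
      by (simp add: Msum ring_distribs sum_subtractf sum_distrib_left mult_ac flip: lessThan_Suc_atMost)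
    ultimately show ?thesis by simp
  qed
  have low2: "(\<Sum>j<n. m (Suc j) * (norm (g (z j)))\<^sup>2) \<le> I + 2 * B * k * M"
  proof -
    define r where "r j = (case j of 0 \<Rightarrow> - 2 * B * k | Suc i \<Rightarrow> (norm (g (z i)))\<^sup>2 - 2 * B * k)" for j
    have "(\<Sum>j\<le>n. m j * r j) \<le> I"
      unfolding I_def
    proof (rule slab_ge[OF g2c])
      fix j x assume "j \<le> n" "x \<in> S j"
      have "- 2 * B * k \<le> 0" using B0 k0 by simp
      also have "0 \<le> (norm (g x))\<^sup>2" by simp
      finally show "r j \<le> (norm (g x))\<^sup>2"
        using gz[of "j - 1" x] \<open>x \<in> S j\<close> \<open>j \<le> n\<close> by (auto simp: r_def split: nat.split)
    qed
    moreover have "(\<Sum>j\<le>n. m j * r j) = (\<Sum>j<n. m (Suc j) * (norm (g (z j)))\<^sup>2) - 2 * B * k * M"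
      unfolding Msum lessThan_Suc_atMost[symmetric] sum.lessThan_Suc_shift
      by (simp add: r_def ring_distribs sum_subtractf sum_distrib_left mult_ac)
    ultimately show ?thesis by simp
  qed
  have "(\<Sum>j<n. (m j + m (Suc j)) / 2 * (av (Suc j) - av j)\<^sup>2)
      \<le> (\<Sum>j<n. (m j + m (Suc j)) / 2 * ((d / N)\<^sup>2 * (norm (g (z j)))\<^sup>2))"
    by (intro sum_mono mult_left_mono z(2)) (use mpos in \<open>auto intro!: add_nonneg_nonneg intro: less_imp_le\<close>)
  also have "\<dots> = (d / N)\<^sup>2 * (((\<Sum>j<n. m j * (norm (g (z j)))\<^sup>2) + (\<Sum>j<n. m (Suc j) * (norm (g (z j)))\<^sup>2)) / 2)"
    by (simp add: sum_distrib_left sum.distrib[symmetric] sum_divide_distrib) (simp add: field_simps)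
  also have "\<dots> \<le> (d / N)\<^sup>2 * (I + 2 * B * k * M)" using low1 low2 by (intro mult_left_mono) auto
  finally have "lam * (T - s\<^sup>2 / M) \<le> (d / N)\<^sup>2 * (I + 2 * B * k * M)" using disc Teq by simp
  then have "T - s\<^sup>2 / M \<le> (d / N)\<^sup>2 * (I + 2 * B * k * M) / lam"
    using lam by (simp add: pos_le_divide_eq mult.commute)
  also have "\<dots> = d\<^sup>2 / (N\<^sup>2 * lam) * (I + 2 * B * k * M)" by (simp add: power_divide)
  finally show ?thesis using P2 s2 unfolding I_def M_def lam_def by (simp add: ring_distribs)
qed

section \<open>The Payne-Weinberger inequality\<close>

text \<open>By the half-angle formula 2 - 2 cos(2y) = 4 sin(y)^2 this reduces to sin(y)/y -> 1 at y
  = pi / (2N).\<close>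

lemma discrete_wirtinger_constant_tendsto:
  "(\<lambda>n. 1 / ((real (Suc n))\<^sup>2 * (2 - 2 * cos (pi / real (Suc n))))) \<longlonglongrightarrow> 1 / pi\<^sup>2"
proof -
  define y where "y n = pi / 2 * inverse (real (Suc n))" for n
  have y0: "y \<longlonglongrightarrow> 0"
    unfolding y_def using tendsto_mult_right_zero[OF LIMSEQ_inverse_real_of_nat] by blast
  have ypos: "y n > 0" for n by (simp add: y_def)
  have "((\<lambda>h. (sin (0 + h) - sin 0) / h) \<longlongrightarrow> cos 0) (at (0::real))"
    using DERIV_sin[of "0::real"] by (simp add: DERIV_def)
  then have "((\<lambda>h. sin h / h) \<longlongrightarrow> 1) (at (0::real))" by simp
  moreover have "filterlim y (at 0) sequentially"
  proof -
    have "y n \<noteq> 0" for n using ypos[of n] by simp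
    then show ?thesis using y0 by (simp add: filterlim_at)
  qed
  ultimately have "(\<lambda>n. sin (y n) / y n) \<longlonglongrightarrow> 1" by (rule filterlim_compose)
  then have "(\<lambda>n. 1 / (pi\<^sup>2 * (sin (y n) / y n)\<^sup>2)) \<longlonglongrightarrow> 1 / (pi\<^sup>2 * 1\<^sup>2)"
    by (intro tendsto_intros) auto
  moreover have "pi\<^sup>2 * (sin (y n) / y n)\<^sup>2 = (real (Suc n))\<^sup>2 * (2 - 2 * cos (pi / real (Suc n)))" for n
  proof -
    define N where "N = real (Suc n)"
    have N: "N > 0" by (simp add: N_def)
    have "2 * (pi / 2 * t) = pi * t" for t by simp
    then have yN: "2 * y n = pi / N" unfolding y_def N_def divide_inverse by blast
    have "2 - 2 * (1 - 2 * t) = 4 * t" for t :: real by simp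
    then have "2 - 2 * cos (pi / N) = 4 * (sin (y n))\<^sup>2"
      unfolding yN[symmetric] cos_double_sin by blast
    then have "N\<^sup>2 * (2 - 2 * cos (pi / N)) = (2 * N * y n)\<^sup>2 * (sin (y n) / y n)\<^sup>2"
      using ypos[of n] by (simp add: power_mult_distrib power_divide)
    also have "2 * N * y n = pi" using yN N by (simp add: field_simps)
    finally show ?thesis by (simp only: N_def)
  qed
  ultimately show ?thesis by (simp only: power_one mult_1_right)
qed

theorem payne_weinberger:
  fixes K :: "'a::euclidean_space set" and P :: "'a \<Rightarrow> real" and g :: "'a \<Rightarrow> 'a"
  assumes K: "compact K" "convex K"
    and P: "\<And>x. x \<in> K \<Longrightarrow> (P has_derivative (\<lambda>h. g x \<bullet> h)) (at x)"
    and g: "continuous_on K g"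
    and mean: "(LINT x|lebesgue_on K. P x) = 0"
  shows "(LINT x|lebesgue_on K. (P x)\<^sup>2) \<le> (diameter K / pi)\<^sup>2 * (LINT x|lebesgue_on K. (norm (g x))\<^sup>2)"
proof (rule ccontr)
  define d where "d = diameter K"
  define D where "D = (LINT x|lebesgue_on K. (P x)\<^sup>2) - (d / pi)\<^sup>2 * (LINT x|lebesgue_on K. (norm (g x))\<^sup>2)"
  assume "\<not> ?thesis"
  then have D: "D > 0" by (simp add: D_def d_def)
  have Pc: "continuous_on K P"
    by (meson P continuous_at_imp_continuous_on has_derivative_continuous)
  have Km: "K \<in> lmeasurable" using lmeasurable_compact[OF K(1)] .
  have Kne: "K \<noteq> {}" using D by (auto simp: D_def)
  have int: "integrable (lebesgue_on S) (\<lambda>x. (P x)\<^sup>2)" "integrable (lebesgue_on S) (\<lambda>x. (norm (g x))\<^sup>2)"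
     "(LINT x|lebesgue_on S. (c::real)) = measure lebesgue S * c" "integrable (lebesgue_on S) (\<lambda>x. c::real)"
    if "compact S" "S \<subseteq> K" for S c
    using that Pc g lmeasurable_compact[OF that(1)]
    by (auto intro!: integrable_on_compact continuous_intros intro: continuous_on_subset simp: measure_restrict_space)
  have null: "measure lebesgue S > 0" if "compact S" "S \<subseteq> K" "(LINT x|lebesgue_on S. f x) > (0::real)" for S f
  proof (rule ccontr)
    assume "\<not> measure lebesgue S > 0"
    then have "measure lebesgue S = 0" using measure_nonneg[of lebesgue S] by linarith
    then have "negligible S" using lmeasurable_compact[OF that(1)] by (simp add: negligible_iff_measure)
    then have "(LINT x|lebesgue_on S. f x) = (LINT x|lebesgue_on {}. f x)"
      using lmeasurable_compact[OF that(1)] by (intro integral_lebesgue_on_spike_set) auto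
    then show False using that by simp
  qed
  define M where "M = measure lebesgue K"
  have M: "M > 0"
    unfolding M_def
  proof (rule null[OF K(1) subset_refl])
    have "(d / pi)\<^sup>2 * (LINT x|lebesgue_on K. (norm (g x))\<^sup>2) \<ge> 0" by (simp add: integral_nonneg_AE)
    then show "(LINT x|lebesgue_on K. (P x)\<^sup>2) > 0" using D unfolding D_def by linarith
  qed
  \<comment> \<open>Half of the violation, spread evenly over \<open>K\<close>: the integral of
    \<open>G\<close> over \<open>K\<close> is still \<open>D / 2\<close>, while on a needle
    \<open>c0\<close> times the volume is available to absorb the errors.\<close>
  define c0 where "c0 = D / (2 * M)"
  have c0: "c0 > 0" using D M by (simp add: c0_def)
  define G where "G x = (P x)\<^sup>2 - (d / pi)\<^sup>2 * (norm (g x))\<^sup>2 - c0" for x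
  have Gint: "(LINT x|lebesgue_on S. G x) = (LINT x|lebesgue_on S. (P x)\<^sup>2)
      - (d / pi)\<^sup>2 * (LINT x|lebesgue_on S. (norm (g x))\<^sup>2) - measure lebesgue S * c0"
    if "compact S" "S \<subseteq> K" for S
    unfolding G_def using int[OF that] by simp
  have "(LINT x|lebesgue_on K. G x) = D - M * c0" unfolding Gint[OF K(1) subset_refl] by (simp add: D_def M_def)
  also have "\<dots> > 0" using D M by (simp add: c0_def)
  finally have Gpos: "(LINT x|lebesgue_on K. G x) > 0" .
  have Gc: "continuous_on K G" unfolding G_def by (intro continuous_intros Pc g)
  obtain B1 where B1: "\<And>x. x \<in> K \<Longrightarrow> norm (P x) \<le> B1"
    using compact_imp_bounded[OF compact_continuous_image[OF Pc K(1)]] by (auto simp: bounded_iff)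
  obtain B2 where B2: "\<And>x. x \<in> K \<Longrightarrow> norm (g x) \<le> B2"
    using compact_imp_bounded[OF compact_continuous_image[OF g K(1)]] by (auto simp: bounded_iff)
  define B where "B = max B1 B2"
  have B: "\<bar>P x\<bar> \<le> B" "norm (g x) \<le> B" if "x \<in> K" for x
    using B1[OF that] B2[OF that] by (auto simp: B_def)
  have B0: "B \<ge> 0" using B(2) Kne norm_ge_zero order_trans by blast
  \<comment> \<open>The error per unit volume that the needle estimate leaves when \<open>s\<close>
    bounds both the oscillation within slabs and the excess of the discrete constant over
    1/pi^2.\<close>
  define err where "err s = (2 * B * s + s\<^sup>2) + d\<^sup>2 * (1 / pi\<^sup>2 + s) * (2 * B * s) + d\<^sup>2 * s * B\<^sup>2" for s
  have "(err \<longlongrightarrow> (2 * B * 0 + 0\<^sup>2) + d\<^sup>2 * (1 / pi\<^sup>2 + 0) * (2 * B * 0) + d\<^sup>2 * 0 * B\<^sup>2) (at_right 0)"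
    unfolding err_def by (intro tendsto_intros)
  then have "\<forall>\<^sub>F s in at_right 0. err s < c0" using c0 by (intro order_tendstoD) auto
  then obtain b where b: "b > 0" "\<And>s. 0 < s \<Longrightarrow> s < b \<Longrightarrow> err s < c0"
    by (auto simp: eventually_at_right_field)
  define s where "s = b / 2"
  have s: "s > 0" "err s < c0" using b by (auto simp: s_def)
  obtain r1 where r1: "r1 > 0" "\<And>x y. x \<in> K \<Longrightarrow> y \<in> K \<Longrightarrow> dist y x < r1 \<Longrightarrow> dist (P y) (P x) < s"
    using compact_uniformly_continuous[OF Pc K(1)] s(1) unfolding uniformly_continuous_on_def by metis
  obtain r2 where r2: "r2 > 0" "\<And>x y. x \<in> K \<Longrightarrow> y \<in> K \<Longrightarrow> dist y x < r2 \<Longrightarrow> dist (g y) (g x) < s"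
    using compact_uniformly_continuous[OF g K(1)] s(1) unfolding uniformly_continuous_on_def by metis
  \<comment> \<open>The range of uniform continuity is shared: one half for two slab widths, by the
    choice of \<open>n\<close>, and one half for the thickness of the needle.\<close>
  define r0 where "r0 = min r1 r2"
  have r0: "r0 > 0" using r1 r2 by (simp add: r0_def)
  have "(\<lambda>n. 2 * d * inverse (real (Suc n))) \<longlonglongrightarrow> 0"
    by (rule tendsto_mult_right_zero[OF LIMSEQ_inverse_real_of_nat])
  then have "\<forall>\<^sub>F n in sequentially. 2 * d * inverse (real (Suc n)) < r0 / 2"
    using r0 by (intro order_tendstoD) auto
  moreover have "\<forall>\<^sub>F n in sequentially. 1 / ((real (Suc n))\<^sup>2 * (2 - 2 * cos (pi / real (Suc n)))) < 1 / pi\<^sup>2 + s"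
    using order_tendstoD(2)[OF discrete_wirtinger_constant_tendsto] s(1) by simp
  ultimately have "\<forall>\<^sub>F n in sequentially. 2 * d * inverse (real (Suc n)) < r0 / 2 \<and>
     1 / ((real (Suc n))\<^sup>2 * (2 - 2 * cos (pi / real (Suc n)))) < 1 / pi\<^sup>2 + s" by (rule eventually_conj)
  then have "\<exists>n. 2 * d * inverse (real (Suc n)) < r0 / 2 \<and>
     1 / ((real (Suc n))\<^sup>2 * (2 - 2 * cos (pi / real (Suc n)))) < 1 / pi\<^sup>2 + s"
    by (rule eventually_happens'[OF sequentially_bot])
  then obtain n where n: "2 * d * inverse (real (Suc n)) < r0 / 2"
     "1 / ((real (Suc n))\<^sup>2 * (2 - 2 * cos (pi / real (Suc n)))) < 1 / pi\<^sup>2 + s" by blast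
  have n1: "2 * d / real (Suc n) < r0 / 2" using n(1) by (simp only: divide_inverse)
  obtain e L where e: "norm e = 1" and L: "L \<subseteq> K" "compact L" "convex L"
      "(LINT x|lebesgue_on L. P x) = 0" "(LINT x|lebesgue_on L. G x) > 0"
    and thin: "\<And>x y. x \<in> L \<Longrightarrow> y \<in> L \<Longrightarrow> norm ((y - x) - ((y - x) \<bullet> e) *\<^sub>R e) < r0 / 2"
    using localization[OF K Pc mean Gc Gpos, of "r0 / 2"] r0 by (auto simp del: not_less)
  define m where "m = measure lebesgue L"
  have m: "m > 0" unfolding m_def by (rule null) (use L in auto)
  define I where "I = (LINT x|lebesgue_on L. (norm (g x))\<^sup>2)"
  define r where "r = 1 / ((real (Suc n))\<^sup>2 * (2 - 2 * cos (pi / real (Suc n))))"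
  have est: "(LINT x|lebesgue_on L. (P x)\<^sup>2) \<le> (2 * B * s + s\<^sup>2) * measure lebesgue L
     + d\<^sup>2 / ((real (Suc n))\<^sup>2 * (2 - 2 * cos (pi / real (Suc n)))) *
       ((LINT x|lebesgue_on L. (norm (g x))\<^sup>2) + 2 * B * s * measure lebesgue L)"
  proof (rule needle_estimate[where e = e and \<eta> = "r0 / 2"])
    show "norm (y - x) \<le> d" if "x \<in> L" "y \<in> L" for x y
      using diameter_bounded_bound[OF compact_imp_bounded[OF K(1)], of y x] that L(1) by (auto simp: d_def dist_norm)
    show "\<bar>P y - P x\<bar> \<le> s \<and> norm (g y - g x) \<le> s"
      if "x \<in> L" "y \<in> L" "norm (y - x) \<le> 2 * d / real (Suc n) + r0 / 2" for x y
    proof -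
      have "dist y x < r0" using that(3) n1 by (simp add: dist_norm)
      then show ?thesis using r1(2)[of x y] r2(2)[of x y] that L(1)
        by (auto simp: r0_def dist_norm intro: less_imp_le)
    qed
  qed (use L P g B e m thin in \<open>auto simp: m_def intro: continuous_on_subset less_imp_le\<close>)
  have I: "0 \<le> I" "I \<le> B\<^sup>2 * m"
  proof -
    show "0 \<le> I" by (simp add: I_def integral_nonneg_AE)
    have "I \<le> (LINT x|lebesgue_on L. B\<^sup>2)"
      unfolding I_def using L B int by (intro integral_mono) (auto intro!: power_mono)
    then show "I \<le> B\<^sup>2 * m" unfolding int(3)[OF L(2,1)] by (simp only: m_def mult.commute)
  qed
  have "(LINT x|lebesgue_on L. (P x)\<^sup>2) \<le> (2 * B * s + s\<^sup>2) * m + d\<^sup>2 * (r * (I + 2 * B * s * m))"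
    using est by (simp add: m_def I_def r_def)
  also have "\<dots> \<le> (2 * B * s + s\<^sup>2) * m + d\<^sup>2 * ((1 / pi\<^sup>2 + s) * (I + 2 * B * s * m))"
    using n(2) I(1) B0 s(1) m by (intro add_left_mono mult_left_mono mult_right_mono) (auto simp: r_def)
  also have "\<dots> = (2 * B * s + s\<^sup>2) * m + d\<^sup>2 * (1 / pi\<^sup>2 + s) * (2 * B * s) * m + d\<^sup>2 * s * I + (d / pi)\<^sup>2 * I"
    by (simp add: power_divide algebra_simps)
  also have "\<dots> \<le> (2 * B * s + s\<^sup>2) * m + d\<^sup>2 * (1 / pi\<^sup>2 + s) * (2 * B * s) * m + d\<^sup>2 * s * (B\<^sup>2 * m) + (d / pi)\<^sup>2 * I"
    using I s(1) by (intro add_right_mono add_left_mono mult_left_mono) auto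
  also have "\<dots> = err s * m + (d / pi)\<^sup>2 * I" by (simp add: err_def algebra_simps)
  also have "\<dots> < c0 * m + (d / pi)\<^sup>2 * I" using s(2) m by simp
  finally show False using L(5) unfolding Gint[OF L(2,1)] by (simp add: m_def I_def mult.commute)
qed

section \<open>Smooth functions and polynomials\<close>

lemma frechet_derivative_eqI: "(f has_derivative f') (at x) \<Longrightarrow> frechet_derivative f (at x) = f'"
  using frechet_derivative_at by metis

lemma times_differentiable_imp_continuous: "times_differentiable n f \<Longrightarrow> continuous_on UNIV f"
  by (cases n) (auto simp: continuous_on_eq_continuous_within differentiable_imp_continuous_within)

lemma times_differentiable_SucD: "times_differentiable (Suc n) f \<Longrightarrow> times_differentiable n f"
proof (induction n arbitrary: f)
  case 0
  then show ?case using times_differentiable_imp_continuous by (simp del: times_differentiable.simps(2)) blast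
next
  case (Suc n)
  show ?case
    unfolding times_differentiable.simps(2)[of n]
    using Suc.prems Suc.IH unfolding times_differentiable.simps(2)[of "Suc n"] by blast
qed

lemma times_differentiable_const: "times_differentiable n (\<lambda>_. c)"
  by (induction n arbitrary: c) (auto simp: frechet_derivative_const)

lemma times_differentiable_add:
  "times_differentiable n f \<Longrightarrow> times_differentiable n g \<Longrightarrow> times_differentiable n (\<lambda>x. f x + g x)"
proof (induction n arbitrary: f g)
  case (Suc n)
  have "frechet_derivative (\<lambda>x. f x + g x) (at x) b
      = frechet_derivative f (at x) b + frechet_derivative g (at x) b" for x b
  proof -
    have "((\<lambda>x. f x + g x) has_derivative (\<lambda>h. frechet_derivative f (at x) h + frechet_derivative g (at x) h)) (at x)"
      using Suc.prems by (intro has_derivative_add) (auto simp: frechet_derivative_works)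
    from frechet_derivative_eqI[OF this] show ?thesis by simp
  qed
  then show ?case using Suc by auto
qed (auto intro: continuous_on_add)

lemma times_differentiable_mult:
  "times_differentiable n f \<Longrightarrow> times_differentiable n g \<Longrightarrow> times_differentiable n (\<lambda>x. f x * g x)"
proof (induction n arbitrary: f g)
  case (Suc n)
  have "frechet_derivative (\<lambda>x. f x * g x) (at x) b
      = f x * frechet_derivative g (at x) b + frechet_derivative f (at x) b * g x" for x b
  proof -
    have "((\<lambda>x. f x * g x) has_derivative (\<lambda>h. f x * frechet_derivative g (at x) h + frechet_derivative f (at x) h * g x)) (at x)"
      using Suc.prems by (intro has_derivative_mult) (auto simp: frechet_derivative_works)
    from frechet_derivative_eqI[OF this] show ?thesis by simp
  qed
  moreover have "times_differentiable n f" "times_differentiable n g"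
    using Suc.prems times_differentiable_SucD by blast+
  ultimately show ?case using Suc by (auto intro!: times_differentiable_add)
qed (auto intro: continuous_on_mult)

text \<open>\<open>F\<close> is a class of functions of one variable closed under differentiation,
  so the induction needs no formula for higher derivatives. It serves for affine functions and for
  the functions \<open>flat_exp p\<close>.\<close>

lemma times_differentiable_compose_affine:
  fixes a :: "'a::euclidean_space"
  assumes "q \<in> F" and F: "\<And>q. q \<in> F \<Longrightarrow> \<exists>q'\<in>F. \<forall>t. (q has_real_derivative q' t) (at t)"
  shows "times_differentiable n (\<lambda>x. q (a \<bullet> x + c))"
  using assms(1)
proof (induction n arbitrary: q)
  case (0 q)
  obtain q' where "\<And>t. (q has_real_derivative q' t) (at t)" using F[OF 0] by blast
  then have "continuous_on UNIV q" using DERIV_continuous_on by blast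
  then show ?case by (auto intro!: continuous_intros continuous_on_compose2[of UNIV q])
next
  case (Suc n q)
  obtain q' where q': "q' \<in> F" "\<And>t. (q has_real_derivative q' t) (at t)" using F[OF Suc.prems] by blast
  have D: "((\<lambda>x. q (a \<bullet> x + c)) has_derivative (\<lambda>h. q' (a \<bullet> x + c) * (a \<bullet> h))) (at x)" for x
  proof -
    have "((\<lambda>x. a \<bullet> x + c) has_derivative (\<lambda>h. a \<bullet> h)) (at x)" by (auto intro!: derivative_eq_intros)
    from has_derivative_compose[OF this q'(2)[unfolded has_field_derivative_def]] show ?thesis .
  qed
  then have "frechet_derivative (\<lambda>x. q (a \<bullet> x + c)) (at x) b = q' (a \<bullet> x + c) * (a \<bullet> b)" for x b
    using frechet_derivative_eqI[OF D[of x]] by simp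
  moreover have "\<And>x. (\<lambda>x. q (a \<bullet> x + c)) differentiable (at x)" using D differentiable_def by blast
  ultimately show ?case using Suc.IH[OF q'(1)]
    by (auto intro!: times_differentiable_mult times_differentiable_const)
qed

lemma smooth_const: "smooth (\<lambda>_. c)"
  by (simp add: smooth_def times_differentiable_const)

lemma smooth_add: "smooth f \<Longrightarrow> smooth g \<Longrightarrow> smooth (\<lambda>x. f x + g x)"
  by (simp add: smooth_def times_differentiable_add)

lemma smooth_mult: "smooth f \<Longrightarrow> smooth g \<Longrightarrow> smooth (\<lambda>x. f x * g x)"
  by (simp add: smooth_def times_differentiable_mult)

lemma smooth_sum: "(\<And>i. i \<in> I \<Longrightarrow> smooth (f i)) \<Longrightarrow> smooth (\<lambda>x. \<Sum>i\<in>I. f i x)"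
  by (induction I rule: infinite_finite_induct) (auto intro: smooth_const smooth_add)

lemma smooth_prod: "(\<And>i. i \<in> I \<Longrightarrow> smooth (f i)) \<Longrightarrow> smooth (\<lambda>x. \<Prod>i\<in>I. f i x)"
  by (induction I rule: infinite_finite_induct) (auto intro: smooth_const smooth_mult)

lemma smooth_inner: "smooth (\<lambda>x. x \<bullet> a)"
proof -
  let ?F = "range (\<lambda>(m, c) t. m * t + c :: real)"
  have "times_differentiable n (\<lambda>x. (\<lambda>t. t) (a \<bullet> x + 0))" for n
  proof (rule times_differentiable_compose_affine[of _ ?F])
    show "(\<lambda>t. t) \<in> ?F" by (rule range_eqI[of _ _ "(1, 0)"]) auto
    fix q :: "real \<Rightarrow> real" assume "q \<in> ?F"
    then obtain m c where q: "q = (\<lambda>t. m * t + c)" by auto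
    have "(\<lambda>_. m) \<in> ?F" by (rule range_eqI[of _ _ "(0, m)"]) auto
    moreover have "\<forall>t. (q has_real_derivative m) (at t)"
      unfolding q by (auto intro!: derivative_eq_intros)
    ultimately show "\<exists>q'\<in>?F. \<forall>t. (q has_real_derivative q' t) (at t)" by (intro bexI[of _ "\<lambda>_. m"])
  qed
  then show ?thesis by (simp add: smooth_def inner_commute)
qed

lemma smooth_power: "smooth f \<Longrightarrow> smooth (\<lambda>x. f x ^ n)"
  by (induction n) (auto intro: smooth_const smooth_mult)

lemma smooth_partial: "smooth f \<Longrightarrow> b \<in> Basis \<Longrightarrow> smooth (\<lambda>x. frechet_derivative f (at x) b)"
  unfolding smooth_def by (metis times_differentiable.simps(2))

lemma smooth_differentiable: "smooth f \<Longrightarrow> f differentiable (at x)"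
  unfolding smooth_def by (metis times_differentiable.simps(2))

lemma smooth_continuous: "smooth f \<Longrightarrow> continuous_on S f"
  unfolding smooth_def using times_differentiable_imp_continuous continuous_on_subset by blast

lemma grad_inner: 
  assumes "f differentiable (at x)" shows "grad f x \<bullet> h = frechet_derivative f (at x) h"
proof -
  interpret linear "frechet_derivative f (at x)" by (rule linear_frechet_derivative[OF assms])
  have "frechet_derivative f (at x) h = frechet_derivative f (at x) (\<Sum>b\<in>Basis. (h \<bullet> b) *\<^sub>R b)"
    by (simp add: euclidean_representation)
  also have "\<dots> = (\<Sum>b\<in>Basis. (h \<bullet> b) * frechet_derivative f (at x) b)"
    by (simp add: sum scaleR)
  also have "\<dots> = grad f x \<bullet> h"
    by (simp add: grad_def inner_sum_left inner_commute[of h] mult.commute)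
  finally show ?thesis by simp
qed

lemma has_derivative_grad: "f differentiable (at x) \<Longrightarrow> (f has_derivative (\<lambda>h. grad f x \<bullet> h)) (at x)"
  by (simp add: grad_inner frechet_derivative_works[symmetric])

lemma grad_eqI: "(f has_derivative (\<lambda>h. g \<bullet> h)) (at x) \<Longrightarrow> grad f x = g"
  unfolding grad_def by (simp add: frechet_derivative_eqI euclidean_representation)

lemma grad_const: "grad (\<lambda>_. c) = (\<lambda>_. 0)"
  by (rule ext, rule grad_eqI) simp

lemma grad_add:
  assumes "smooth f" "smooth g" shows "grad (\<lambda>x. f x + g x) = (\<lambda>x. grad f x + grad g x)"
proof
  fix x show "grad (\<lambda>x. f x + g x) x = grad f x + grad g x"
    using has_derivative_add[OF has_derivative_grad has_derivative_grad, of f x g] assms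
    by (intro grad_eqI) (simp add: smooth_differentiable inner_add_left)
qed

lemma grad_mult:
  assumes "smooth f" "smooth g" shows "grad (\<lambda>x. f x * g x) = (\<lambda>x. f x *\<^sub>R grad g x + g x *\<^sub>R grad f x)"
proof
  fix x show "grad (\<lambda>x. f x * g x) x = f x *\<^sub>R grad g x + g x *\<^sub>R grad f x"
    using has_derivative_mult[OF has_derivative_grad has_derivative_grad, of f x g] assms
    by (intro grad_eqI) (simp add: smooth_differentiable inner_add_left mult.commute)
qed

lemma grad_cmult: "smooth f \<Longrightarrow> grad (\<lambda>x. c * f x) = (\<lambda>x. c *\<^sub>R grad f x)"
  using grad_mult[of "\<lambda>_. c" f] by (simp add: smooth_const grad_const)

lemma grad_diff: "smooth f \<Longrightarrow> smooth g \<Longrightarrow> grad (\<lambda>x. f x - g x) = (\<lambda>x. grad f x - grad g x)"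
  using grad_add[of f "\<lambda>x. (-1) * g x"] grad_cmult[of g "-1"] smooth_mult[OF smooth_const, of g "-1"] by simp

lemma grad_sum:
  "finite I \<Longrightarrow> (\<And>i. i \<in> I \<Longrightarrow> smooth (f i)) \<Longrightarrow> grad (\<lambda>x. \<Sum>i\<in>I. f i x) = (\<lambda>x. \<Sum>i\<in>I. grad (f i) x)"
  by (induction I rule: finite_induct) (simp_all add: grad_const grad_add smooth_sum)

lemma continuous_on_grad: "smooth f \<Longrightarrow> continuous_on S (grad f)"
  unfolding grad_def by (intro continuous_intros smooth_continuous smooth_partial)

section \<open>Polynomials of bounded total degree\<close>

lemma finite_multi_indices: "finite (multi_indices r :: ('a::euclidean_space \<Rightarrow> nat) set)"
proof (rule finite_subset)
  show "multi_indices r \<subseteq> ((Basis :: 'a set) \<rightarrow>\<^sub>E {..r})"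
  proof
    fix \<alpha> :: "'a \<Rightarrow> nat" assume \<alpha>: "\<alpha> \<in> multi_indices r"
    have "\<alpha> b \<le> r" if "b \<in> Basis" for b
      using member_le_sum[of b Basis \<alpha>] that \<alpha> by (force simp: multi_indices_def)
    then show "\<alpha> \<in> Basis \<rightarrow>\<^sub>E {..r}" using \<alpha> by (auto simp: multi_indices_def PiE_iff)
  qed
  show "finite ((Basis :: 'a set) \<rightarrow>\<^sub>E {..r})" by (intro finite_PiE) auto
qed

definition monomial :: "('a::euclidean_space \<Rightarrow> nat) \<Rightarrow> 'a \<Rightarrow> real" where
  "monomial \<alpha> x = (\<Prod>b\<in>Basis. (x \<bullet> b) ^ \<alpha> b)"

lemma polys_alt: "polys r = {f. \<exists>c. f = (\<lambda>x. \<Sum>\<alpha>\<in>multi_indices r. c \<alpha> * monomial \<alpha> x)}"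
  by (simp add: polys_def monomial_def)

lemma smooth_monomial: "smooth (monomial \<alpha>)"
  unfolding monomial_def by (intro smooth_prod smooth_power smooth_inner)

lemma polys_smooth: "f \<in> polys r \<Longrightarrow> smooth f"
  by (auto simp: polys_alt intro!: smooth_sum smooth_mult smooth_const smooth_monomial)

lemma monomial_in_polys: "\<alpha> \<in> multi_indices r \<Longrightarrow> monomial \<alpha> \<in> polys r"
  unfolding polys_alt mem_Collect_eq
  by (rule exI[of _ "\<lambda>\<beta>. if \<beta> = \<alpha> then 1 else 0"])
     (simp add: finite_multi_indices if_distrib[of "\<lambda>c. c * _"] sum.delta cong: if_cong)

lemma polys_lincomb: "f \<in> polys r \<Longrightarrow> g \<in> polys r \<Longrightarrow> (\<lambda>x. f x + t * g x) \<in> polys r"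
proof -
  assume "f \<in> polys r" "g \<in> polys r"
  then obtain c d where "f = (\<lambda>x. \<Sum>\<alpha>\<in>multi_indices r. c \<alpha> * monomial \<alpha> x)"
    "g = (\<lambda>x. \<Sum>\<alpha>\<in>multi_indices r. d \<alpha> * monomial \<alpha> x)" by (auto simp: polys_alt)
  then show ?thesis unfolding polys_alt mem_Collect_eq
    by (intro exI[of _ "\<lambda>\<alpha>. c \<alpha> + t * d \<alpha>"]) (simp add: sum.distrib sum_distrib_left algebra_simps)
qed

lemma polys_add: "f \<in> polys r \<Longrightarrow> g \<in> polys r \<Longrightarrow> (\<lambda>x. f x + g x) \<in> polys r"
  using polys_lincomb[of f r g 1] by simp

lemma polys_diff: "f \<in> polys r \<Longrightarrow> g \<in> polys r \<Longrightarrow> (\<lambda>x. f x - g x) \<in> polys r"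
  using polys_lincomb[of f r g "-1"] by simp

lemma polys_zero: "(\<lambda>_. 0) \<in> polys r"
  unfolding polys_alt mem_Collect_eq by (rule exI[of _ "\<lambda>_. 0"]) simp

lemma polys_sum: "finite I \<Longrightarrow> (\<And>i. i \<in> I \<Longrightarrow> f i \<in> polys r) \<Longrightarrow> (\<lambda>x. \<Sum>i\<in>I. c i * f i x) \<in> polys r"
proof (induction I rule: finite_induct)
  case (insert i I)
  then show ?case using polys_lincomb[of "\<lambda>x. \<Sum>i\<in>I. c i * f i x" r "f i" "c i"] by (simp add: add.commute)
qed (simp add: polys_zero)

lemma polys_mono: "r \<le> s \<Longrightarrow> polys r \<subseteq> polys s"
proof
  fix f :: "'a \<Rightarrow> real" assume rs: "r \<le> s" and "f \<in> polys r"
  then obtain c where "f = (\<lambda>x. \<Sum>\<alpha>\<in>multi_indices r. c \<alpha> * monomial \<alpha> x)" by (auto simp: polys_alt)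
  moreover have "monomial \<alpha> \<in> polys s" if "\<alpha> \<in> multi_indices r" for \<alpha> :: "'a \<Rightarrow> nat"
    using that rs by (intro monomial_in_polys) (auto simp: multi_indices_def)
  ultimately show "f \<in> polys s" using polys_sum[OF finite_multi_indices, of r monomial s c] by simp
qed

lemma polys_const: "(\<lambda>_::'a::euclidean_space. c) \<in> polys r"
proof -
  let ?\<alpha> = "\<lambda>b\<in>(Basis :: 'a set). 0 :: nat"
  have "?\<alpha> \<in> multi_indices r" by (simp add: multi_indices_def)
  then have "monomial ?\<alpha> \<in> polys r" by (rule monomial_in_polys)
  moreover have "monomial ?\<alpha> = (\<lambda>x::'a. 1)" by (auto simp: monomial_def)
  ultimately show ?thesis using polys_lincomb[OF polys_zero, of "\<lambda>_. 1" r c] by simp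
qed

lemma polys_coordinate:
  fixes b :: "'a::euclidean_space" assumes b: "b \<in> Basis" and r: "r \<ge> 1"
  shows "(\<lambda>x. x \<bullet> b) \<in> polys r"
proof -
  let ?\<alpha> = "\<lambda>i\<in>Basis. if i = b then 1 else 0 :: nat"
  have "(\<Sum>i\<in>Basis. ?\<alpha> i) = 1" using b by simp
  then have "?\<alpha> \<in> multi_indices r" using r unfolding multi_indices_def by simp
  then have "monomial ?\<alpha> \<in> polys r" by (rule monomial_in_polys)
  moreover have "monomial ?\<alpha> = (\<lambda>x. x \<bullet> b)"
  proof
    fix x
    have "monomial ?\<alpha> x = (\<Prod>i\<in>Basis. if i = b then x \<bullet> b else 1)"
      unfolding monomial_def by (intro prod.cong) auto
    then show "monomial ?\<alpha> x = x \<bullet> b" using b by simp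
  qed
  ultimately show ?thesis by simp
qed

section \<open>Square-integrable functions\<close>

lemma L2_dominated_integrable:
  fixes k :: "'a \<Rightarrow> 'b::{banach, second_countable_topology}"
  assumes f: "f \<in> L2 M" and g: "g \<in> L2 M" and k: "k \<in> borel_measurable M"
    and le: "\<And>x. norm (k x) \<le> norm (f x) * norm (g x)"
  shows "integrable M k"
proof (rule Bochner_Integration.integrable_bound[OF _ k])
  show "integrable M (\<lambda>x. (norm (f x))\<^sup>2 + (norm (g x))\<^sup>2)" using f g by (auto simp: L2_def)
  show "AE x in M. norm (k x) \<le> norm ((norm (f x))\<^sup>2 + (norm (g x))\<^sup>2)"
  proof (rule AE_I2)
    fix x
    have "0 \<le> (norm (f x) - norm (g x))\<^sup>2" "0 \<le> (norm (f x))\<^sup>2" "0 \<le> (norm (g x))\<^sup>2" by simp_all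
    then have "norm (f x) * norm (g x) \<le> (norm (f x))\<^sup>2 + (norm (g x))\<^sup>2"
      by (simp only: power2_diff)
    then show "norm (k x) \<le> norm ((norm (f x))\<^sup>2 + (norm (g x))\<^sup>2)" using le[of x] by simp
  qed
qed

lemma L2_inner_integrable:
  assumes "f \<in> L2 M" "g \<in> L2 M"
  shows "integrable M (\<lambda>x. f x \<bullet> g x)"
  using assms by (intro L2_dominated_integrable[OF assms] Cauchy_Schwarz_ineq2[folded real_norm_def]) (auto simp: L2_def)

lemma L2_scaleR_integrable:
  assumes "f \<in> L2 M" "g \<in> L2 M"
  shows "integrable M (\<lambda>x. f x *\<^sub>R g x)"
  using assms by (intro L2_dominated_integrable[OF assms]) (auto simp: L2_def)

lemma L2_lincomb:
  assumes f: "f \<in> L2 M" and g: "g \<in> L2 M"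
  shows "(\<lambda>x. f x + c *\<^sub>R g x) \<in> L2 M"
proof -
  have "integrable M (\<lambda>x. (norm (f x))\<^sup>2 + 2 * c * (f x \<bullet> g x) + c\<^sup>2 * (norm (g x))\<^sup>2)"
    using assms L2_inner_integrable[OF assms] by (auto simp: L2_def)
  also have "(\<lambda>x. (norm (f x))\<^sup>2 + 2 * c * (f x \<bullet> g x) + c\<^sup>2 * (norm (g x))\<^sup>2)
     = (\<lambda>x. (norm (f x + c *\<^sub>R g x))\<^sup>2)"
  proof
    fix x show "(norm (f x))\<^sup>2 + 2 * c * (f x \<bullet> g x) + c\<^sup>2 * (norm (g x))\<^sup>2 = (norm (f x + c *\<^sub>R g x))\<^sup>2"
      unfolding power2_norm_eq_inner
      by (simp add: inner_add_left inner_add_right inner_commute[of "g x" "f x"] power2_eq_square algebra_simps)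
  qed
  finally show ?thesis using assms by (auto simp: L2_def)
qed

lemma L2_add: "f \<in> L2 M \<Longrightarrow> g \<in> L2 M \<Longrightarrow> (\<lambda>x. f x + g x) \<in> L2 M"
  using L2_lincomb[of f M g 1] by simp

lemma L2_diff: "f \<in> L2 M \<Longrightarrow> g \<in> L2 M \<Longrightarrow> (\<lambda>x. f x - g x) \<in> L2 M"
  using L2_lincomb[of f M g "-1"] by simp

lemma L2_zero: "(\<lambda>_. 0) \<in> L2 M"
  by (simp add: L2_def)

lemma L2_sum: "finite I \<Longrightarrow> (\<And>i. i \<in> I \<Longrightarrow> f i \<in> L2 M) \<Longrightarrow> (\<lambda>x. \<Sum>i\<in>I. c i *\<^sub>R f i x) \<in> L2 M"
proof (induction I rule: finite_induct)
  case (insert i I)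
  then show ?case using L2_lincomb[of "\<lambda>x. \<Sum>i\<in>I. c i *\<^sub>R f i x" M "f i" "c i"] by (simp add: add.commute)
qed (simp add: L2_zero)

lemma L2_inner_commute: "L2_inner M f g = L2_inner M g f"
  by (simp add: L2_inner_def inner_commute)

lemma L2_inner_lincomb_left:
  assumes "f \<in> L2 M" "g \<in> L2 M" "h \<in> L2 M"
  shows "L2_inner M (\<lambda>x. f x + c *\<^sub>R g x) h = L2_inner M f h + c * L2_inner M g h"
  using L2_inner_integrable[OF assms(1,3)] L2_inner_integrable[OF assms(2,3)]
  by (simp add: L2_inner_def inner_add_left)

lemma L2_inner_lincomb_right:
  assumes "f \<in> L2 M" "g \<in> L2 M" "h \<in> L2 M"
  shows "L2_inner M h (\<lambda>x. f x + c *\<^sub>R g x) = L2_inner M h f + c * L2_inner M h g"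
  using L2_inner_lincomb_left[OF assms] by (simp add: L2_inner_commute)

lemma L2_inner_diff_left:
  "f \<in> L2 M \<Longrightarrow> g \<in> L2 M \<Longrightarrow> h \<in> L2 M \<Longrightarrow> L2_inner M (\<lambda>x. f x - g x) h = L2_inner M f h - L2_inner M g h"
  using L2_inner_lincomb_left[of f M g h "-1"] by simp

lemma L2_inner_sum_right:
  assumes "finite I" "\<And>i. i \<in> I \<Longrightarrow> f i \<in> L2 M" "h \<in> L2 M"
  shows "L2_inner M h (\<lambda>x. \<Sum>i\<in>I. c i *\<^sub>R f i x) = (\<Sum>i\<in>I. c i * L2_inner M h (f i))"
  using assms
proof (induction I rule: finite_induct)
  case (insert i I)
  then show ?case
    using L2_inner_lincomb_right[OF L2_sum[of I f M c], of "f i" h "c i"] by (simp add: add.commute)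
qed (simp add: L2_inner_def)

lemma L2_inner_nonneg: "L2_inner M f f \<ge> 0"
  by (simp add: L2_inner_def integral_nonneg_AE)

lemma L2_norm_nonneg: "L2_norm M f \<ge> 0"
  by (simp add: L2_norm_def L2_inner_nonneg)

lemma L2_norm_power2: "(L2_norm M f)\<^sup>2 = L2_inner M f f"
  by (simp add: L2_norm_def L2_inner_nonneg)

lemma L2_inner_lincomb_self:
  assumes "f \<in> L2 M" "g \<in> L2 M"
  shows "L2_inner M (\<lambda>x. f x + c *\<^sub>R g x) (\<lambda>x. f x + c *\<^sub>R g x)
    = L2_inner M f f + 2 * c * L2_inner M f g + c\<^sup>2 * L2_inner M g g"
  using L2_inner_lincomb_left[OF assms L2_lincomb[OF assms, of c], of c]
    L2_inner_lincomb_right[OF assms assms(1), of c] L2_inner_lincomb_right[OF assms assms(2), of c]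
  by (simp add: L2_inner_commute[of M g f] power2_eq_square algebra_simps)

lemma linear_coeff_zero_if_quadratic_nonneg:
  fixes b c :: real
  assumes "\<And>t. 0 \<le> 2 * t * b + t\<^sup>2 * c"
  shows "b = 0"
proof (rule ccontr)
  assume "b \<noteq> 0"
  \<comment> \<open>Replacing \<open>c\<close> by a positive upper bound covers all signs of
    \<open>c\<close>, including 0, with the single test value \<open>- b / k\<close>.\<close>
  define k where "k = \<bar>c\<bar> + 1"
  have k: "k > 0" "c \<le> k" by (auto simp: k_def)
  have "0 \<le> 2 * (- b / k) * b + (- b / k)\<^sup>2 * c" by (rule assms)
  also have "\<dots> \<le> 2 * (- b / k) * b + (- b / k)\<^sup>2 * k" using k by (intro add_left_mono mult_left_mono) auto
  also have "\<dots> = - (b\<^sup>2 / k)" using k by (simp add: power2_eq_square)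
  finally show False using \<open>b \<noteq> 0\<close> k by (simp add: divide_le_0_iff)
qed

lemma L2_Cauchy_Schwarz:
  assumes "f \<in> L2 M" "g \<in> L2 M"
  shows "\<bar>L2_inner M f g\<bar> \<le> L2_norm M f * L2_norm M g"
proof -
  define A B C where "A = L2_inner M f f" and "B = L2_inner M f g" and "C = L2_inner M g g"
  have q: "0 \<le> A + 2 * t * B + t\<^sup>2 * C" for t
    using L2_inner_nonneg[of M "\<lambda>x. f x + t *\<^sub>R g x"] L2_inner_lincomb_self[OF assms, of t]
    by (simp add: A_def B_def C_def)
  have AC: "A \<ge> 0" "C \<ge> 0" by (simp_all add: A_def C_def L2_inner_nonneg)
  have "B\<^sup>2 \<le> A * C"
  proof (cases "C = 0")
    case True
    have "B = 0"
    proof (rule ccontr)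
      assume "B \<noteq> 0"
      then show False using q[of "- (A + 1) / (2 * B)"] True AC by (simp add: field_simps)
    qed
    then show ?thesis using True by simp
  next
    case False
    then have "C > 0" using AC by simp
    then show ?thesis using q[of "- B / C"] by (simp add: field_simps power2_eq_square)
  qed
  then have "sqrt (B\<^sup>2) \<le> sqrt (A * C)" by (rule real_sqrt_le_mono)
  then show ?thesis by (simp add: A_def B_def C_def L2_norm_def real_sqrt_mult)
qed

lemma L2_norm_triangle:
  assumes "f \<in> L2 M" "g \<in> L2 M"
  shows "L2_norm M (\<lambda>x. f x + g x) \<le> L2_norm M f + L2_norm M g"
proof (rule power2_le_imp_le)
  have "L2_inner M f g \<le> L2_norm M f * L2_norm M g" using L2_Cauchy_Schwarz[OF assms] by simp
  then show "(L2_norm M (\<lambda>x. f x + g x))\<^sup>2 \<le> (L2_norm M f + L2_norm M g)\<^sup>2"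
    using L2_inner_lincomb_self[OF assms, of 1] by (simp add: L2_norm_power2 power2_sum)
qed (simp add: L2_norm_nonneg)

lemma L2_inner_cong_AE:
  assumes "f \<in> L2 M" "f' \<in> L2 M" "AE x in M. f x = f' x" "g \<in> L2 M"
  shows "L2_inner M f g = L2_inner M f' g"
  unfolding L2_inner_def using assms
  by (intro integral_cong_AE) (auto simp: L2_def elim: eventually_mono)

lemma L2_norm_cong_AE:
  assumes "f \<in> L2 M" "f' \<in> L2 M" "AE x in M. f x = f' x"
  shows "L2_norm M f = L2_norm M f'"
  using L2_inner_cong_AE[OF assms assms(1)] L2_inner_cong_AE[OF assms assms(2)]
  by (simp add: L2_norm_def L2_inner_commute)

text \<open>Gram-Schmidt for a possibly dependent family, such as the gradients of monomials, where
  the constant contributes 0. Both \<open>f\<close> and the new element \<open>e k\<close> are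
  projected onto the old span, and \<open>f\<close> is then corrected along the residual
  \<open>r\<close> of \<open>e k\<close>.\<close>

lemma L2_projection_exists:
  assumes "finite I" "\<And>i. i \<in> I \<Longrightarrow> e i \<in> L2 M" "f \<in> L2 M"
  shows "\<exists>c. \<forall>i\<in>I. L2_inner M (\<lambda>x. f x - (\<Sum>j\<in>I. c j *\<^sub>R e j x)) (e i) = 0"
  using assms
proof (induction I arbitrary: f rule: finite_induct)
  case (insert k I)
  have eI: "\<And>i. i \<in> I \<Longrightarrow> e i \<in> L2 M" and ek: "e k \<in> L2 M" using insert.prems by auto
  obtain c where c: "\<And>i. i \<in> I \<Longrightarrow> L2_inner M (\<lambda>x. f x - (\<Sum>j\<in>I. c j *\<^sub>R e j x)) (e i) = 0"
    using insert.IH[OF eI insert.prems(2)] by blast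
  obtain d where d: "\<And>i. i \<in> I \<Longrightarrow> L2_inner M (\<lambda>x. e k x - (\<Sum>j\<in>I. d j *\<^sub>R e j x)) (e i) = 0"
    using insert.IH[OF eI ek] by blast
  define s where "s = (\<lambda>x. f x - (\<Sum>j\<in>I. c j *\<^sub>R e j x))"
  define w where "w = (\<lambda>x. \<Sum>j\<in>I. d j *\<^sub>R e j x)"
  define r where "r = (\<lambda>x. e k x - w x)"
  have wL: "w \<in> L2 M" unfolding w_def using insert.hyps(1) eI by (rule L2_sum)
  have sL: "s \<in> L2 M" unfolding s_def using insert.hyps(1) eI insert.prems(2) by (intro L2_diff L2_sum)
  have rL: "r \<in> L2 M" unfolding r_def using ek wL by (rule L2_diff)
  \<comment> \<open>If \<open>r\<close> has norm zero, the quotient is 0 by convention; this is the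
    right value because \<open>L2_inner M s r\<close> vanishes by Cauchy-Schwarz.\<close>
  define l where "l = L2_inner M s r / L2_inner M r r"
  define v where "v = (\<lambda>x. s x + (- l) *\<^sub>R r x)"
  have vL: "v \<in> L2 M" unfolding v_def using sL rL by (rule L2_lincomb)
  have vi: "L2_inner M v (e i) = 0" if "i \<in> I" for i
  proof -
    have "L2_inner M s (e i) = 0" "L2_inner M r (e i) = 0"
      using c[OF that] d[OF that] by (simp_all only: s_def r_def w_def)
    then show ?thesis
      unfolding v_def using L2_inner_lincomb_left[OF sL rL eI[OF that], of "- l"] by simp
  qed
  have vr: "L2_inner M v r = 0"
  proof -
    have "L2_inner M v r = L2_inner M s r - l * L2_inner M r r"
      unfolding v_def using L2_inner_lincomb_left[OF sL rL rL, of "- l"] by simp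
    also have "\<dots> = 0"
      using L2_Cauchy_Schwarz[OF sL rL] by (cases "L2_inner M r r = 0") (auto simp: l_def L2_norm_def)
    finally show ?thesis .
  qed
  have vw: "L2_inner M v w = 0"
    unfolding w_def using L2_inner_sum_right[where f = e and c = d, OF insert.hyps(1) eI vL] vi by simp
  have vk: "L2_inner M v (e k) = 0"
  proof -
    have "e k = (\<lambda>x. r x + 1 *\<^sub>R w x)" by (simp add: r_def)
    then show ?thesis using L2_inner_lincomb_right[OF rL wL vL, of 1] vr vw by simp
  qed
  define b where "b j = (if j = k then l else c j - l * d j)" for j
  have "v = (\<lambda>x. f x - (\<Sum>j\<in>insert k I. b j *\<^sub>R e j x))"
  proof
    fix x
    have "(\<Sum>j\<in>I. b j *\<^sub>R e j x) = (\<Sum>j\<in>I. c j *\<^sub>R e j x - l *\<^sub>R (d j *\<^sub>R e j x))"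
      using insert.hyps(2) by (intro sum.cong refl) (auto simp: b_def scaleR_left_diff_distrib)
    also have "\<dots> = (\<Sum>j\<in>I. c j *\<^sub>R e j x) - l *\<^sub>R w x"
      by (simp add: sum_subtractf w_def scaleR_sum_right)
    finally show "v x = f x - (\<Sum>j\<in>insert k I. b j *\<^sub>R e j x)"
      using insert.hyps by (simp add: v_def s_def r_def b_def scaleR_right_diff_distrib)
  qed
  then show ?case using vi vk by (intro exI[of _ b]) auto
qed simp

section \<open>Cutoff functions and integration by parts\<close>

text \<open>For \<open>p = 1\<close> this is the classical smooth function exp(-1/t), flat at 0. The
  polynomial factor in 1/t makes the class closed under differentiation.\<close>

definition flat_exp :: "real poly \<Rightarrow> real \<Rightarrow> real" where
  "flat_exp p t = (if t > 0 then poly p (1 / t) * exp (- (1 / t)) else 0)"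

lemma flat_exp_nonzeroD: "flat_exp p t \<noteq> 0 \<Longrightarrow> t > 0"
  by (auto simp: flat_exp_def split: if_splits)

lemma poly_over_exp_tendsto_0: "((\<lambda>s. poly p s / exp s) \<longlongrightarrow> 0) (at_top :: real filter)"
proof -
  have "((\<lambda>s. \<Sum>i\<le>degree p. coeff p i * (s ^ i / exp s)) \<longlongrightarrow> (\<Sum>i\<le>degree p. coeff p i * 0)) at_top"
    by (intro tendsto_sum tendsto_mult tendsto_const tendsto_power_div_exp_0)
  then show ?thesis by (simp add: poly_altdef sum_divide_distrib)
qed

text \<open>Differentiating in 1/t replaces \<open>p\<close> by \<open>p - pderiv p\<close> and
  brings the factor 1/t^2, the polynomial \<open>[:0, 0, 1:]\<close>. At 0 the exponential beats
  every power of 1/t.\<close>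

lemma flat_exp_has_derivative:
  "(flat_exp p has_real_derivative flat_exp ([:0, 0, 1:] * (p - pderiv p)) t) (at t)"
proof -
  consider "t > 0" | "t < 0" | "t = 0" by linarith
  then show ?thesis
  proof cases
    case 1
    have "((\<lambda>t. poly p (1 / t) * exp (- (1 / t))) has_real_derivative
        flat_exp ([:0, 0, 1:] * (p - pderiv p)) t) (at t)"
      using 1 by (auto intro!: derivative_eq_intros DERIV_chain2[OF poly_DERIV]
          simp: flat_exp_def field_simps power2_eq_square)
    then show ?thesis
      by (rule has_field_derivative_transform_within_open[of _ _ _ "{0<..}"]) (use 1 in \<open>auto simp: flat_exp_def\<close>)
  next
    case 2
    have "((\<lambda>t. 0) has_real_derivative flat_exp ([:0, 0, 1:] * (p - pderiv p)) t) (at t)"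
      using 2 by (simp add: flat_exp_def)
    then show ?thesis
      by (rule has_field_derivative_transform_within_open[of _ _ _ "{..<0}"]) (use 2 in \<open>auto simp: flat_exp_def\<close>)
  next
    case 3
    have "((\<lambda>h. poly (pCons 0 p) (inverse h) / exp (inverse h)) \<longlongrightarrow> 0) (at_right 0)"
      by (rule filterlim_compose[OF poly_over_exp_tendsto_0 filterlim_inverse_at_top_right])
    moreover have "\<forall>\<^sub>F h in at_right 0. poly (pCons 0 p) (inverse h) / exp (inverse h) = (flat_exp p (0 + h) - flat_exp p 0) / h"
      by (rule eventually_at_rightI[of 0 1]) (auto simp: flat_exp_def exp_minus field_simps)
    ultimately have "((\<lambda>h. (flat_exp p (0 + h) - flat_exp p 0) / h) \<longlongrightarrow> 0) (at_right 0)"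
      by (rule Lim_transform_eventually)
    moreover have "((\<lambda>h. (flat_exp p (0 + h) - flat_exp p 0) / h) \<longlongrightarrow> 0) (at_left 0)"
      by (rule tendsto_eventually, rule eventually_at_leftI[of "-1"]) (auto simp: flat_exp_def)
    ultimately have "((\<lambda>h. (flat_exp p (0 + h) - flat_exp p 0) / h) \<longlongrightarrow> 0) (at 0)"
      by (simp add: filterlim_at_split)
    then show ?thesis using 3 by (simp add: DERIV_def flat_exp_def)
  qed
qed

lemma smooth_flat_exp_affine: "smooth (\<lambda>x. flat_exp p (a \<bullet> x + c))"
  unfolding smooth_def
proof
  fix n
  show "times_differentiable n (\<lambda>x. flat_exp p (a \<bullet> x + c))"
    by (rule times_differentiable_compose_affine[of _ "range flat_exp"]) (use flat_exp_has_derivative in blast)+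
qed

lemma flat_exp_1_bounds: "0 \<le> flat_exp 1 t" "flat_exp 1 t \<le> 1"
  by (auto simp: flat_exp_def)

lemma flat_exp_1_tendsto: "(flat_exp 1 \<longlongrightarrow> 1) at_top"
proof -
  have "((\<lambda>t. exp (- inverse t)) \<longlongrightarrow> exp (- 0)) (at_top :: real filter)"
    by (intro tendsto_intros tendsto_inverse_0_at_top filterlim_ident)
  moreover have "\<forall>\<^sub>F t in at_top. exp (- inverse t) = flat_exp 1 t"
    using eventually_gt_at_top[of 0] by eventually_elim (simp add: flat_exp_def inverse_eq_divide)
  ultimately show ?thesis by (simp add: Lim_transform_eventually)
qed

text \<open>One factor per half-space of the polyhedron. Its argument is (n+1) times the slack of
  the inequality, minus 1: the shift keeps the support inside the interior, and the growth in
  \<open>n\<close> gives the limit 1. Bounded pointwise convergence is enough, as the gradients of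
  the cutoffs cancel where they are used.\<close>

lemma polyhedron_cutoff:
  fixes K :: "'a::euclidean_space set"
  assumes "polyhedron K" "compact K"
  obtains cut :: "nat \<Rightarrow> 'a \<Rightarrow> real" where
    "\<And>n. smooth (cut n)" "\<And>n x. 0 \<le> cut n x" "\<And>n x. cut n x \<le> 1"
    "\<And>n. closure {x. cut n x \<noteq> 0} \<subseteq> interior K" "\<And>n. compact (closure {x. cut n x \<noteq> 0})"
    "\<And>x. x \<in> interior K \<Longrightarrow> (\<lambda>n. cut n x) \<longlonglongrightarrow> 1"
proof -
  obtain F where F: "finite F" "K = \<Inter>F" "\<forall>h\<in>F. \<exists>a b. a \<noteq> 0 \<and> h = {x. a \<bullet> x \<le> b}"
    using assms(1) unfolding polyhedron_def by blast
  then obtain a b where ab: "\<And>h. h \<in> F \<Longrightarrow> a h \<noteq> 0 \<and> h = {x. a h \<bullet> x \<le> b h}" by metis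
  have inside: "a h \<bullet> x < b h" if "x \<in> interior K" "h \<in> F" for x h
  proof -
    have "K \<subseteq> {x. a h \<bullet> x \<le> b h}" using F(2) ab[OF that(2)] that(2) by blast
    then have "x \<in> interior {x. a h \<bullet> x \<le> b h}" using that(1) interior_mono by blast
    then show ?thesis using ab[OF that(2)] interior_halfspace_le[of "a h" "b h"] by auto
  qed
  define cut where "cut n x = (\<Prod>h\<in>F. flat_exp 1 ((- real (Suc n) *\<^sub>R a h) \<bullet> x + (real (Suc n) * b h - 1)))" for n :: nat and x
  define C where "C n = (\<Inter>h\<in>F. {x. a h \<bullet> x \<le> b h - 1 / real (Suc n)})" for n :: nat
  have clC: "closed (C n)" for n unfolding C_def by (auto intro: closed_halfspace_le)
  have CK: "C n \<subseteq> interior K" for n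
  proof (rule subset_trans)
    show "C n \<subseteq> (\<Inter>h\<in>F. {x. a h \<bullet> x < b h})"
    proof
      fix x assume x: "x \<in> C n"
      have "a h \<bullet> x < b h" if "h \<in> F" for h
      proof -
        have "a h \<bullet> x \<le> b h - 1 / real (Suc n)" using x that unfolding C_def by blast
        also have "\<dots> < b h" by simp
        finally show ?thesis .
      qed
      then show "x \<in> (\<Inter>h\<in>F. {x. a h \<bullet> x < b h})" by blast
    qed
    have "(\<Inter>h\<in>F. {x. a h \<bullet> x < b h}) \<subseteq> h" if "h \<in> F" for h using ab[OF that] that by force
    then have "(\<Inter>h\<in>F. {x. a h \<bullet> x < b h}) \<subseteq> K" unfolding F(2) by blast
    then show "(\<Inter>h\<in>F. {x. a h \<bullet> x < b h}) \<subseteq> interior K"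
      by (rule interior_maximal) (use F(1) in \<open>auto intro!: open_INT open_halfspace_lt\<close>)
  qed
  have sup: "{x. cut n x \<noteq> 0} \<subseteq> C n" for n
  proof
    fix x assume "x \<in> {x. cut n x \<noteq> 0}"
    then have "cut n x \<noteq> 0" by simp
    have "a h \<bullet> x \<le> b h - 1 / real (Suc n)" if "h \<in> F" for h
    proof -
      have "flat_exp 1 ((- real (Suc n) *\<^sub>R a h) \<bullet> x + (real (Suc n) * b h - 1)) \<noteq> 0"
        using \<open>cut n x \<noteq> 0\<close> that unfolding cut_def prod_zero_iff[OF F(1)] by blast
      then have "(- real (Suc n) *\<^sub>R a h) \<bullet> x + (real (Suc n) * b h - 1) > 0"
        by (rule flat_exp_nonzeroD)
      then have "real (Suc n) * (a h \<bullet> x) + 1 < real (Suc n) * b h"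
        by (simp only: inner_scaleR_left)
      then show ?thesis by (simp del: of_nat_Suc add: field_simps)
    qed
    then show "x \<in> C n" by (simp add: C_def)
  qed
  have clsup: "closure {x. cut n x \<noteq> 0} \<subseteq> C n" for n by (rule closure_minimal[OF sup clC])
  show thesis
  proof (rule that[of cut])
    show "smooth (cut n)" for n unfolding cut_def by (intro smooth_prod smooth_flat_exp_affine)
    show "0 \<le> cut n x" for n x unfolding cut_def by (intro prod_nonneg ballI flat_exp_1_bounds)
    show "cut n x \<le> 1" for n x unfolding cut_def by (intro prod_le_1) (simp add: flat_exp_1_bounds)
    show "closure {x. cut n x \<noteq> 0} \<subseteq> interior K" for n using clsup CK by blast
    have "bounded K" by (rule compact_imp_bounded) fact
    then show "compact (closure {x. cut n x \<noteq> 0})" for n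
      using clsup[of n] CK[of n] interior_subset[of K]
      by (auto simp: compact_eq_bounded_closed intro: bounded_subset)
    fix x assume x: "x \<in> interior K"
    have "(\<lambda>n. flat_exp 1 ((- real (Suc n) *\<^sub>R a h) \<bullet> x + (real (Suc n) * b h - 1))) \<longlonglongrightarrow> 1" if h: "h \<in> F" for h
    proof (rule filterlim_compose[OF flat_exp_1_tendsto])
      have p: "b h - a h \<bullet> x > 0" using inside[OF x h] by simp
      have "filterlim (\<lambda>n. (b h - a h \<bullet> x) * real (Suc n)) at_top sequentially"
        by (rule filterlim_tendsto_pos_mult_at_top[OF tendsto_const p])
           (rule filterlim_compose[OF filterlim_real_sequentially filterlim_Suc])
      then have "filterlim (\<lambda>n. - 1 + (b h - a h \<bullet> x) * real (Suc n)) at_top sequentially"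
        by (rule filterlim_tendsto_add_at_top[OF tendsto_const])
      moreover have "- 1 + (b h - a h \<bullet> x) * real (Suc n) = (- real (Suc n) *\<^sub>R a h) \<bullet> x + (real (Suc n) * b h - 1)" for n
        by (simp only: inner_scaleR_left inner_minus_left) (simp only: algebra_simps)
      ultimately show "filterlim (\<lambda>n. (- real (Suc n) *\<^sub>R a h) \<bullet> x + (real (Suc n) * b h - 1)) at_top sequentially"
        by (simp only:)
    qed
    then have "(\<lambda>n. cut n x) \<longlonglongrightarrow> (\<Prod>h\<in>F. 1)" unfolding cut_def by (intro tendsto_prod)
    then show "(\<lambda>n. cut n x) \<longlonglongrightarrow> 1" by simp
  qed
qed

section \<open>Integration by parts with compact support\<close>

lemma zero_outside_support: "x \<notin> closure {x. \<psi> x \<noteq> 0} \<Longrightarrow> \<psi> x = 0"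
  using closure_subset[of "{x. \<psi> x \<noteq> 0}"] by blast

lemma partial_outside_support:
  assumes "x \<notin> closure {x. \<psi> x \<noteq> (0::real)}"
  shows "frechet_derivative \<psi> (at x) = (\<lambda>_. 0)"
proof (rule frechet_derivative_eqI)
  have "((\<lambda>_. 0) has_derivative (\<lambda>_. 0)) (at x)" by simp
  then show "(\<psi> has_derivative (\<lambda>_. 0)) (at x)"
  proof (rule has_derivative_transform_within_open)
    show "open (- closure {x. \<psi> x \<noteq> 0})" by (intro open_Compl closed_closure)
    show "x \<in> - closure {x. \<psi> x \<noteq> 0}" using assms by simp
    fix y assume "y \<in> - closure {x. \<psi> x \<noteq> 0}"
    then have "\<psi> y = 0" by (intro zero_outside_support) simp
    then show "0 = \<psi> y" by (rule sym)
  qed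
qed

lemma integrable_compact_support:
  fixes f :: "'a::euclidean_space \<Rightarrow> 'b::euclidean_space"
  assumes "compact S" "continuous_on UNIV f" "\<And>x. x \<notin> S \<Longrightarrow> f x = 0"
  shows "integrable lborel f"
proof -
  have "integrable lborel (\<lambda>x. indicator S x *\<^sub>R f x)"
    using assms(1) continuous_on_subset[OF assms(2) subset_UNIV] by (rule borel_integrable_compact)
  moreover have "(\<lambda>x. indicator S x *\<^sub>R f x) = f" using assms(3) by (auto simp: indicator_def)
  ultimately show ?thesis by simp
qed

text \<open>By translation invariance every difference quotient has integral 0, and the quotients
  converge to the partial derivative under a common bound.\<close>

lemma integral_partial_compact_support:
  fixes \<psi> :: "'a::euclidean_space \<Rightarrow> real"
  assumes \<psi>: "smooth \<psi>" and S: "compact (closure {x. \<psi> x \<noteq> 0})" and b: "b \<in> Basis"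
  shows "(LINT x|lborel. frechet_derivative \<psi> (at x) b) = 0"
proof -
  define S where "S = closure {x. \<psi> x \<noteq> 0}"
  define D where "D x = frechet_derivative \<psi> (at x) b" for x
  have Dc: "continuous_on UNIV D" unfolding D_def by (intro smooth_continuous smooth_partial \<psi> b)
  have D0: "D x = 0" if "x \<notin> S" for x using partial_outside_support[of x \<psi>] that by (simp add: D_def S_def)
  have \<psi>0: "\<psi> x = 0" if "x \<notin> S" for x using that unfolding S_def by (rule zero_outside_support)
  have cS: "compact S" using S by (simp add: S_def)
  obtain C where C: "\<And>x. x \<in> S \<Longrightarrow> norm (D x) \<le> C"
    using compact_imp_bounded[OF compact_continuous_image[OF continuous_on_subset[OF Dc] cS]] by (auto simp: bounded_iff)
  have DC: "\<bar>D x\<bar> \<le> max C 0" for x using C[of x] D0[of x] by (cases "x \<in> S") auto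
  \<comment> \<open>The points from which a step of length at most 1 in direction \<open>b\<close>
    reaches the support. By the mean value theorem all quotients vanish outside this compact
    set.\<close>
  define T where "T = (\<lambda>(x, s). x - s *\<^sub>R b) ` (S \<times> {0..1::real})"
  have cT: "compact T" unfolding T_def
    by (intro compact_continuous_image compact_Times cS compact_Icc) (auto simp: case_prod_beta intro!: continuous_intros)
  define q where "q n x = (\<psi> (inverse (real (Suc n)) *\<^sub>R b + x) - \<psi> x) / inverse (real (Suc n))" for n x
  have \<psi>i: "integrable lborel \<psi>"
    using cS smooth_continuous[OF \<psi>] \<psi>0 by (rule integrable_compact_support)
  have shift: "integrable lborel (\<lambda>x. \<psi> (c + x))" "(LINT x|lborel. \<psi> (c + x)) = (LINT x|lborel. \<psi> x)" for c
  proof -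
    have m: "\<psi> \<in> borel_measurable borel" using smooth_continuous[OF \<psi>] by (rule borel_measurable_continuous_onI)
    have l: "lborel = distr lborel borel ((+) c)" by (simp add: lborel_distr_plus)
    show "(LINT x|lborel. \<psi> (c + x)) = (LINT x|lborel. \<psi> x)"
      by (subst (2) l, subst integral_distr) (use m in auto)
    show "integrable lborel (\<lambda>x. \<psi> (c + x))"
      using \<psi>i m by (subst (asm) l, subst (asm) integrable_distr_eq) auto
  qed
  have qint: "(LINT x|lborel. q n x) = 0" for n
    unfolding q_def using shift[of "inverse (real (Suc n)) *\<^sub>R b"] \<psi>i by simp
  have derb: "((\<lambda>s. \<psi> (x + s *\<^sub>R b)) has_real_derivative D (x + s *\<^sub>R b)) (at s)" for x s
  proof -
    have "((\<lambda>s. x + s *\<^sub>R b) has_derivative (\<lambda>h. h *\<^sub>R b)) (at s)" by (auto intro!: derivative_eq_intros)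
    from has_derivative_compose[OF this has_derivative_grad[OF smooth_differentiable[OF \<psi>]]]
    show ?thesis
      by (rule has_derivative_imp_has_field_derivative) (simp add: D_def grad_inner smooth_differentiable \<psi>)
  qed
  have "(\<lambda>n. LINT x|lborel. q n x) \<longlonglongrightarrow> (LINT x|lborel. D x)"
  proof (rule integral_dominated_convergence[where w = "\<lambda>x. indicator T x *\<^sub>R max C 0"])
    show "D \<in> borel_measurable lborel" using borel_measurable_continuous_onI[OF Dc] by simp
    have "continuous_on UNIV (q n)" for n
      unfolding q_def by (intro continuous_intros continuous_on_compose2[OF smooth_continuous[OF \<psi>, of UNIV]]) auto
    then show "q n \<in> borel_measurable lborel" for n using borel_measurable_continuous_onI by auto
    show "integrable lborel (\<lambda>x. indicator T x *\<^sub>R max C 0)"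
      by (rule borel_integrable_compact[OF cT continuous_on_const])
    show "AE x in lborel. (\<lambda>n. q n x) \<longlonglongrightarrow> D x"
    proof (rule AE_I2)
      fix x
      have "((\<lambda>h. (\<psi> (x + (0 + h) *\<^sub>R b) - \<psi> (x + 0 *\<^sub>R b)) / h) \<longlongrightarrow> D (x + 0 *\<^sub>R b)) (at 0)"
        using derb[of x 0] by (simp only: DERIV_def)
      moreover have "filterlim (\<lambda>n. inverse (real (Suc n))) (at 0) sequentially"
        using LIMSEQ_inverse_real_of_nat by (simp add: filterlim_at)
      ultimately have "(\<lambda>n. (\<psi> (x + (0 + inverse (real (Suc n))) *\<^sub>R b) - \<psi> (x + 0 *\<^sub>R b)) / inverse (real (Suc n))) \<longlonglongrightarrow> D (x + 0 *\<^sub>R b)"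
        by (rule filterlim_compose)
      then show "(\<lambda>n. q n x) \<longlonglongrightarrow> D x" unfolding q_def by (simp only: add.commute add_0 scaleR_zero_left add_0_right)
    qed
    show "AE x in lborel. norm (q n x) \<le> indicator T x *\<^sub>R max C 0" for n
    proof (rule AE_I2)
      fix x
      define h where "h = inverse (real (Suc n))"
      have h: "0 < h" "h \<le> 1" by (auto simp: h_def field_simps)
      have "\<exists>z>0. z < h \<and> \<psi> (x + h *\<^sub>R b) - \<psi> (x + 0 *\<^sub>R b) = (h - 0) * D (x + z *\<^sub>R b)"
        using h derb by (intro MVT2) auto
      then obtain z where z: "0 < z" "z < h" "\<psi> (x + h *\<^sub>R b) - \<psi> x = h * D (x + z *\<^sub>R b)" by auto
      have qz: "q n x = D (x + z *\<^sub>R b)" unfolding q_def h_def[symmetric] using z(3) h by (simp add: add.commute)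
      show "norm (q n x) \<le> indicator T x *\<^sub>R max C 0"
      proof (cases "x + z *\<^sub>R b \<in> S")
        case True
        then have "x \<in> T" unfolding T_def using z h by (intro image_eqI[of _ _ "(x + z *\<^sub>R b, z)"]) auto
        then show ?thesis using DC qz by simp
      next
        case False
        then show ?thesis using D0 qz by (simp add: indicator_def)
      qed
    qed
  qed
  then have "(\<lambda>n::nat. 0::real) \<longlonglongrightarrow> (LINT x|lborel. D x)" by (simp only: qint)
  then show ?thesis unfolding D_def by (simp add: LIMSEQ_const_iff)
qed

lemma integral_lebesgue_on_support:
  fixes f :: "'a::euclidean_space \<Rightarrow> 'b::euclidean_space"
  assumes "U \<in> sets lebesgue" "f \<in> borel_measurable borel" "\<And>x. x \<notin> U \<Longrightarrow> f x = 0"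
  shows "(LINT x|lebesgue_on U. f x) = (LINT x|lborel. f x)"
proof -
  have "(LINT x|lebesgue_on U. f x) = (LINT x|lebesgue. indicator U x *\<^sub>R f x)"
    using assms by (subst integral_restrict_space) auto
  also have "(\<lambda>x. indicator U x *\<^sub>R f x) = f" using assms(3) by (auto simp: indicator_def)
  also have "(LINT x|lebesgue. f x) = (LINT x|lborel. f x)"
    using assms(2) by (intro integral_completion) simp
  finally show ?thesis .
qed

lemma integral_grad_compact_support:
  fixes \<psi> :: "'a::euclidean_space \<Rightarrow> real"
  assumes \<psi>: "smooth \<psi>" and S: "compact (closure {x. \<psi> x \<noteq> 0})"
  shows "(LINT x|lborel. grad \<psi> x) = 0"
proof -
  have "integrable lborel (\<lambda>x. frechet_derivative \<psi> (at x) b)" if "b \<in> Basis" for b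
    using S smooth_continuous[OF smooth_partial[OF \<psi> that]]
    by (rule integrable_compact_support) (simp add: partial_outside_support)
  then have "(LINT x|lborel. grad \<psi> x) = (\<Sum>b\<in>Basis. (LINT x|lborel. frechet_derivative \<psi> (at x) b) *\<^sub>R b)"
    unfolding grad_def by (subst Bochner_Integration.integral_sum) auto
  then show ?thesis using integral_partial_compact_support[OF assms] by simp
qed

lemma smooth_integration_by_parts:
  assumes P: "smooth P" and \<phi>: "\<phi> \<in> test_functions U" and U: "U \<in> sets lebesgue"
  shows "(LINT x|lebesgue_on U. P x *\<^sub>R grad \<phi> x) = - (LINT x|lebesgue_on U. \<phi> x *\<^sub>R grad P x)"
proof -
  let ?S = "closure {x. \<phi> x \<noteq> 0}"
  have \<phi>s: "smooth \<phi>" "compact ?S" "?S \<subseteq> U" using \<phi> by (auto simp: test_functions_def)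
  have \<phi>0: "\<phi> x = 0" "grad \<phi> x = 0" if "x \<notin> ?S" for x
    using zero_outside_support[OF that] partial_outside_support[OF that] by (auto simp: grad_def)
  have c: "continuous_on UNIV (\<lambda>x. P x *\<^sub>R grad \<phi> x)" "continuous_on UNIV (\<lambda>x. \<phi> x *\<^sub>R grad P x)"
    using P \<phi>s(1) by (auto intro!: continuous_intros smooth_continuous continuous_on_grad)
  have z: "P x *\<^sub>R grad \<phi> x = 0" "\<phi> x *\<^sub>R grad P x = 0" if "x \<notin> ?S" for x
    using \<phi>0[OF that] by simp_all
  have zU: "P x *\<^sub>R grad \<phi> x = 0" "\<phi> x *\<^sub>R grad P x = 0" if "x \<notin> U" for x
    using z[of x] that \<phi>s(3) by blast+
  have i: "integrable lborel (\<lambda>x. P x *\<^sub>R grad \<phi> x)" "integrable lborel (\<lambda>x. \<phi> x *\<^sub>R grad P x)"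
    by (rule integrable_compact_support[OF \<phi>s(2) c(1) z(1)] integrable_compact_support[OF \<phi>s(2) c(2) z(2)]; assumption)+
  have "closure {x. P x * \<phi> x \<noteq> 0} \<subseteq> ?S" by (rule closure_mono) auto
  then have "compact (closure {x. P x * \<phi> x \<noteq> 0})"
    using compact_Int_closed[OF \<phi>s(2) closed_closure, of "{x. P x * \<phi> x \<noteq> 0}"] by (simp add: Int_absorb1)
  then have "0 = (LINT x|lborel. grad (\<lambda>x. P x * \<phi> x) x)"
    using integral_grad_compact_support[OF smooth_mult[OF P \<phi>s(1)]] by simp
  also have "\<dots> = (LINT x|lborel. P x *\<^sub>R grad \<phi> x) + (LINT x|lborel. \<phi> x *\<^sub>R grad P x)"
    unfolding grad_mult[OF P \<phi>s(1)] using i by simp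
  also have "(LINT x|lborel. P x *\<^sub>R grad \<phi> x) = (LINT x|lebesgue_on U. P x *\<^sub>R grad \<phi> x)"
    by (intro integral_lebesgue_on_support[symmetric] U borel_measurable_continuous_onI c zU)
  also have "(LINT x|lborel. \<phi> x *\<^sub>R grad P x) = (LINT x|lebesgue_on U. \<phi> x *\<^sub>R grad P x)"
    by (intro integral_lebesgue_on_support[symmetric] U borel_measurable_continuous_onI c zU)
  finally show ?thesis by (simp add: eq_neg_iff_add_eq_0)
qed

section \<open>Weak gradients on simplices\<close>

lemma L2_on_subset:
  fixes f :: "'a::euclidean_space \<Rightarrow> 'b::euclidean_space"
  assumes f: "f \<in> L2_on S" and TS: "T \<subseteq> S" and S: "S \<in> sets lebesgue" and T: "T \<in> sets lebesgue"
  shows "f \<in> L2_on T"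
proof -
  have m: "f \<in> borel_measurable (lebesgue_on T)"
    using f TS by (auto simp: L2_def intro: measurable_restrict_mono)
  have "integrable lebesgue (\<lambda>x. indicator S x *\<^sub>R (norm (f x))\<^sup>2)"
    using f S by (auto simp: L2_def integrable_restrict_space)
  from integrable_mult_indicator[OF T this] have "integrable lebesgue (\<lambda>x. indicator T x *\<^sub>R (norm (f x))\<^sup>2)"
    by (rule Bochner_Integration.integrable_cong[THEN iffD1, rotated -1]) (use TS in \<open>auto simp: indicator_def\<close>)
  then show ?thesis using m T by (auto simp: L2_def integrable_restrict_space)
qed

lemma L2_on_spike_set:
  fixes f :: "'a::euclidean_space \<Rightarrow> 'b::euclidean_space"
  assumes f: "f \<in> L2_on S" and S: "S \<in> sets lebesgue" and T: "T \<in> sets lebesgue" and neg: "negligible (S - T \<union> (T - S))"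
  shows "f \<in> L2_on T"
proof -
  have ae: "AE x in lebesgue. indicator S x *\<^sub>R h x = indicator T x *\<^sub>R h x" for h :: "'a \<Rightarrow> 'c::real_vector"
    by (rule AE_I'[of "S - T \<union> (T - S)"]) (use neg negligible_iff_null_sets in \<open>auto simp: indicator_def\<close>)
  have "(\<lambda>x. indicator S x *\<^sub>R f x) \<in> borel_measurable lebesgue"
    using f S by (auto simp: L2_def borel_measurable_restrict_space_iff)
  from borel_measurable_AE[OF this ae] have "f \<in> borel_measurable (lebesgue_on T)"
    using T by (auto simp: borel_measurable_restrict_space_iff)
  moreover have i: "integrable lebesgue (\<lambda>x. indicator S x *\<^sub>R (norm (f x))\<^sup>2)"
    using f S by (auto simp: L2_def integrable_restrict_space)
  have "(\<lambda>x. indicator T x *\<^sub>R (norm (f x))\<^sup>2) \<in> borel_measurable lebesgue"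
    by (rule borel_measurable_AE[OF borel_measurable_integrable[OF i] ae])
  then have "integrable lebesgue (\<lambda>x. indicator T x *\<^sub>R (norm (f x))\<^sup>2)"
    by (rule Bochner_Integration.integrable_cong_AE_imp[OF i]) (use ae[of "\<lambda>x. (norm (f x))\<^sup>2"] in \<open>rule eventually_mono, auto\<close>)
  ultimately show ?thesis using T by (auto simp: L2_def integrable_restrict_space)
qed

lemma continuous_L2_on_compact:
  fixes f :: "'a::euclidean_space \<Rightarrow> 'b::euclidean_space"
  assumes "compact K" "continuous_on K f"
  shows "f \<in> L2_on K"
proof -
  have "continuous_on K (\<lambda>x. (norm (f x))\<^sup>2)" by (intro continuous_intros assms)
  then show ?thesis
    using integrable_on_compact[OF assms(1)] borel_measurable_integrable[OF integrable_on_compact[OF assms]]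
    by (simp add: L2_def)
qed

lemma continuous_L2_on_bounded:
  fixes f :: "'a::euclidean_space \<Rightarrow> 'b::euclidean_space"
  assumes "bounded U" "U \<in> sets lebesgue" "continuous_on UNIV f"
  shows "f \<in> L2_on U"
proof (rule L2_on_subset)
  show "f \<in> L2_on (closure U)"
    by (rule continuous_L2_on_compact) (use assms continuous_on_subset in auto)
qed (use assms closure_subset in auto)

text \<open>A test function on \<open>U\<close> is one on \<Omega>, and both integrands vanish off
  its support, so the two identities coincide.\<close>

lemma has_weak_grad_subset:
  assumes w: "has_weak_grad \<Omega> u g" and U: "U \<subseteq> \<Omega>" "U \<in> sets lebesgue" "\<Omega> \<in> sets lebesgue"
  shows "has_weak_grad U u g"
  unfolding has_weak_grad_def
proof (intro conjI ballI)
  show "u \<in> L2_on U" "g \<in> L2_on U"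
    using w U by (auto simp: has_weak_grad_def intro: L2_on_subset)
  fix \<phi> assume \<phi>: "\<phi> \<in> test_functions U"
  then have "\<phi> \<in> test_functions \<Omega>" using U(1) by (auto simp: test_functions_def)
  then have eq: "(LINT x|lebesgue_on \<Omega>. u x *\<^sub>R grad \<phi> x) = - (LINT x|lebesgue_on \<Omega>. \<phi> x *\<^sub>R g x)"
    using w by (simp add: has_weak_grad_def)
  have restr: "(LINT x|lebesgue_on \<Omega>. h x) = (LINT x|lebesgue_on U. h x)"
    if h0: "\<And>x. x \<notin> closure {x. \<phi> x \<noteq> 0} \<Longrightarrow> h x = 0" for h :: "'a \<Rightarrow> 'a"
  proof -
    have z: "h x = 0" if "x \<notin> U" for x using \<phi> that by (intro h0) (auto simp: test_functions_def)
    have "indicator \<Omega> x *\<^sub>R h x = indicator U x *\<^sub>R h x" for x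
    proof (cases "x \<in> U")
      case True
      then show ?thesis using U(1) by (auto simp: indicator_def)
    next
      case False
      then show ?thesis using z[OF False] by simp
    qed
    then have "(LINT x|lebesgue. indicator \<Omega> x *\<^sub>R h x) = (LINT x|lebesgue. indicator U x *\<^sub>R h x)" by (simp only:)
    moreover have "(LINT x|lebesgue_on S. h x) = (LINT x|lebesgue. indicator S x *\<^sub>R h x)" if "S \<in> sets lebesgue" for S
      using that by (subst integral_restrict_space) auto
    ultimately show ?thesis using U(2,3) by simp
  qed
  have z: "u x *\<^sub>R grad \<phi> x = 0" "\<phi> x *\<^sub>R g x = 0" if "x \<notin> closure {x. \<phi> x \<noteq> 0}" for x
    using zero_outside_support[OF that] partial_outside_support[OF that] by (simp_all add: grad_def)
  show "(LINT x|lebesgue_on U. u x *\<^sub>R grad \<phi> x) = - (LINT x|lebesgue_on U. \<phi> x *\<^sub>R g x)"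
  proof -
    have "(LINT x|lebesgue_on \<Omega>. u x *\<^sub>R grad \<phi> x) = (LINT x|lebesgue_on U. u x *\<^sub>R grad \<phi> x)"
      by (rule restr) (rule z(1))
    moreover have "(LINT x|lebesgue_on \<Omega>. \<phi> x *\<^sub>R g x) = (LINT x|lebesgue_on U. \<phi> x *\<^sub>R g x)"
      by (rule restr) (rule z(2))
    ultimately show ?thesis using eq by (simp only:)
  qed
qed

lemma has_weak_grad_diff_smooth:
  assumes w: "has_weak_grad U u g" and P: "smooth P" and U: "bounded U" "U \<in> sets lebesgue"
  shows "has_weak_grad U (\<lambda>x. u x - P x) (\<lambda>x. g x - grad P x)"
  unfolding has_weak_grad_def
proof (intro conjI ballI)
  have L: "u \<in> L2_on U" "g \<in> L2_on U" "P \<in> L2_on U" "grad P \<in> L2_on U"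
    using w P U by (auto simp: has_weak_grad_def intro!: continuous_L2_on_bounded smooth_continuous continuous_on_grad)
  then show "(\<lambda>x. u x - P x) \<in> L2_on U" "(\<lambda>x. g x - grad P x) \<in> L2_on U" by (auto intro: L2_diff)
  fix \<phi> assume \<phi>: "\<phi> \<in> test_functions U"
  then have \<phi>L: "\<phi> \<in> L2_on U" "grad \<phi> \<in> L2_on U"
    using U by (auto simp: test_functions_def intro!: continuous_L2_on_bounded smooth_continuous continuous_on_grad)
  have "(LINT x|lebesgue_on U. (u x - P x) *\<^sub>R grad \<phi> x)
      = (LINT x|lebesgue_on U. u x *\<^sub>R grad \<phi> x) - (LINT x|lebesgue_on U. P x *\<^sub>R grad \<phi> x)"
    using L2_scaleR_integrable[OF L(1) \<phi>L(2)] L2_scaleR_integrable[OF L(3) \<phi>L(2)]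
    by (simp add: scaleR_left_diff_distrib)
  also have "\<dots> = - (LINT x|lebesgue_on U. \<phi> x *\<^sub>R g x) + (LINT x|lebesgue_on U. \<phi> x *\<^sub>R grad P x)"
    using w \<phi> smooth_integration_by_parts[OF P \<phi> U(2)] by (simp add: has_weak_grad_def)
  also have "\<dots> = - (LINT x|lebesgue_on U. \<phi> x *\<^sub>R (g x - grad P x))"
    using L2_scaleR_integrable[OF \<phi>L(1) L(2)] L2_scaleR_integrable[OF \<phi>L(1) L(4)]
    by (simp add: scaleR_right_diff_distrib)
  finally show "(LINT x|lebesgue_on U. (u x - P x) *\<^sub>R grad \<phi> x) = - (LINT x|lebesgue_on U. \<phi> x *\<^sub>R (g x - grad P x))" .
qed

text \<open>\<open>f\<close> may be nonzero up to the boundary, but its products with the cutoffs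
  are test functions. For each of them the side with \<open>grad (\<phi> n)\<close> is the same for
  both gradients and cancels, so the limit is taken only in integrals free of derivatives of the
  cutoffs.\<close>

lemma weak_grad_tested_unique:
  fixes K :: "'a::euclidean_space set"
  assumes K: "polyhedron K" "compact K"
    and g: "has_weak_grad (interior K) v g1" "has_weak_grad (interior K) v g2" and f: "smooth f"
  shows "(LINT x|lebesgue_on (interior K). f x *\<^sub>R g1 x) = (LINT x|lebesgue_on (interior K). f x *\<^sub>R g2 x)"
proof -
  define U where "U = interior K"
  have U: "bounded U" "U \<in> sets lebesgue"
    using compact_imp_bounded[OF K(2)] by (auto simp: U_def bounded_interior)
  obtain cut :: "nat \<Rightarrow> 'a \<Rightarrow> real" where cut:
    "\<And>n. smooth (cut n)" "\<And>n x. 0 \<le> cut n x" "\<And>n x. cut n x \<le> 1"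
    "\<And>n. closure {x. cut n x \<noteq> 0} \<subseteq> interior K" "\<And>n. compact (closure {x. cut n x \<noteq> 0})"
    "\<And>x. x \<in> interior K \<Longrightarrow> (\<lambda>n. cut n x) \<longlonglongrightarrow> 1"
    using polyhedron_cutoff[OF K] by metis
  define \<phi> where "\<phi> n x = cut n x * f x" for n x
  have test: "\<phi> n \<in> test_functions U" for n
  proof -
    have sub: "closure {x. \<phi> n x \<noteq> 0} \<subseteq> closure {x. cut n x \<noteq> 0}" by (rule closure_mono) (auto simp: \<phi>_def)
    then have "compact (closure {x. \<phi> n x \<noteq> 0})"
      using compact_Int_closed[OF cut(5) closed_closure, of n "{x. \<phi> n x \<noteq> 0}"] by (simp add: Int_absorb1)
    moreover have "smooth (\<phi> n)" unfolding \<phi>_def by (intro smooth_mult cut f)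
    ultimately show ?thesis using sub cut(4)[of n] unfolding test_functions_def U_def by auto
  qed
  have fL: "f \<in> L2_on U" using U f by (intro continuous_L2_on_bounded smooth_continuous)
  have lim: "(\<lambda>n. LINT x|lebesgue_on U. \<phi> n x *\<^sub>R g x) \<longlonglongrightarrow> (LINT x|lebesgue_on U. f x *\<^sub>R g x)"
    if gL: "g \<in> L2_on U" for g :: "'a \<Rightarrow> 'a"
  proof (rule integral_dominated_convergence[where w = "\<lambda>x. norm (f x *\<^sub>R g x)"])
    have i: "integrable (lebesgue_on U) (\<lambda>x. f x *\<^sub>R g x)" using fL gL by (rule L2_scaleR_integrable)
    then show "(\<lambda>x. f x *\<^sub>R g x) \<in> borel_measurable (lebesgue_on U)" by (rule borel_measurable_integrable)
    show "integrable (lebesgue_on U) (\<lambda>x. norm (f x *\<^sub>R g x))" using i by (rule integrable_norm)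
    have "\<phi> n \<in> L2_on U" for n
      using test[of n] U by (auto simp: test_functions_def intro!: continuous_L2_on_bounded smooth_continuous)
    then show "(\<lambda>x. \<phi> n x *\<^sub>R g x) \<in> borel_measurable (lebesgue_on U)" for n
      using L2_scaleR_integrable[OF _ gL] borel_measurable_integrable by blast
    show "AE x in lebesgue_on U. (\<lambda>n. \<phi> n x *\<^sub>R g x) \<longlonglongrightarrow> f x *\<^sub>R g x"
    proof (rule AE_I2)
      fix x assume "x \<in> space (lebesgue_on U)"
      then have "(\<lambda>n. cut n x) \<longlonglongrightarrow> 1" using cut(6) by (simp add: U_def)
      then have "(\<lambda>n. (cut n x * f x) *\<^sub>R g x) \<longlonglongrightarrow> (1 * f x) *\<^sub>R g x" by (intro tendsto_intros)
      then show "(\<lambda>n. \<phi> n x *\<^sub>R g x) \<longlonglongrightarrow> f x *\<^sub>R g x" by (simp only: \<phi>_def mult_1)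
    qed
    show "AE x in lebesgue_on U. norm (\<phi> n x *\<^sub>R g x) \<le> norm (f x *\<^sub>R g x)" for n
    proof (rule AE_I2)
      fix x
      have "norm (\<phi> n x *\<^sub>R g x) = cut n x * norm (f x *\<^sub>R g x)"
        using cut(2)[of n x] by (simp add: \<phi>_def abs_mult)
      also have "\<dots> \<le> 1 * norm (f x *\<^sub>R g x)" by (intro mult_right_mono cut) simp
      finally show "norm (\<phi> n x *\<^sub>R g x) \<le> norm (f x *\<^sub>R g x)" by simp
    qed
  qed
  have "(LINT x|lebesgue_on U. \<phi> n x *\<^sub>R g1 x) = (LINT x|lebesgue_on U. \<phi> n x *\<^sub>R g2 x)" for n
  proof -
    have "- (LINT x|lebesgue_on U. \<phi> n x *\<^sub>R g1 x) = (LINT x|lebesgue_on U. v x *\<^sub>R grad (\<phi> n) x)"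
      "(LINT x|lebesgue_on U. v x *\<^sub>R grad (\<phi> n) x) = - (LINT x|lebesgue_on U. \<phi> n x *\<^sub>R g2 x)"
      using g test[of n] unfolding has_weak_grad_def U_def[symmetric] by metis+
    then show ?thesis by (metis neg_equal_iff_equal)
  qed
  moreover have "g1 \<in> L2_on U" "g2 \<in> L2_on U" using g by (simp_all add: has_weak_grad_def U_def)
  ultimately show ?thesis
    unfolding U_def[symmetric] by (intro LIMSEQ_unique[OF lim]) (simp_all add: lim)
qed

text \<open>The partial derivatives of \<open>f\<close> are smooth again, so the previous lemma
  applies to each of them. This makes the arbitrary choice in \<open>weak_grad\<close> harmless when
  tested against polynomial gradients.\<close>

lemma weak_grad_inner_unique:
  fixes K :: "'a::euclidean_space set"
  assumes K: "polyhedron K" "compact K"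
    and g: "has_weak_grad (interior K) v g1" "has_weak_grad (interior K) v g2" and f: "smooth f"
  shows "inner_on (interior K) g1 (grad f) = inner_on (interior K) g2 (grad f)"
proof -
  have U: "bounded (interior K)" "interior K \<in> sets lebesgue"
    using compact_imp_bounded[OF K(2)] by (auto simp: bounded_interior)
  define D where "D b x = frechet_derivative f (at x) b" for b x
  have Ds: "smooth (D b)" if "b \<in> Basis" for b unfolding D_def using f that by (rule smooth_partial)
  have eq: "inner_on (interior K) g (grad f) = (\<Sum>b\<in>Basis. (LINT x|lebesgue_on (interior K). D b x *\<^sub>R g x) \<bullet> b)"
    if gL: "g \<in> L2_on (interior K)" for g
  proof -
    have i: "integrable (lebesgue_on (interior K)) (\<lambda>x. D b x *\<^sub>R g x)" if "b \<in> Basis" for b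
      using U Ds[OF that] by (intro L2_scaleR_integrable gL continuous_L2_on_bounded smooth_continuous)
    have "inner_on (interior K) g (grad f) = (LINT x|lebesgue_on (interior K). (\<Sum>b\<in>Basis. (D b x *\<^sub>R g x) \<bullet> b))"
      by (simp add: L2_inner_def grad_def D_def inner_sum_right)
    also have "\<dots> = (\<Sum>b\<in>Basis. LINT x|lebesgue_on (interior K). (D b x *\<^sub>R g x) \<bullet> b)"
      by (rule Bochner_Integration.integral_sum) (rule integrable_inner_left[OF i])
    also have "\<dots> = (\<Sum>b\<in>Basis. (LINT x|lebesgue_on (interior K). D b x *\<^sub>R g x) \<bullet> b)"
      by (intro sum.cong refl integral_inner_left i)
    finally show ?thesis .
  qed
  show ?thesis
    using g weak_grad_tested_unique[OF K g Ds] by (simp add: eq has_weak_grad_def)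
qed

text \<open>An element is only known to lie in the closure of \<Omega>; this puts its interior into
  \<Omega>, where the weak gradient of \<open>u\<close> lives. A boundary point has, just below the
  graph in its chart, open sets disjoint from \<Omega>, so it is not interior to the closure; a
  domain with a slit would violate this.\<close>

lemma lipschitz_domain_interior_closure:
  fixes \<Omega> :: "'a::euclidean_space set"
  assumes "lipschitz_domain \<Omega>"
  shows "interior (closure \<Omega>) \<subseteq> \<Omega>"
proof (rule subsetI, rule ccontr)
  fix x assume x: "x \<in> interior (closure \<Omega>)" "x \<notin> \<Omega>"
  have "open \<Omega>" using assms by (simp add: lipschitz_domain_def)
  then have "x \<in> frontier \<Omega>" using x interior_subset by (auto simp: frontier_def interior_open)
  moreover have "\<forall>z\<in>frontier \<Omega>. \<exists>U e L \<gamma>. open U \<and> z \<in> U \<and> norm e = 1 \<and>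
        L-lipschitz_on {y. y \<bullet> e = 0} \<gamma> \<and> \<Omega> \<inter> U = {x\<in>U. \<gamma> (x - (x \<bullet> e) *\<^sub>R e) < x \<bullet> e}"
    using assms unfolding lipschitz_domain_def by (elim conjE)
  ultimately obtain U e L and \<gamma> :: "'a \<Rightarrow> real" where U: "open U" "x \<in> U" "norm e = 1"
    and \<gamma>: "L-lipschitz_on {y. y \<bullet> e = 0} \<gamma>"
    and \<Omega>U: "\<Omega> \<inter> U = {x\<in>U. \<gamma> (x - (x \<bullet> e) *\<^sub>R e) < x \<bullet> e}"
    by (elim ballE[of _ _ x] exE conjE) auto
  have ee: "e \<bullet> e = 1" using U(3) by (simp add: dot_square_norm)
  define \<pi> where "\<pi> z = z - (z \<bullet> e) *\<^sub>R e" for z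
  have "continuous_on UNIV (\<lambda>z. \<gamma> (\<pi> z))"
  proof (rule continuous_on_compose2[OF lipschitz_on_continuous_on[OF \<gamma>]])
    show "\<pi> ` UNIV \<subseteq> {y. y \<bullet> e = 0}" using ee by (auto simp: \<pi>_def inner_diff_left)
    show "continuous_on UNIV \<pi>" unfolding \<pi>_def by (intro continuous_intros)
  qed
  then have Wo: "open {z. z \<bullet> e < \<gamma> (\<pi> z)}" by (intro open_Collect_less continuous_intros)
  define V where "V = U \<inter> interior (closure \<Omega>)"
  have "open V" "x \<in> V" using U x by (auto simp: V_def)
  then obtain d where d: "d > 0" "ball x d \<subseteq> V" by (meson open_contains_ball)
  \<comment> \<open>A point below \<open>x\<close> in the direction of \<open>e\<close>: strictly
    under the graph, yet still in the neighbourhood contained in the closure of \<Omega>.\<close>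
  define y where "y = x - (d / 2) *\<^sub>R e"
  have "y \<in> ball x d" using d U(3) by (simp add: y_def dist_norm)
  then have yV: "y \<in> V" using d by blast
  have "\<gamma> (\<pi> x) \<ge> x \<bullet> e" using x(2) U(2) \<Omega>U by (force simp: \<pi>_def)
  moreover have "\<pi> y = \<pi> x" using ee by (simp add: \<pi>_def y_def inner_diff_left algebra_simps)
  moreover have "y \<bullet> e = x \<bullet> e - d / 2" using ee by (simp add: y_def inner_diff_left)
  ultimately have "y \<in> {z. z \<bullet> e < \<gamma> (\<pi> z)}" using d(1) by simp
  moreover have "y \<in> closure \<Omega>" using yV interior_subset by (auto simp: V_def)
  ultimately have "(V \<inter> {z. z \<bullet> e < \<gamma> (\<pi> z)}) \<inter> closure \<Omega> \<noteq> {}" using yV by blast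
  moreover have "open (V \<inter> {z. z \<bullet> e < \<gamma> (\<pi> z)})" using \<open>open V\<close> Wo by blast
  ultimately obtain z where "z \<in> V" "z \<bullet> e < \<gamma> (\<pi> z)" "z \<in> \<Omega>"
    using open_Int_closure_eq_empty by blast
  moreover from this have "z \<in> \<Omega> \<inter> U" by (auto simp: V_def)
  ultimately show False unfolding \<Omega>U by (simp add: \<pi>_def)
qed

lemma full_dimensional_simplex:
  fixes K :: "'a::euclidean_space set"
  assumes "int DIM('a) simplex K"
  shows "compact K" "convex K" "polyhedron K" "interior K \<noteq> {}"
proof -
  show c: "compact K" using assms compact_simplex by blast
  show cv: "convex K" using assms convex_simplex by blast
  show "polyhedron K" using assms simplex_imp_polyhedron by blast
  have "aff_dim K = int DIM('a)" using assms aff_dim_simplex by blast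
  moreover from this have "K \<noteq> {}" by auto
  ultimately show "interior K \<noteq> {}"
    using interior_rel_interior_gen[of K] rel_interior_eq_empty[OF cv] by simp
qed

section \<open>Residual minimization\<close>

lemma has_weak_grad_weak_grad: "has_weak_grad U u g \<Longrightarrow> has_weak_grad U u (weak_grad U u)"
  unfolding weak_grad_def by (rule someI[of "has_weak_grad U u"])

lemma smooth_L2_on: "compact K \<Longrightarrow> smooth f \<Longrightarrow> f \<in> L2_on K"
  by (simp add: continuous_L2_on_compact smooth_continuous)

lemma grad_L2_on: "compact K \<Longrightarrow> smooth f \<Longrightarrow> grad f \<in> L2_on K"
  by (simp add: continuous_L2_on_compact continuous_on_grad)

lemma smooth_lincomb: "smooth f \<Longrightarrow> smooth g \<Longrightarrow> smooth (\<lambda>x. f x + c * g x)"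
  by (intro smooth_add smooth_mult smooth_const)

lemma grad_lincomb: "smooth f \<Longrightarrow> smooth g \<Longrightarrow> grad (\<lambda>x. f x + c * g x) = (\<lambda>x. grad f x + c *\<^sub>R grad g x)"
  by (simp add: grad_add grad_cmult smooth_mult smooth_const)

lemma L2_proj:
  fixes K :: "'a::euclidean_space set"
  assumes K: "compact K" and f: "f \<in> L2_on K"
  shows "L2_proj K r f \<in> polys r"
    and "v \<in> polys r \<Longrightarrow> inner_on K (\<lambda>x. f x - L2_proj K r f x) v = 0"
proof -
  obtain c where c: "\<And>\<alpha>. \<alpha> \<in> multi_indices r \<Longrightarrow>
      inner_on K (\<lambda>x. f x - (\<Sum>\<beta>\<in>multi_indices r. c \<beta> *\<^sub>R monomial \<beta> x)) (monomial \<alpha>) = 0"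
    using L2_projection_exists[OF finite_multi_indices smooth_L2_on[OF K smooth_monomial] f, of r id] by auto
  define P where "P = (\<lambda>x. \<Sum>\<beta>\<in>multi_indices r. c \<beta> * monomial \<beta> x)"
  have P: "P \<in> polys r" unfolding P_def by (intro polys_sum finite_multi_indices monomial_in_polys)
  have fP: "(\<lambda>x. f x - P x) \<in> L2_on K" using f smooth_L2_on[OF K polys_smooth[OF P]] by (rule L2_diff)
  have "inner_on K (\<lambda>x. f x - P x) v = 0" if v: "v \<in> polys r" for v
  proof -
    obtain d where d: "v = (\<lambda>x. \<Sum>\<beta>\<in>multi_indices r. d \<beta> * monomial \<beta> x)" using v by (auto simp: polys_alt)
    show ?thesis
      using L2_inner_sum_right[where f = monomial and c = d, OF finite_multi_indices smooth_L2_on[OF K smooth_monomial] fP, of r] c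
      by (simp add: d P_def)
  qed
  then have "\<exists>P. P \<in> polys r \<and> (\<forall>v\<in>polys r. inner_on K (\<lambda>x. f x - P x) v = 0)" using P by blast
  then have *: "L2_proj K r f \<in> polys r \<and> (\<forall>v\<in>polys r. inner_on K (\<lambda>x. f x - L2_proj K r f x) v = 0)"
    unfolding L2_proj_def by (rule someI_ex)
  show "L2_proj K r f \<in> polys r" using * by blast
  show "v \<in> polys r \<Longrightarrow> inner_on K (\<lambda>x. f x - L2_proj K r f x) v = 0" using * by blast
qed

lemma payne_weinberger_L2:
  fixes K :: "'a::euclidean_space set"
  assumes K: "compact K" "convex K" and f: "smooth f" and mean: "inner_on K f (\<lambda>_. 1) = 0"
  shows "norm_on K f \<le> diameter K / pi * norm_on K (grad f)"
proof (rule power2_le_imp_le)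
  have "(LINT x|lebesgue_on K. (f x)\<^sup>2) \<le> (diameter K / pi)\<^sup>2 * (LINT x|lebesgue_on K. (norm (grad f x))\<^sup>2)"
    using K mean f
    by (intro payne_weinberger has_derivative_grad smooth_differentiable continuous_on_grad) (auto simp: L2_inner_def)
  then show "(norm_on K f)\<^sup>2 \<le> (diameter K / pi * norm_on K (grad f))\<^sup>2"
    by (simp only: power_mult_distrib L2_norm_power2 L2_inner_def power2_norm_eq_inner) (simp add: power2_eq_square)
  have "diameter K \<ge> 0" using diameter_ge_0 compact_imp_bounded[OF K(1)] by blast
  then show "0 \<le> diameter K / pi * norm_on K (grad f)" by (simp add: L2_norm_nonneg)
qed

text \<open>The supremum in the discrete dual norm is attained at the potential of the
  \<open>L\<^sup>2\<close>-projection onto gradients, so the norm of a residual is an \<open>L\<^sup>2\<close> norm.\<close>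

lemma discrete_dual_norm_eq:
  fixes K :: "'a::euclidean_space set"
  assumes K: "compact K" "measure lebesgue K > 0" and s: "s \<ge> 1"
    and z: "z \<in> polys s" and g: "g \<in> L2_on K"
    and proj: "\<And>v. v \<in> polys s \<Longrightarrow> inner_on K g (grad v) = inner_on K (grad z) (grad v)"
  shows "discrete_dual_norm K s g = norm_on K (grad z)"
proof -
  define V where "V = polys_mean_zero K s - {\<lambda>_. 0}"
  define Q where "Q v = inner_on K g (grad v) / norm_on K (grad v)" for v
  have zL: "grad z \<in> L2_on K" using K(1) polys_smooth[OF z] by (rule grad_L2_on)
  have one: "inner_on K (\<lambda>_. c) (\<lambda>_. 1) = c * measure lebesgue K" for c
    using lmeasurable_compact[OF K(1)] by (simp add: L2_inner_def measure_restrict_space)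
  have center: "(\<lambda>x. f x - c) \<in> polys_mean_zero K s" "grad (\<lambda>x. f x - c) = grad f"
    if f: "f \<in> polys s" and c: "c = inner_on K f (\<lambda>_. 1) / measure lebesgue K" for f c
  proof -
    have "(\<lambda>x. f x - c) \<in> polys s" using f polys_const by (rule polys_diff)
    moreover have "inner_on K (\<lambda>x. f x - c) (\<lambda>_. 1) = 0"
      using K L2_inner_diff_left[of f "lebesgue_on K" "\<lambda>_. c" "\<lambda>_. 1"]
      by (simp add: smooth_L2_on polys_smooth[OF f] smooth_const one c)
    ultimately show "(\<lambda>x. f x - c) \<in> polys_mean_zero K s" by (simp add: polys_mean_zero_def)
    show "grad (\<lambda>x. f x - c) = grad f" using polys_smooth[OF f] by (simp add: grad_diff smooth_const grad_const)
  qed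
  have up: "Q v \<le> norm_on K (grad z)" if "v \<in> V" for v
  proof -
    have v: "v \<in> polys s" using that by (auto simp: V_def polys_mean_zero_def)
    have "\<bar>inner_on K (grad z) (grad v)\<bar> \<le> norm_on K (grad z) * norm_on K (grad v)"
      by (rule L2_Cauchy_Schwarz[OF zL grad_L2_on[OF K(1) polys_smooth[OF v]]])
    then show ?thesis
      using L2_norm_nonneg[of "lebesgue_on K" "grad v"] L2_norm_nonneg[of "lebesgue_on K" "grad z"]
      by (cases "norm_on K (grad v) = 0") (auto simp: Q_def proj[OF v] pos_divide_le_eq)
  qed
  have attained: "\<exists>v\<in>V. norm_on K (grad z) \<le> Q v"
  proof (cases "norm_on K (grad z) = 0")
    case True
    \<comment> \<open>With \<open>grad z\<close> zero the supremum should be 0, but it needs a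
      competitor: a centred coordinate function is a nonzero polynomial of degree one. In the other
      case \<open>z\<close> minus its mean attains the supremum.\<close>
    obtain b :: 'a where b: "b \<in> Basis" using nonempty_Basis by blast
    define c where "c = inner_on K (\<lambda>x. x \<bullet> b) (\<lambda>_. 1) / measure lebesgue K"
    define v where "v x = x \<bullet> b - c" for x
    have "v \<in> polys_mean_zero K s" unfolding v_def by (rule center(1)[OF polys_coordinate[OF b s] c_def])
    moreover have "v b - v 0 = 1" using b by (simp add: v_def)
    then have "v \<noteq> (\<lambda>_. 0)" by auto
    ultimately have vV: "v \<in> V" by (simp add: V_def)
    then have v: "v \<in> polys s" by (auto simp: V_def polys_mean_zero_def)
    have "inner_on K (grad z) (grad v) = 0"
      using L2_Cauchy_Schwarz[OF zL grad_L2_on[OF K(1) polys_smooth[OF v]]] True by simp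
    then show ?thesis using vV True by (intro bexI[of _ v]) (simp_all add: Q_def proj[OF v])
  next
    case False
    define c where "c = inner_on K z (\<lambda>_. 1) / measure lebesgue K"
    define v where "v x = z x - c" for x
    have v: "v \<in> polys_mean_zero K s" "grad v = grad z" using center[OF z c_def] by (simp_all add: v_def[abs_def])
    have "v \<noteq> (\<lambda>_. 0)"
    proof
      assume "v = (\<lambda>_. 0)"
      then have "grad z = grad (\<lambda>_. 0)" using v(2) by simp
      also have "\<dots> = (\<lambda>_. 0)" by (rule grad_const)
      finally show False using False by (simp add: L2_norm_def L2_inner_def)
    qed
    then have "v \<in> V" using v by (simp add: V_def)
    moreover have "Q v = norm_on K (grad z)"
      using False v proj[of v] by (simp add: Q_def polys_mean_zero_def power2_eq_square flip: L2_norm_power2)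
    ultimately show ?thesis by (intro bexI[of _ v]) auto
  qed
  have bdd: "bdd_above (Q ` V)" using up by (rule bdd_aboveI2)
  have "(SUP v\<in>V. Q v) = norm_on K (grad z)"
  proof (rule antisym)
    show "(SUP v\<in>V. Q v) \<le> norm_on K (grad z)" using attained up by (intro cSUP_least) auto
    show "norm_on K (grad z) \<le> (SUP v\<in>V. Q v)" using attained cSUP_upper2[OF bdd] by blast
  qed
  then show ?thesis by (simp add: discrete_dual_norm_def V_def Q_def)
qed

text \<open>Tested with gradients of polynomials of degree at most \<open>s\<close>,
  \<open>g\<close> acts like its projection \<open>grad y\<close>. As \<open>r \<le> s\<close>, the
  dual norm of the residual is the ordinary norm of \<open>grad y + grad f\<close> for every
  candidate \<open>f\<close>, and the minimization becomes least squares with its normal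
  equations.\<close>

lemma residual_minimizer_orthogonal:
  fixes K :: "'a::euclidean_space set" and g :: "'a \<Rightarrow> 'a" and v w :: "'a \<Rightarrow> real"
  assumes K: "compact K" "measure lebesgue K > 0" and rs: "r \<le> s" "s \<ge> 1" and g: "g \<in> L2_on K"
    and min: "is_arg_min (\<lambda>w. 1/2 * (discrete_dual_norm K s (\<lambda>x. g x + grad w x))\<^sup>2) (\<lambda>w. w \<in> polys r) w"
    and v: "v \<in> polys r"
  shows "inner_on K (\<lambda>x. g x + grad w x) (grad v) = 0"
proof -
  obtain c where c: "\<And>\<alpha>. \<alpha> \<in> multi_indices s \<Longrightarrow>
      inner_on K (\<lambda>x. g x - (\<Sum>\<beta>\<in>multi_indices s. c \<beta> *\<^sub>R grad (monomial \<beta>) x)) (grad (monomial \<alpha>)) = 0"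
    using L2_projection_exists[OF finite_multi_indices grad_L2_on[OF K(1) smooth_monomial] g, of s id] by auto
  define y where "y = (\<lambda>x. \<Sum>\<beta>\<in>multi_indices s. c \<beta> * monomial \<beta> x)"
  have y: "y \<in> polys s" unfolding y_def by (intro polys_sum finite_multi_indices monomial_in_polys)
  have grad_comb: "grad (\<lambda>x. \<Sum>\<beta>\<in>multi_indices s. d \<beta> * monomial \<beta> x) = (\<lambda>x. \<Sum>\<beta>\<in>multi_indices s. d \<beta> *\<^sub>R grad (monomial \<beta>) x)"
    for d :: "('a \<Rightarrow> nat) \<Rightarrow> real"
    by (simp add: grad_sum finite_multi_indices smooth_mult smooth_const smooth_monomial grad_cmult)
  have yL: "grad y \<in> L2_on K" using K(1) polys_smooth[OF y] by (rule grad_L2_on)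
  have gy: "inner_on K g (grad f) = inner_on K (grad y) (grad f)" if f: "f \<in> polys s" for f
  proof -
    obtain d where d: "f = (\<lambda>x. \<Sum>\<beta>\<in>multi_indices s. d \<beta> * monomial \<beta> x)" using f by (auto simp: polys_alt)
    have "inner_on K (\<lambda>x. g x - grad y x) (grad f) = 0"
      unfolding d grad_comb
      using L2_inner_sum_right[where f = "\<lambda>\<beta>. grad (monomial \<beta>)" and c = d, OF finite_multi_indices grad_L2_on[OF K(1) smooth_monomial] L2_diff[OF g yL], of s] c
      by (simp add: y_def grad_comb)
    then show ?thesis
      using L2_inner_diff_left[OF g yL grad_L2_on[OF K(1) polys_smooth[OF f]]] by simp
  qed
  have sub: "f \<in> polys s" if "f \<in> polys r" for f :: "'a \<Rightarrow> real" using that polys_mono[OF rs(1)] by blast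
  have dual: "discrete_dual_norm K s (\<lambda>x. g x + grad f x) = norm_on K (\<lambda>x. grad y x + grad f x)" if f: "f \<in> polys r" for f
  proof -
    have fL: "grad f \<in> L2_on K" using K(1) polys_smooth[OF f] by (rule grad_L2_on)
    have "discrete_dual_norm K s (\<lambda>x. g x + grad f x) = norm_on K (grad (\<lambda>x. y x + f x))"
    proof (rule discrete_dual_norm_eq[OF K rs(2)])
      show "(\<lambda>x. y x + f x) \<in> polys s" using y sub[OF f] by (rule polys_add)
      show "(\<lambda>x. g x + grad f x) \<in> L2_on K" using g fL by (rule L2_add)
      fix v :: "'a \<Rightarrow> real" assume v: "v \<in> polys s"
      have vL: "grad v \<in> L2_on K" using K(1) polys_smooth[OF v] by (rule grad_L2_on)
      show "inner_on K (\<lambda>x. g x + grad f x) (grad v) = inner_on K (grad (\<lambda>x. y x + f x)) (grad v)"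
        using L2_inner_lincomb_left[OF g fL vL, of 1] L2_inner_lincomb_left[OF yL fL vL, of 1] gy[OF v]
        by (simp add: grad_add polys_smooth[OF y] polys_smooth[OF f])
    qed
    then show ?thesis by (simp add: grad_add polys_smooth[OF y] polys_smooth[OF f])
  qed
  have w: "w \<in> polys r" using min by (simp add: is_arg_min_def)
  have wL: "grad w \<in> L2_on K" and vL: "grad v \<in> L2_on K"
    using K(1) polys_smooth[OF w] polys_smooth[OF v] by (auto intro: grad_L2_on)
  define E where "E = (\<lambda>x. grad y x + grad w x)"
  have EL: "E \<in> L2_on K" unfolding E_def using yL wL by (rule L2_add)
  \<comment> \<open>Comparing the minimizer \<open>w\<close> with the candidates
    \<open>w + t v\<close> gives a nonnegative quadratic in \<open>t\<close> without constant term,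
    so its linear coefficient vanishes.\<close>
  have "0 \<le> 2 * t * inner_on K E (grad v) + t\<^sup>2 * inner_on K (grad v) (grad v)" for t
  proof -
    have wt: "(\<lambda>x. w x + t * v x) \<in> polys r" using w v by (rule polys_lincomb)
    have "(discrete_dual_norm K s (\<lambda>x. g x + grad w x))\<^sup>2 \<le> (discrete_dual_norm K s (\<lambda>x. g x + grad (\<lambda>x. w x + t * v x) x))\<^sup>2"
      using min wt unfolding is_arg_min_def by (auto simp: not_less)
    then have "(norm_on K E)\<^sup>2 \<le> (norm_on K (\<lambda>x. E x + t *\<^sub>R grad v x))\<^sup>2"
      unfolding dual[OF w] dual[OF wt]
      unfolding grad_lincomb[OF polys_smooth[OF w] polys_smooth[OF v]] E_def by (simp only: add.assoc)
    then show ?thesis using L2_inner_lincomb_self[OF EL vL, of t] by (simp add: L2_norm_power2)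
  qed
  then have "inner_on K E (grad v) = 0" by (rule linear_coeff_zero_if_quadratic_nonneg)
  then show ?thesis
    using L2_inner_lincomb_left[OF g wL vL, of 1] L2_inner_lincomb_left[OF yL wL vL, of 1] gy[OF sub[OF v]]
    by (simp add: E_def)
qed

text \<open>\<open>u - \<nu>\<close> splits into the projection error, the mean-free part of
  \<open>P - w\<close> and the mean of \<open>P - w\<close>. Payne-Weinberger bounds the second
  part; the third is minus the mean of \<open>uh - P'\<close>, since both projections keep the mean
  of \<open>u\<close>. Here \<open>g\<close> stands for the weak gradient of \<open>u - P\<close>,
  and \<open>flux\<close> expresses q = - g - grad P in tested form.\<close>

lemma postprocessing_estimate:
  fixes K :: "'a::euclidean_space set"
  assumes K: "compact K" "convex K" "measure lebesgue K > 0"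
    and L2: "u \<in> L2_on K" "uh \<in> L2_on K" "q \<in> L2_on K" "qh \<in> L2_on K" "g \<in> L2_on K" "\<nu> \<in> L2_on K"
    and w: "w \<in> polys r" "AE x in lebesgue_on K. \<nu> x = w x"
    and mean: "inner_on K \<nu> (\<lambda>_. 1) = inner_on K uh (\<lambda>_. 1)"
    and orth: "\<And>v. v \<in> polys r \<Longrightarrow> inner_on K (\<lambda>x. qh x + grad w x) (grad v) = 0"
    and flux: "\<And>v. v \<in> polys r \<Longrightarrow>
       inner_on K q (grad v) = - inner_on K g (grad v) - inner_on K (grad (L2_proj K r u)) (grad v)"
  shows "norm_on K (\<lambda>x. u x - \<nu> x) \<le>
      diameter K / pi * (norm_on K (\<lambda>x. q x - qh x) + norm_on K g) +
      norm_on K (\<lambda>x. uh x - L2_proj K s u x) + norm_on K (\<lambda>x. u x - L2_proj K r u x)"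
proof -
  define P where "P = L2_proj K r u"
  define P' where "P' = L2_proj K s u"
  define M where "M = measure lebesgue K"
  have P: "P \<in> polys r" "smooth P" "P \<in> L2_on K" and P': "P' \<in> L2_on K"
    using L2_proj(1)[OF K(1) L2(1)] smooth_L2_on[OF K(1)] polys_smooth unfolding P_def P'_def by blast+
  have wL: "smooth w" "w \<in> L2_on K" using polys_smooth[OF w(1)] smooth_L2_on[OF K(1)] by auto
  have oneL: "(\<lambda>_. 1::real) \<in> L2_on K" using smooth_L2_on[OF K(1) smooth_const] .
  have one: "inner_on K (\<lambda>_. c) (\<lambda>_. 1) = c * M" for c
    using lmeasurable_compact[OF K(1)] by (simp add: L2_inner_def measure_restrict_space M_def)
  define d0 where "d0 = (\<lambda>x. P x - w x)"
  have d0: "d0 \<in> polys r" "smooth d0" "d0 \<in> L2_on K"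
    using polys_diff[OF P(1) w(1)] polys_smooth smooth_L2_on[OF K(1)] unfolding d0_def by blast+
  have grL: "grad d0 \<in> L2_on K" "grad P \<in> L2_on K" "grad w \<in> L2_on K"
    using K(1) d0(2) P(2) wL(1) by (auto intro: grad_L2_on)
  \<comment> \<open>Tested with \<open>d0\<close> itself, \<open>grad w\<close> may be replaced by
    \<open>- qh\<close> and \<open>grad P\<close> by \<open>- g - q\<close>, so that only the flux
    error and \<open>g\<close> remain.\<close>
  have grad_rho: "norm_on K (grad d0) \<le> norm_on K (\<lambda>x. q x - qh x) + norm_on K g"
  proof -
    have "(norm_on K (grad d0))\<^sup>2 = inner_on K (grad P) (grad d0) - inner_on K (grad w) (grad d0)"
      using L2_inner_diff_left[OF grL(2,3,1)] P(2) wL(1) by (simp add: L2_norm_power2 d0_def grad_diff)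
    also have "inner_on K (grad w) (grad d0) = - inner_on K qh (grad d0)"
      using orth[OF d0(1)] L2_inner_lincomb_left[OF L2(4) grL(3,1), of 1] by simp
    also have "inner_on K (grad P) (grad d0) = - inner_on K g (grad d0) - inner_on K q (grad d0)"
      using flux[OF d0(1)] by (simp add: P_def)
    finally have "(norm_on K (grad d0))\<^sup>2 = - inner_on K g (grad d0) - inner_on K (\<lambda>x. q x - qh x) (grad d0)"
      using L2_inner_diff_left[OF L2(3,4) grL(1)] by simp
    also have "\<dots> \<le> norm_on K g * norm_on K (grad d0) + norm_on K (\<lambda>x. q x - qh x) * norm_on K (grad d0)"
      using L2_Cauchy_Schwarz[OF L2(5) grL(1)] L2_Cauchy_Schwarz[OF L2_diff[OF L2(3,4)] grL(1)] by linarith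
    finally have "norm_on K (grad d0) * norm_on K (grad d0)
        \<le> (norm_on K (\<lambda>x. q x - qh x) + norm_on K g) * norm_on K (grad d0)"
      by (simp add: power2_eq_square algebra_simps)
    then show ?thesis
      using L2_norm_nonneg[of "lebesgue_on K" "grad d0"] L2_norm_nonneg[of "lebesgue_on K" g]
        L2_norm_nonneg[of "lebesgue_on K" "\<lambda>x. q x - qh x"]
      by (cases "norm_on K (grad d0) = 0") (auto simp: mult_le_cancel_right)
  qed
  define m where "m = inner_on K d0 (\<lambda>_. 1) / M"
  have M: "M > 0" using K(3) by (simp add: M_def)
  have cL: "(\<lambda>_. c::real) \<in> L2_on K" for c using smooth_L2_on[OF K(1) smooth_const] .
  have osc: "norm_on K (\<lambda>x. d0 x - m) \<le> diameter K / pi * norm_on K (grad d0)"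
  proof -
    have "inner_on K (\<lambda>x. d0 x - m) (\<lambda>_. 1) = 0"
      using L2_inner_diff_left[OF d0(3) cL oneL] M by (simp add: one m_def)
    then have "norm_on K (\<lambda>x. d0 x - m) \<le> diameter K / pi * norm_on K (grad (\<lambda>x. d0 x - m))"
      using K d0(2) smooth_lincomb[OF d0(2) smooth_const, of "-1" m] by (intro payne_weinberger_L2) auto
    then show ?thesis using d0(2) by (simp add: grad_diff smooth_const grad_const)
  qed
  have normc: "norm_on K (\<lambda>_. c) = \<bar>c\<bar> * sqrt M" for c :: real
  proof -
    have "inner_on K (\<lambda>_. c) (\<lambda>_. c) = c\<^sup>2 * M"
      using lmeasurable_compact[OF K(1)] by (simp add: L2_inner_def measure_restrict_space M_def power2_eq_square)
    then show ?thesis by (simp add: L2_norm_def real_sqrt_mult)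
  qed
  have mean_rho: "norm_on K (\<lambda>_. m) \<le> norm_on K (\<lambda>x. uh x - P' x)"
  proof -
    have "inner_on K w (\<lambda>_. 1) = inner_on K uh (\<lambda>_. 1)"
      using L2_inner_cong_AE[OF L2(6) wL(2) w(2) oneL] mean by simp
    moreover have "inner_on K P (\<lambda>_. 1) = inner_on K u (\<lambda>_. 1)" "inner_on K P' (\<lambda>_. 1) = inner_on K u (\<lambda>_. 1)"
      using L2_proj(2)[OF K(1) L2(1) polys_const] L2_inner_diff_left[OF L2(1) P(3) oneL]
        L2_inner_diff_left[OF L2(1) P' oneL] by (simp_all add: P_def P'_def)
    ultimately have "m * M = - inner_on K (\<lambda>x. uh x - P' x) (\<lambda>_. 1)"
      using L2_inner_diff_left[OF P(3) wL(2) oneL] L2_inner_diff_left[OF L2(2) P' oneL] M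
      by (simp add: m_def d0_def)
    then have "\<bar>m\<bar> * M \<le> norm_on K (\<lambda>x. uh x - P' x) * sqrt M"
      using L2_Cauchy_Schwarz[OF L2_diff[OF L2(2) P'] oneL] M normc[of 1]
      by (metis abs_minus_cancel abs_mult abs_of_pos abs_one mult_1)
    then have "(\<bar>m\<bar> * sqrt M) * sqrt M \<le> norm_on K (\<lambda>x. uh x - P' x) * sqrt M"
      using M by (simp add: mult.assoc)
    then show ?thesis using M by (simp add: normc)
  qed
  have "norm_on K (\<lambda>x. u x - \<nu> x) = norm_on K (\<lambda>x. u x - w x)"
    using w(2) L2 wL by (intro L2_norm_cong_AE L2_diff) (auto elim: eventually_mono)
  also have "(\<lambda>x. u x - w x) = (\<lambda>x. (u x - P x) + ((d0 x - m) + m))" by (simp add: d0_def)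
  also have "norm_on K \<dots> \<le> norm_on K (\<lambda>x. u x - P x) + norm_on K (\<lambda>x. (d0 x - m) + m)"
    by (intro L2_norm_triangle L2_diff L2_add L2(1) P(3) d0(3) cL)
  also have "norm_on K (\<lambda>x. (d0 x - m) + m) \<le> norm_on K (\<lambda>x. d0 x - m) + norm_on K (\<lambda>_. m)"
    by (intro L2_norm_triangle L2_diff d0(3) cL)
  finally have "norm_on K (\<lambda>x. u x - \<nu> x) \<le> norm_on K (\<lambda>x. u x - P x) + (norm_on K (\<lambda>x. d0 x - m) + norm_on K (\<lambda>_. m))"
    by simp
  moreover have "diameter K / pi * norm_on K (grad d0) \<le> diameter K / pi * (norm_on K (\<lambda>x. q x - qh x) + norm_on K g)"
    using diameter_ge_0[OF compact_imp_bounded[OF K(1)]] by (intro mult_left_mono grad_rho) auto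
  ultimately show ?thesis using osc mean_rho unfolding P_def P'_def by linarith
qed

theorem corollary3p2:
  fixes \<Omega> :: "(real^'d) set"
    and T :: "real \<Rightarrow> (real^'d) set set"
    and p :: nat and h :: real
    and f u\<^sub>D u u\<^sub>h \<nu>\<^sub>h :: "real^'d \<Rightarrow> real"
    and q q\<^sub>h :: "real^'d \<Rightarrow> real^'d"
  assumes "CARD('d) = 2 \<or> CARD('d) = 3"
    and "polyhedral_lipschitz_domain \<Omega>"
    and "\<And>h. h > 0 \<Longrightarrow> conforming_mesh \<Omega> (T h)"
    and "shape_regular_family T"
    and "p \<ge> 1"
    and "f \<in> L2_on \<Omega>"
    and "u\<^sub>D \<in> H_half_boundary \<Omega>"
    and "model_solution \<Omega> f u\<^sub>D u q"
    and "h > 0"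
    and "mfem_solution \<Omega> (T h) p f u\<^sub>D u\<^sub>h q\<^sub>h"
    and "rm_solution \<Omega> (T h) p u\<^sub>h q\<^sub>h \<nu>\<^sub>h"
  shows "\<forall>K\<in>T h.
    norm_on K (\<lambda>x. u x - \<nu>\<^sub>h x) \<le>
      diameter K / pi *
        (norm_on K (\<lambda>x. q x - q\<^sub>h x) +
         norm_on K (weak_grad (interior K) (\<lambda>x. u x - L2_proj K (p + 1) u x))) +
      norm_on K (\<lambda>x. u\<^sub>h x - L2_proj K (p - 1) u x) +
      norm_on K (\<lambda>x. u x - L2_proj K (p + 1) u x)"
proof
  fix K assume KT: "K \<in> T h"
  have mesh: "conforming_mesh \<Omega> (T h)" using assms(3,9) by blast
  have lip: "lipschitz_domain \<Omega>" using assms(2) by (simp add: polyhedral_lipschitz_domain_def)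
  have "int DIM(real^'d) simplex K" using mesh KT by (simp add: conforming_mesh_def)
  note K = full_dimensional_simplex[OF this]
  have K\<Omega>: "K \<subseteq> closure \<Omega>" using mesh KT by (auto simp: conforming_mesh_def)
  have int\<Omega>: "interior K \<subseteq> \<Omega>"
    using interior_mono[OF K\<Omega>] lipschitz_domain_interior_closure[OF lip] by blast
  have \<Omega>m: "\<Omega> \<in> sets lebesgue" using lip by (simp add: lipschitz_domain_def)
  have Km: "K \<in> sets lebesgue" "interior K \<in> sets lebesgue" using lmeasurable_compact[OF K(1)] by auto
  \<comment> \<open>\<Omega> is open, so faces of \<open>K\<close> on its frontier lie outside it.
    They are null, which lets integrability and integrals pass between \<Omega>, the interior of
    \<open>K\<close> and \<open>K\<close>.\<close>
  have neg: "negligible (interior K - K \<union> (K - interior K))"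
    by (rule negligible_subset[OF negligible_convex_frontier[OF K(2)]])
       (use interior_subset[of K] closure_subset[of K] in \<open>auto simp: frontier_def\<close>)
  have pos: "measure lebesgue K > 0"
  proof -
    have "\<not> negligible K" using K(4) open_not_negligible[OF open_interior] negligible_subset interior_subset by metis
    then show ?thesis using lmeasurable_compact[OF K(1)] by (simp add: negligible_iff_measure zero_less_measure_iff)
  qed
  have restrict: "k \<in> L2_on K" if "k \<in> L2_on \<Omega>" for k :: "real^'d \<Rightarrow> 'b::euclidean_space"
    using L2_on_spike_set[OF L2_on_subset[OF that int\<Omega> \<Omega>m Km(2)] Km(2,1) neg] .
  have inner_int: "inner_on K a b = inner_on (interior K) a b" for a b :: "real^'d \<Rightarrow> real^'d"
    unfolding L2_inner_def by (rule integral_lebesgue_on_spike_set[OF Km(1,2)]) (use neg in \<open>simp add: Un_commute\<close>)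
  have uw: "has_weak_grad \<Omega> u (weak_grad \<Omega> u)"
  proof -
    obtain G where "has_weak_grad \<Omega> u G" using assms(8) by (auto simp: model_solution_def H1_def)
    then show ?thesis by (rule has_weak_grad_weak_grad)
  qed
  have uL: "u \<in> L2_on \<Omega>" "weak_grad \<Omega> u \<in> L2_on \<Omega>" using uw by (auto simp: has_weak_grad_def)
  have qL: "q \<in> L2_on \<Omega>" using assms(8) by (auto simp: model_solution_def Hdiv_def has_weak_div_def)
  have qhL: "q\<^sub>h \<in> L2_on \<Omega>" using assms(10) by (auto simp: mfem_solution_def Hdiv_polys_def Hdiv_def has_weak_div_def)
  have uhL: "u\<^sub>h \<in> L2_on \<Omega>" using assms(10) by (auto simp: mfem_solution_def broken_polys_def)
  have \<nu>L: "\<nu>\<^sub>h \<in> L2_on \<Omega>" using assms(11) by (auto simp: rm_solution_def broken_polys_def)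
  obtain w where w: "AE x in lebesgue_on K. \<nu>\<^sub>h x = w x"
    and min: "is_arg_min (\<lambda>w. 1/2 * (discrete_dual_norm K (p + 2) (\<lambda>x. q\<^sub>h x + grad w x))\<^sup>2) (\<lambda>w. w \<in> polys (p + 1)) w"
    and mean: "inner_on K \<nu>\<^sub>h (\<lambda>_. 1) = inner_on K u\<^sub>h (\<lambda>_. 1)"
    using assms(11) KT unfolding rm_solution_def by blast
  define P where "P = L2_proj K (p + 1) u"
  have P: "smooth P" unfolding P_def using L2_proj(1)[OF K(1) restrict[OF uL(1)]] by (rule polys_smooth)
  define g where "g = weak_grad (interior K) (\<lambda>x. u x - P x)"
  \<comment> \<open>One of two weak gradients of the same function on the interior of
    \<open>K\<close>: this one comes from \<Omega> and is tied to \<open>q\<close>, while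
    \<open>g\<close> is the representative in the claim. \<open>flux\<close> exchanges them under
    the integral.\<close>
  have wg: "has_weak_grad (interior K) (\<lambda>x. u x - P x) (\<lambda>x. weak_grad \<Omega> u x - grad P x)"
    using has_weak_grad_subset[OF uw int\<Omega> Km(2) \<Omega>m] P compact_imp_bounded[OF K(1)] Km(2)
    by (intro has_weak_grad_diff_smooth) (auto intro: bounded_interior)
  then have g: "has_weak_grad (interior K) (\<lambda>x. u x - P x) g"
    unfolding g_def by (rule has_weak_grad_weak_grad)
  have gL: "g \<in> L2_on K"
    by (rule L2_on_spike_set[OF _ Km(2,1) neg]) (use g in \<open>simp add: has_weak_grad_def\<close>)
  have orth: "inner_on K (\<lambda>x. q\<^sub>h x + grad w x) (grad v) = 0" if "v \<in> polys (p + 1)" for v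
    by (rule residual_minimizer_orthogonal[OF K(1) pos _ _ restrict[OF qhL] min that]) auto
  have flux: "inner_on K q (grad v) = - inner_on K g (grad v) - inner_on K (grad P) (grad v)"
    if "v \<in> polys (p + 1)" for v
  proof -
    have v: "smooth v" using that by (rule polys_smooth)
    have L: "grad v \<in> L2_on K" "grad P \<in> L2_on K" "weak_grad \<Omega> u \<in> L2_on K" "q \<in> L2_on K"
      using grad_L2_on[OF K(1)] v P restrict uL qL by auto
    have "AE x in lebesgue. x \<in> \<Omega> \<longrightarrow> q x = - weak_grad \<Omega> u x"
      using assms(8) \<Omega>m by (simp add: model_solution_def AE_restrict_space_iff)
    moreover have "AE x in lebesgue. x \<notin> K - interior K"
      using negligible_subset[OF neg, of "K - interior K"] by (intro AE_not_in) (auto simp: negligible_iff_null_sets)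
    ultimately have "AE x in lebesgue. x \<in> K \<longrightarrow> q x = - weak_grad \<Omega> u x"
      by eventually_elim (use int\<Omega> in blast)
    then have ae: "AE x in lebesgue_on K. q x = 0 - weak_grad \<Omega> u x"
      using Km(1) by (simp add: AE_restrict_space_iff)
    have "inner_on K q (grad v) = inner_on K (\<lambda>x. 0 - weak_grad \<Omega> u x) (grad v)"
      by (rule L2_inner_cong_AE[OF L(4) L2_diff[OF L2_zero L(3)] ae L(1)])
    also have "\<dots> = - inner_on K (weak_grad \<Omega> u) (grad v)"
      by (simp add: L2_inner_def)
    also have "inner_on K (weak_grad \<Omega> u) (grad v)
        = inner_on K (\<lambda>x. weak_grad \<Omega> u x - grad P x) (grad v) + inner_on K (grad P) (grad v)"
      using L2_inner_diff_left[OF L(3,2,1)] by simp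
    also have "inner_on K (\<lambda>x. weak_grad \<Omega> u x - grad P x) (grad v) = inner_on K g (grad v)"
      unfolding inner_int by (rule weak_grad_inner_unique[OF K(3,1) wg g v])
    finally show ?thesis by simp
  qed
  show "norm_on K (\<lambda>x. u x - \<nu>\<^sub>h x) \<le>
      diameter K / pi *
        (norm_on K (\<lambda>x. q x - q\<^sub>h x) +
         norm_on K (weak_grad (interior K) (\<lambda>x. u x - L2_proj K (p + 1) u x))) +
      norm_on K (\<lambda>x. u\<^sub>h x - L2_proj K (p - 1) u x) +
      norm_on K (\<lambda>x. u x - L2_proj K (p + 1) u x)"
    unfolding P_def[symmetric] g_def[symmetric]
    using postprocessing_estimate[OF K(1,2) pos restrict[OF uL(1)] restrict[OF uhL] restrict[OF qL]
        restrict[OF qhL] gL restrict[OF \<nu>L] _ w mean orth flux[unfolded P_def], of "p - 1"] min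
    by (simp add: P_def is_arg_min_def)
qed

end
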